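(* Assume that the Markov independence assumption and the analyticity assumption stated in the context are satisfied (with the associated $\delta$, $\tilde C_0$, $\Psi_0$). Suppose also that $\sum_{k=0}^\infty\kappa_1^k\,\mathbb E(\tilde C_0^2(X_k)e^{-2\nu S_k})<\infty$, and that $$\sum_{k=0}^\infty\kappa_1^k\,\mathbb E\big[\tilde C_0(X_k)\Psi_0(X_k)e^{-(2\nu-\delta)S_k}+\Psi_0^2(X_k)e^{-2(\nu-\delta)S_k}\big]<\infty,$$ $$\sum_{k=0}^\infty\kappa_1^k\,\mathbb E\big[(\tilde C_0(X_k)+\Psi_0(X_k)+k)e^{-(\nu+\delta)S_k}\big]<\infty.$$ Then, for any $t>0$ and $\tau\ge0$, $\mathbb E(N_tN_{t+\tau})<\infty$, and there exist positive constants $a$ and $\epsilon_1$, independent of $t$ and $\tau$, such that for all sufficiently large $t$ and all $\tau\ge0$ $$\mathbb E(N_tN_{t+\tau})=e^{\nu(2t+\tau)}\,\kappa_2\sum_{k=0}^\infty\kappa_1^k\,\mathbb E\big(\tilde C_0^2(X_k)e^{-2\nu S_k}\big)\,\big[1+c_{t,\tau}\,e^{-\epsilon_1t}\big]\quad\text{with }|c_{t,\tau}|\le a.$$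
   Context: Branching model. $(\mathbb X,\mathcal X)$ is a measurable space, $\xi:\mathbb X\to[0,+\infty)$ and $\kappa:\mathbb X\to\{2,3,\dots\}$ are measurable functions, and $(X_n)_{n\ge 0}$ is an $\mathbb X$-valued process. Cells are labelled by finite sequences $v=(k_1,\dots,k_n)$ of positive integers ($n$ is the generation of $v$; the empty sequence labels the single initial cell, born at time $0$). To each label $v$ is attached an $\mathbb X$-valued random variable $X_v$ in such a way that, along every infinite line of descent $(v_n)_{n\ge0}$ ($v_0=\emptyset$ and $v_{n+1}$ is obtained from $v_n$ by appending one positive integer), the process $(X_{v_n})_{n\ge 0}$ has the same law as $(X_n)_{n\ge 0}$. A cell $v$ has lifetime $\xi(X_v)$ and at the end of its lifetime it splits into $\kappa(X_v)$ new cells, labelled by appending $1,\dots,\kappa(X_v)$ to $v$. $N_t$ is the number of cells alive at time $t$ (a cell being alive from its birth time, included, to its death time, excluded). $S_n:=\sum_{j=0}^n\xi(X_j)$ and $\nu:=\inf\big\{\gamma>0:\ \sum_{n\ge0}\mathbb E\big[(\prod_{j=0}^{n-1}\kappa(X_j))(\kappa(X_n)-1)e^{-\gamma S_n}\big]<\infty\big\}$. Markov independence assumption. (1) For each integer $k\ge0$ there is a process $X^{(k)}=(X^{(k)}_n)_{n\ge0}$ (defined jointly with $X=(X_n)_{n\ge0}$) such that $(X^{(k)}_n)_{0\le n\le k}=(X_n)_{0\le n\le k}$ a.s., $X^{(k)}$ has the same law as $X$, and, for every pair of lines of cells coinciding up to the $k$-th generation but not at the $(k+1)$-th generation, the corresponding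 pair of sequences of parameters has the same distribution as $(X,X^{(k)})$. (2) $(X_n)_n$ is a stationary Markov process; $(\kappa(X_n))_n$ is a sequence of i.i.d. square integrable random variables with expectation $\kappa_1$, independent of $(\xi(X_n))_n$; for all $k\ge0$, $(X^{(k)}_n)_{n\ge k+1}$ and $(X_n)_{n\ge k+1}$ are independent given $X_k$; and $$\forall x\in\mathbb X,\quad\nu=\inf\Big\{\gamma>0:\ \sum_{n\ge0}\kappa_1^n\,\mathbb E\big[e^{-\gamma S_{n+1}}\,\big|\,X_0=x\big]<\infty\Big\}<\infty.$$ Set $\kappa_2:=\mathbb E[\kappa(X_1)(\kappa(X_1)-1)]$. Analyticity assumption. Let $f_{x,0}(t)=(\kappa_1-1)e^{-\nu t}\sum_{n\ge0}\kappa_1^n\,\mathbb P(S_{n+1}-S_0\le t\,|\,X_0=x)$ and, for $\gamma>0$, $\tilde f_{x,0}(\gamma)=\int_0^\infty e^{-\gamma t}f_{x,0}(t)\,dt=\frac{\kappa_1-1}{\gamma+\nu}\sum_{n\ge0}\kappa_1^n\,\mathbb E[e^{-(\gamma+\nu)(S_{n+1}-S_0)}|X_0=x]$. There exist positive reals $\delta<\nu$ and $\epsilon$ such that, for every $x\in\mathbb X$, the Laplace transform $\tilde f_{x,0}$, extended on the complex plane, satisfies: (1) it is analytic in $\{z=u+iy:|u|<\delta+\epsilon,\ y\in\mathbb R\}\setminus\{0\}$; (2) it has a simple pole at $0$, with residue denoted $\tilde C_0(x)$; (3) $\int_{-\infty}^{+\infty}|\tilde f_{x,0}(\delta+iy)|\,dy<\infty$;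 (4) $\lim_{y\to\pm\infty}\tilde f_{x,0}(u+iy)=0$ uniformly in $u\in[-\delta,\delta]$; (5) $\Psi_0(x):=\int_{-\infty}^{+\infty}|\tilde f_{x,0}(-\delta+iy)|\,dy<\infty$.
   Formalization: Added for every k: (κ(X_n))_n is independent of (κ(X^{(k)}_n))_{n>k}, and the pair of κ-sequences of (X, X^{(k)}) is independent of the pair of ξ-sequences; otherwise the formula can fail, e.g. when sibling cells share their offspring number. *)

theory Defs
  imports "HOL-Probability.Probability" "HOL-Complex_Analysis.Complex_Analysis"
begin

section \<open>The branching model\<close>

abbreviation path_space :: "'x measure \<Rightarrow> (nat \<Rightarrow> 'x) measure" where
  "path_space E \<equiv> PiM UNIV (\<lambda>_::nat. E)"

definition life_sum :: "('x \<Rightarrow> real) \<Rightarrow> (nat \<Rightarrow> 'x) \<Rightarrow> nat \<Rightarrow> real" where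
  "life_sum \<xi> w n = (\<Sum>j\<le>n. \<xi> (w j))"

text \<open>
  Cells are labelled by finite lists of positive integers, children being obtained by appending
  at the end.  An infinite line of descent is given by a sequence \<open>l\<close> of positive integers; its
  cell of generation \<open>n\<close> is \<open>ancestor l n\<close>.  The parameter \<open>Y v\<close> is attached to every label,
  whether or not the corresponding cell is ever born.
\<close>

definition labels :: "nat list set" where
  "labels = lists {1..}"

definition lines :: "(nat \<Rightarrow> nat) set" where
  "lines = {l. \<forall>i. 1 \<le> l i}"

definition ancestor :: "(nat \<Rightarrow> nat) \<Rightarrow> nat \<Rightarrow> nat list" where
  "ancestor l n = map l [0..<n]"

text \<open>
  The reference process \<open>X\<close> lives on \<open>P\<close>, the family \<open>Y\<close> of cell parameters on \<open>T\<close>.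
\<close>

definition branching_model ::
  "'x measure \<Rightarrow> ('x \<Rightarrow> real) \<Rightarrow> ('x \<Rightarrow> nat) \<Rightarrow> 'p measure \<Rightarrow> (nat \<Rightarrow> 'p \<Rightarrow> 'x)
    \<Rightarrow> 't measure \<Rightarrow> (nat list \<Rightarrow> 't \<Rightarrow> 'x) \<Rightarrow> bool" where
  "branching_model E \<xi> \<kappa> P X T Y \<longleftrightarrow>
     prob_space P \<and> prob_space T \<and>
     \<xi> \<in> E \<rightarrow>\<^sub>M borel \<and> (\<forall>x\<in>space E. 0 \<le> \<xi> x) \<and>
     \<kappa> \<in> E \<rightarrow>\<^sub>M count_space UNIV \<and> (\<forall>x\<in>space E. 2 \<le> \<kappa> x) \<and>
     (\<forall>n. X n \<in> P \<rightarrow>\<^sub>M E) \<and>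
     (\<forall>v\<in>labels. Y v \<in> T \<rightarrow>\<^sub>M E) \<and>
     (\<forall>l\<in>lines. distr T (path_space E) (\<lambda>\<omega> n. Y (ancestor l n) \<omega>)
                  = distr P (path_space E) (\<lambda>\<omega> n. X n \<omega>))"

definition cell_born :: "('x \<Rightarrow> nat) \<Rightarrow> (nat list \<Rightarrow> 't \<Rightarrow> 'x) \<Rightarrow> nat list \<Rightarrow> 't \<Rightarrow> bool" where
  "cell_born \<kappa> Y v \<omega> \<longleftrightarrow> (\<forall>i<length v. 1 \<le> v ! i \<and> v ! i \<le> \<kappa> (Y (take i v) \<omega>))"

definition birth_time :: "('x \<Rightarrow> real) \<Rightarrow> (nat list \<Rightarrow> 't \<Rightarrow> 'x) \<Rightarrow> nat list \<Rightarrow> 't \<Rightarrow> real" where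
  "birth_time \<xi> Y v \<omega> = (\<Sum>i<length v. \<xi> (Y (take i v) \<omega>))"

definition alive_at ::
  "('x \<Rightarrow> real) \<Rightarrow> ('x \<Rightarrow> nat) \<Rightarrow> (nat list \<Rightarrow> 't \<Rightarrow> 'x) \<Rightarrow> real \<Rightarrow> 't \<Rightarrow> nat list set" where
  "alive_at \<xi> \<kappa> Y t \<omega> =
     {v. cell_born \<kappa> Y v \<omega> \<and> birth_time \<xi> Y v \<omega> \<le> t \<and> t < birth_time \<xi> Y v \<omega> + \<xi> (Y v \<omega>)}"

text \<open>The population size is a priori possibly infinite, hence the counting measure
  rather than \<open>card\<close>.\<close>

definition pop ::
  "('x \<Rightarrow> real) \<Rightarrow> ('x \<Rightarrow> nat) \<Rightarrow> (nat list \<Rightarrow> 't \<Rightarrow> 'x) \<Rightarrow> real \<Rightarrow> 't \<Rightarrow> ennreal" where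
  "pop \<xi> \<kappa> Y t \<omega> = emeasure (count_space UNIV) (alive_at \<xi> \<kappa> Y t \<omega>)"

definition pop_moment ::
  "('x \<Rightarrow> real) \<Rightarrow> ('x \<Rightarrow> nat) \<Rightarrow> 't measure \<Rightarrow> (nat list \<Rightarrow> 't \<Rightarrow> 'x) \<Rightarrow> real \<Rightarrow> real \<Rightarrow> ennreal" where
  "pop_moment \<xi> \<kappa> T Y t \<tau> = (\<integral>\<^sup>+ \<omega>. pop \<xi> \<kappa> Y t \<omega> * pop \<xi> \<kappa> Y (t + \<tau>) \<omega> \<partial>T)"

definition malthus ::
  "('x \<Rightarrow> real) \<Rightarrow> ('x \<Rightarrow> nat) \<Rightarrow> 'p measure \<Rightarrow> (nat \<Rightarrow> 'p \<Rightarrow> 'x) \<Rightarrow> ereal" where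
  "malthus \<xi> \<kappa> P X =
     (INF \<gamma>\<in>{\<gamma>::real. 0 < \<gamma> \<and>
        (\<Sum>n. \<integral>\<^sup>+ \<omega>. ennreal ((\<Prod>j<n. real (\<kappa> (X j \<omega>))) * (real (\<kappa> (X n \<omega>)) - 1)
                 * exp (- \<gamma> * life_sum \<xi> (\<lambda>j. X j \<omega>) n)) \<partial>P) < \<infinity>}. ereal \<gamma>)"

definition kappa1 :: "('x \<Rightarrow> nat) \<Rightarrow> 'p measure \<Rightarrow> (nat \<Rightarrow> 'p \<Rightarrow> 'x) \<Rightarrow> real" where
  "kappa1 \<kappa> P X = (\<integral>\<omega>. real (\<kappa> (X 0 \<omega>)) \<partial>P)"

definition kappa2 :: "('x \<Rightarrow> nat) \<Rightarrow> 'p measure \<Rightarrow> (nat \<Rightarrow> 'p \<Rightarrow> 'x) \<Rightarrow> real" where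
  "kappa2 \<kappa> P X = (\<integral>\<omega>. real (\<kappa> (X 1 \<omega>)) * (real (\<kappa> (X 1 \<omega>)) - 1) \<partial>P)"


section \<open>The Markov independence assumption\<close>

text \<open>Conditional independence of two random elements given the sigma-algebra generated by a
  third one.\<close>

definition cond_indep_given ::
  "'p measure \<Rightarrow> 'g measure \<Rightarrow> ('p \<Rightarrow> 'g) \<Rightarrow> 'a measure \<Rightarrow> ('p \<Rightarrow> 'a) \<Rightarrow> 'b measure \<Rightarrow> ('p \<Rightarrow> 'b) \<Rightarrow> bool"
  where
  "cond_indep_given P G Z A U B V \<longleftrightarrow>
     (let F = vimage_algebra (space P) Z G in
      \<forall>a\<in>sets A. \<forall>b\<in>sets B. AE \<omega> in P.
        real_cond_exp P F (\<lambda>\<omega>. indicator a (U \<omega>) * indicator b (V \<omega>)) \<omega>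
        = real_cond_exp P F (\<lambda>\<omega>. indicator a (U \<omega>)) \<omega> * real_cond_exp P F (\<lambda>\<omega>. indicator b (V \<omega>)) \<omega>)"

text \<open>
  \<open>Q x\<close> is the law of the whole path given \<open>X\<^sub>0 = x\<close>, defined for every \<open>x\<close>.  The Markov property
  states that, given \<open>X\<^sub>0, \<dots>, X\<^sub>k\<close>, the law of \<open>(X\<^sub>k, X\<^bsub>k+1\<^esub>, \<dots>)\<close> is \<open>Q X\<^sub>k\<close>, the kernel being the
  same for all \<open>k\<close>; the case \<open>k = 0\<close> says that \<open>Q\<close> is a version of the conditional law.
  \<open>Stationary\<close> is understood as stationarity of the transition mechanism.  Invariance of the law
  of \<open>X\<close> under the shift is not required; shift-invariant chains are a special case.
\<close>

definition stationary_markov ::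
  "'x measure \<Rightarrow> 'p measure \<Rightarrow> (nat \<Rightarrow> 'p \<Rightarrow> 'x) \<Rightarrow> ('x \<Rightarrow> (nat \<Rightarrow> 'x) measure) \<Rightarrow> bool" where
  "stationary_markov E P X Q \<longleftrightarrow>
     Q \<in> E \<rightarrow>\<^sub>M prob_algebra (path_space E) \<and>
     (\<forall>x\<in>space E. AE w in Q x. w 0 = x) \<and>
     (\<forall>k. \<forall>B\<in>sets (path_space E). AE \<omega> in P.
        real_cond_exp P
          (vimage_algebra (space P) (\<lambda>\<omega>. \<lambda>i\<in>{..k}. X i \<omega>) (PiM {..k} (\<lambda>_. E)))
          (\<lambda>\<omega>. indicator B (\<lambda>n. X (k + n) \<omega>)) \<omega>
        = measure (Q (X k \<omega>)) B)"

definition coupled_lines ::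
  "'x measure \<Rightarrow> 'p measure \<Rightarrow> (nat \<Rightarrow> 'p \<Rightarrow> 'x) \<Rightarrow> (nat \<Rightarrow> nat \<Rightarrow> 'p \<Rightarrow> 'x)
    \<Rightarrow> 't measure \<Rightarrow> (nat list \<Rightarrow> 't \<Rightarrow> 'x) \<Rightarrow> bool" where
  "coupled_lines E P X X' T Y \<longleftrightarrow>
     (\<forall>k. (\<forall>n. X' k n \<in> P \<rightarrow>\<^sub>M E) \<and>
          (AE \<omega> in P. \<forall>n\<le>k. X' k n \<omega> = X n \<omega>) \<and>
          distr P (path_space E) (\<lambda>\<omega> n. X' k n \<omega>) = distr P (path_space E) (\<lambda>\<omega> n. X n \<omega>) \<and>
          (\<forall>l\<in>lines. \<forall>l'\<in>lines. ancestor l k = ancestor l' k \<and> ancestor l (Suc k) \<noteq> ancestor l' (Suc k) \<longrightarrow>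
             distr T (path_space E \<Otimes>\<^sub>M path_space E)
               (\<lambda>\<omega>. (\<lambda>n. Y (ancestor l n) \<omega>, \<lambda>n. Y (ancestor l' n) \<omega>))
             = distr P (path_space E \<Otimes>\<^sub>M path_space E)
               (\<lambda>\<omega>. (\<lambda>n. X n \<omega>, \<lambda>n. X' k n \<omega>))))"

text \<open>
  The offspring numbers are independent of the lifetimes, and are i.i.d.; the last two conjuncts
  spell this out along two lines of descent: the offspring numbers of distinct
  cells of the pair \<open>(X, X' k)\<close> are independent, and jointly independent of all lifetimes of the
  pair.  This does not follow from the one-line version together with conditional independence
  given \<open>X\<^sub>k\<close>: if \<open>x\<close> also encodes the number of children of the daughter cells, then siblings
  share their offspring number, and the factor \<open>E[\<kappa>\<^sup>2] / \<kappa>\<^sub>1\<^sup>2\<close> appears in the second moment of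
  the population size.
\<close>

definition independent_offspring ::
  "('x \<Rightarrow> real) \<Rightarrow> ('x \<Rightarrow> nat) \<Rightarrow> 'p measure \<Rightarrow> (nat \<Rightarrow> 'p \<Rightarrow> 'x) \<Rightarrow> (nat \<Rightarrow> nat \<Rightarrow> 'p \<Rightarrow> 'x) \<Rightarrow> bool" where
  "independent_offspring \<xi> \<kappa> P X X' \<longleftrightarrow>
     prob_space.indep_vars P (\<lambda>_. count_space UNIV) (\<lambda>n \<omega>. \<kappa> (X n \<omega>)) UNIV \<and>
     (\<forall>n. distr P (count_space UNIV) (\<lambda>\<omega>. \<kappa> (X n \<omega>)) = distr P (count_space UNIV) (\<lambda>\<omega>. \<kappa> (X 0 \<omega>))) \<and>
     integrable P (\<lambda>\<omega>. (real (\<kappa> (X 0 \<omega>)))\<^sup>2) \<and>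
     prob_space.indep_var P
       (path_space (count_space UNIV)) (\<lambda>\<omega> n. \<kappa> (X n \<omega>))
       (path_space borel) (\<lambda>\<omega> n. \<xi> (X n \<omega>)) \<and>
     (\<forall>k. prob_space.indep_var P
       (path_space (count_space UNIV)) (\<lambda>\<omega> n. \<kappa> (X n \<omega>))
       (path_space (count_space UNIV)) (\<lambda>\<omega> n. \<kappa> (X' k (Suc k + n) \<omega>))) \<and>
     (\<forall>k. prob_space.indep_var P
       (path_space (count_space UNIV) \<Otimes>\<^sub>M path_space (count_space UNIV))
         (\<lambda>\<omega>. (\<lambda>n. \<kappa> (X n \<omega>), \<lambda>n. \<kappa> (X' k n \<omega>)))
       (path_space borel \<Otimes>\<^sub>M path_space borel)
         (\<lambda>\<omega>. (\<lambda>n. \<xi> (X n \<omega>), \<lambda>n. \<xi> (X' k n \<omega>))))"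

definition malthus_given ::
  "('x \<Rightarrow> real) \<Rightarrow> real \<Rightarrow> ('x \<Rightarrow> (nat \<Rightarrow> 'x) measure) \<Rightarrow> 'x \<Rightarrow> ereal" where
  "malthus_given \<xi> \<kappa>\<^sub>1 Q x =
     (INF \<gamma>\<in>{\<gamma>::real. 0 < \<gamma> \<and>
        (\<Sum>n. ennreal (\<kappa>\<^sub>1 ^ n) * (\<integral>\<^sup>+ w. ennreal (exp (- \<gamma> * life_sum \<xi> w (Suc n))) \<partial>Q x)) < \<infinity>}. ereal \<gamma>)"

definition markov_independence ::
  "'x measure \<Rightarrow> ('x \<Rightarrow> real) \<Rightarrow> ('x \<Rightarrow> nat) \<Rightarrow> 'p measure \<Rightarrow> (nat \<Rightarrow> 'p \<Rightarrow> 'x) \<Rightarrow> (nat \<Rightarrow> nat \<Rightarrow> 'p \<Rightarrow> 'x)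
    \<Rightarrow> ('x \<Rightarrow> (nat \<Rightarrow> 'x) measure) \<Rightarrow> 't measure \<Rightarrow> (nat list \<Rightarrow> 't \<Rightarrow> 'x) \<Rightarrow> bool" where
  "markov_independence E \<xi> \<kappa> P X X' Q T Y \<longleftrightarrow>
     coupled_lines E P X X' T Y \<and>
     stationary_markov E P X Q \<and>
     independent_offspring \<xi> \<kappa> P X X' \<and>
     (\<forall>k. cond_indep_given P E (X k)
            (path_space E) (\<lambda>\<omega> n. X' k (Suc k + n) \<omega>)
            (path_space E) (\<lambda>\<omega> n. X (Suc k + n) \<omega>)) \<and>
     (\<forall>x\<in>space E. malthus \<xi> \<kappa> P X = malthus_given \<xi> (kappa1 \<kappa> P X) Q x
                    \<and> malthus_given \<xi> (kappa1 \<kappa> P X) Q x < \<infinity>)"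


section \<open>The analyticity assumption\<close>

definition f0 :: "('x \<Rightarrow> real) \<Rightarrow> real \<Rightarrow> real \<Rightarrow> ('x \<Rightarrow> (nat \<Rightarrow> 'x) measure) \<Rightarrow> 'x \<Rightarrow> real \<Rightarrow> real" where
  "f0 \<xi> \<kappa>\<^sub>1 \<nu> Q x t =
     (\<kappa>\<^sub>1 - 1) * exp (- \<nu> * t) *
     (\<Sum>n. \<kappa>\<^sub>1 ^ n * measure (Q x) {w \<in> space (Q x). life_sum \<xi> w (Suc n) - life_sum \<xi> w 0 \<le> t})"

definition laplace_f0 ::
  "('x \<Rightarrow> real) \<Rightarrow> real \<Rightarrow> real \<Rightarrow> ('x \<Rightarrow> (nat \<Rightarrow> 'x) measure) \<Rightarrow> 'x \<Rightarrow> real \<Rightarrow> real" where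
  "laplace_f0 \<xi> \<kappa>\<^sub>1 \<nu> Q x \<gamma> = (LINT t:{0..}|lborel. exp (- \<gamma> * t) * f0 \<xi> \<kappa>\<^sub>1 \<nu> Q x t)"

text \<open>
  \<open>\<Phi> x\<close> denotes the extension of the Laplace transform to the complex plane.  It is determined on
  the punctured strip by its analyticity there and its values on the positive reals, so the
  residue at \<open>0\<close> is automatically real.
\<close>

definition C0 :: "('x \<Rightarrow> complex \<Rightarrow> complex) \<Rightarrow> 'x \<Rightarrow> real" where
  "C0 \<Phi> x = Re (residue (\<Phi> x) 0)"

definition Psi0 :: "('x \<Rightarrow> complex \<Rightarrow> complex) \<Rightarrow> real \<Rightarrow> 'x \<Rightarrow> ennreal" where
  "Psi0 \<Phi> \<delta> x = (\<integral>\<^sup>+ y. ennreal (cmod (\<Phi> x (Complex (- \<delta>) y))) \<partial>lborel)"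

definition analyticity ::
  "'x measure \<Rightarrow> ('x \<Rightarrow> real) \<Rightarrow> real \<Rightarrow> real \<Rightarrow> ('x \<Rightarrow> (nat \<Rightarrow> 'x) measure)
    \<Rightarrow> ('x \<Rightarrow> complex \<Rightarrow> complex) \<Rightarrow> real \<Rightarrow> real \<Rightarrow> bool" where
  "analyticity E \<xi> \<kappa>\<^sub>1 \<nu> Q \<Phi> \<delta> \<epsilon> \<longleftrightarrow>
     0 < \<delta> \<and> \<delta> < \<nu> \<and> 0 < \<epsilon> \<and>
     (\<forall>x\<in>space E.
        (\<forall>\<gamma>>0. \<Phi> x (complex_of_real \<gamma>) = complex_of_real (laplace_f0 \<xi> \<kappa>\<^sub>1 \<nu> Q x \<gamma>)) \<and>
        \<Phi> x analytic_on ({z. \<bar>Re z\<bar> < \<delta> + \<epsilon>} - {0}) \<and>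
        is_pole (\<Phi> x) 0 \<and> zorder (\<Phi> x) 0 = -1 \<and>
        (\<integral>\<^sup>+ y. ennreal (cmod (\<Phi> x (Complex \<delta> y))) \<partial>lborel) < \<infinity> \<and>
        uniform_limit {-\<delta>..\<delta>} (\<lambda>y u. \<Phi> x (Complex u y)) (\<lambda>_. 0) at_top \<and>
        uniform_limit {-\<delta>..\<delta>} (\<lambda>y u. \<Phi> x (Complex u y)) (\<lambda>_. 0) at_bot \<and>
        Psi0 \<Phi> \<delta> x < \<infinity>)"

end

theory Submission
  imports Defs "HOL-Library.Sublist"
begin

text \<open>
  Write \<open>N\<^sub>t N\<^bsub>t+\<tau>\<^esub>\<close> as a sum over pairs of labels.  Comparable labels contribute at most the mean
  population at time \<open>t + \<tau>\<close>, which is of lower order.  A pair of labels that branches at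
  generation \<open>k\<close> is described by the pair \<open>(X, X' k)\<close>; as offspring numbers are independent of
  lifetimes, summing over labels gives \<open>\<kappa>\<^sub>1\<^sup>k \<kappa>\<^sub>2\<close> times the expectation of
  \<open>h (t - S\<^sub>k) h (t + \<tau> - S\<^sub>k)\<close>, where \<open>h s = 1 + exp (\<nu> s) f s\<close> for \<open>s \<ge> 0\<close>, \<open>h s = 0\<close> for
  \<open>s < 0\<close>, and \<open>f\<close> is \<open>f0\<close> at the state \<open>X\<^sub>k\<close>.

  Laplace inversion on the abscissa \<open>\<delta>\<close>, followed by a shift of the contour to \<open>- \<delta>\<close> across the
  pole at \<open>0\<close>, gives \<open>\<bar>f s - C0\<bar> \<le> Psi0 exp (- \<delta> s)\<close>.  This holds for negative \<open>s\<close> too, where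
  \<open>f s = 0\<close>, so that it also controls the part of the leading term carried by \<open>{S\<^sub>k > t}\<close>.  The
  three summability hypotheses then bound the error terms.
\<close>

section \<open>Laplace transforms\<close>

text \<open>The function \<open>h\<close> comes from summation by parts. In generation
  \<open>a\<close> below a child, the mean number of living cells is
  \<open>\<kappa>\<^sub>1 ^ a\<close> times a difference of two probabilities; resumming leaves an
  indicator plus \<open>\<kappa>\<^sub>1 - 1\<close> times the series that defines
  \<open>f0\<close>. The factor \<open>\<kappa>\<^sub>2\<close> is the mean number of ordered pairs
  of distinct children of one cell. Two obstacles shape the analytic half. The complex extension is
  tied to \<open>f\<close> only on the positive reals, so it must first be identified on the
  abscissa \<open>\<delta>\<close>. And the expansion of \<open>f s\<close> is needed at every
  \<open>s\<close>, since \<open>s\<close> becomes \<open>t - S\<^sub>k\<close>, whose law may have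
  atoms; this is available because \<open>exp (\<nu> * s) * f s\<close> is monotone. The leading
  constant is positive because the residue is a limit of nonnegative reals and the pole is simple.
  The rate \<open>\<epsilon>\<^sub>1\<close> is the smaller of \<open>\<delta>\<close>, the decay of
  \<open>f\<close> towards its limit, and \<open>\<nu> - \<delta>\<close>, left over from the terms
  of the product of two \<open>h\<close> that are not quadratic in \<open>f\<close>.\<close>

lemma laplace_power_series:
  fixes f :: "real \<Rightarrow> real" and c :: real and w :: complex
  assumes [measurable]: "f \<in> borel_measurable borel"
    and nonneg: "\<And>t. 0 \<le> f t" and neg: "\<And>t. t < 0 \<Longrightarrow> f t = 0"
    and int: "\<And>\<gamma>. 0 < \<gamma> \<Longrightarrow> integrable lborel (\<lambda>t. exp (- \<gamma> * t) * f t)"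
    and w: "w \<in> ball (of_real c) c"
  shows "(\<lambda>n. (\<integral>t. complex_of_real ((- t) ^ n / fact n * (exp (- c * t) * f t)) \<partial>lborel)
            * (w - of_real c) ^ n)
         sums (\<integral>t. exp (- w * of_real t) * of_real (f t) \<partial>lborel)"
    and "integrable lborel (\<lambda>t. exp (- w * of_real t) * complex_of_real (f t))"
proof -
  define r where "r = cmod (w - of_real c)"
  have r: "0 \<le> r" "r < c" using w by (auto simp: r_def dist_norm norm_minus_commute)
  define h where "h = (\<lambda>n t. complex_of_real ((- t) ^ n / fact n * (exp (- c * t) * f t)) * (w - of_real c) ^ n)"
  have [measurable]: "h n \<in> borel_measurable lborel" for n unfolding h_def by measurable
  \<comment> \<open>The modulus of \<open>(- t) ^ n\<close> is \<open>t ^ n\<close> only for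
    \<open>t \<ge> 0\<close>; for \<open>t < 0\<close> both sides vanish with
    \<open>f\<close>.\<close>
  have norm_h: "norm (h n t) = (r * t) ^ n / fact n * (exp (- c * t) * f t)" for n t
    using nonneg[of t] neg[of t]
    by (cases "t < 0") (auto simp: h_def norm_mult norm_power norm_divide r_def abs_mult power_mult_distrib)
  \<comment> \<open>The moduli add up to an exponential with the smaller rate \<open>c - r\<close>.
    As \<open>r < c\<close>, the sum is integrable; it bounds each term and all partial sums of the
    norms, which permits termwise integration.\<close>
  have norm_sums: "(\<lambda>n. norm (h n t)) sums (exp (- (c - r) * t) * f t)" for t
  proof -
    have "(\<lambda>n. (r * t) ^ n / fact n * (exp (- c * t) * f t)) sums (exp (r * t) * (exp (- c * t) * f t))"
      by (intro sums_mult2) (use exp_converges[of "r * t"] in \<open>simp add: field_simps scaleR_conv_of_real\<close>)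
    moreover have "exp (r * t) * (exp (- c * t) * f t) = exp (- (c - r) * t) * f t"
      by (simp add: left_diff_distrib exp_diff exp_minus field_simps)
    ultimately show ?thesis by (simp only: norm_h)
  qed
  have sums: "(\<lambda>n. h n t) sums (exp (- w * of_real t) * of_real (f t))" for t
  proof -
    have "(\<lambda>n. (- of_real t * (w - of_real c)) ^ n / fact n * complex_of_real (exp (- c * t) * f t))
        sums (exp (- of_real t * (w - of_real c)) * complex_of_real (exp (- c * t) * f t))"
      by (intro sums_mult2) (use exp_converges[of "- of_real t * (w - of_real c)"] in
           \<open>simp add: field_simps scaleR_conv_of_real\<close>)
    moreover have "exp (- of_real t * (w - of_real c)) * complex_of_real (exp (- c * t) * f t)
       = exp (- w * of_real t) * of_real (f t)"
      by (simp add: exp_of_real[symmetric] exp_add[symmetric] right_diff_distrib mult.assoc[symmetric]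
            del: exp_of_real) (simp add: mult_ac)
    moreover have "(- of_real t * (w - of_real c)) ^ n / fact n * complex_of_real (exp (- c * t) * f t) = h n t" for n
      by (simp only: h_def power_mult_distrib of_real_mult of_real_divide of_real_power of_real_minus
            of_real_fact) (simp add: mult_ac)
    ultimately show ?thesis by (simp only:)
  qed
  have inti: "integrable lborel (h n)" for n
  proof (rule Bochner_Integration.integrable_bound[OF int[of "c - r"]])
    have "norm (h n t) \<le> exp (- (c - r) * t) * f t" for t
      using sum_le_suminf[OF sums_summable[OF norm_sums[of t]], of "{n}"] sums_unique[OF norm_sums[of t]] by auto
    then show "AE t in lborel. norm (h n t) \<le> norm (exp (- (c - r) * t) * f t)"
      using nonneg by (intro AE_I2) (simp add: abs_mult)
  qed (use r in auto)
  have sm: "summable (\<lambda>n. \<integral>t. norm (h n t) \<partial>lborel)"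
  proof (rule summableI_nonneg_bounded)
    fix n
    have "(\<Sum>i<n. \<integral>t. norm (h i t) \<partial>lborel) = (\<integral>t. (\<Sum>i<n. norm (h i t)) \<partial>lborel)"
      by (intro Bochner_Integration.integral_sum[symmetric]) (use inti in auto)
    also have "\<dots> \<le> (\<integral>t. exp (- (c - r) * t) * f t \<partial>lborel)"
    proof (intro integral_mono int)
      fix t show "(\<Sum>i<n. norm (h i t)) \<le> exp (- (c - r) * t) * f t"
        using sum_le_suminf[OF sums_summable[OF norm_sums[of t]], of "{..<n}"] sums_unique[OF norm_sums[of t]] by auto
    qed (use r inti in auto)
    finally show "(\<Sum>i<n. \<integral>t. norm (h i t) \<partial>lborel) \<le> (\<integral>t. exp (- (c - r) * t) * f t \<partial>lborel)" .
  qed simp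
  have eq: "(\<Sum>n. h n t) = exp (- w * of_real t) * of_real (f t)" for t
    using sums_unique[OF sums[of t]] by simp
  have a: "AE t in lborel. summable (\<lambda>n. norm (h n t))" using norm_sums sums_summable by blast
  have "(\<lambda>n. integral\<^sup>L lborel (h n)) sums (\<integral>t. (\<Sum>n. h n t) \<partial>lborel)"
    by (rule sums_integral[OF inti a sm])
  moreover have "integral\<^sup>L lborel (h n) =
      (\<integral>t. complex_of_real ((- t) ^ n / fact n * (exp (- c * t) * f t)) \<partial>lborel) * (w - of_real c) ^ n" for n
    unfolding h_def by (rule integral_mult_left_zero)
  ultimately show "(\<lambda>n. (\<integral>t. complex_of_real ((- t) ^ n / fact n * (exp (- c * t) * f t)) \<partial>lborel)
            * (w - of_real c) ^ n)
         sums (\<integral>t. exp (- w * of_real t) * of_real (f t) \<partial>lborel)"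
    by (simp add: eq)
  show "integrable lborel (\<lambda>t. exp (- w * of_real t) * complex_of_real (f t))"
    using integrable_suminf[OF inti a sm] by (simp add: eq)
qed

text \<open>Discs with centre and radius \<open>c > 0\<close> touch the imaginary axis at 0 and
  increase to the whole right half-plane, so power series on them reach every point of it.\<close>

lemma half_plane_in_ball:
  fixes z :: complex
  assumes "0 < Re z"
  obtains c where "0 < c" "z \<in> ball (of_real c) c"
proof
  \<comment> \<open>The condition \<open>|z - c| < c\<close> reads
    \<open>|z|^2 < 2 * c * Re z\<close>; this choice makes the right side twice the left.\<close>
  define c where "c = (cmod z)\<^sup>2 / Re z"
  have z0: "z \<noteq> 0" using assms by auto
  then show "0 < c" using assms by (simp add: c_def)
  have c: "c * Re z = (cmod z)\<^sup>2" using assms by (simp add: c_def)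
  have "(cmod (z - of_real c))\<^sup>2 = (cmod z)\<^sup>2 - 2 * (c * Re z) + c\<^sup>2"
    by (simp add: cmod_power2 power2_diff algebra_simps)
  also have "\<dots> < c\<^sup>2" using z0 by (simp add: c)
  finally have "cmod (z - of_real c) < c"
    using \<open>0 < c\<close> power_less_imp_less_base by fastforce
  then show "z \<in> ball (of_real c) c" by (simp add: dist_norm norm_minus_commute)
qed

text \<open>Agreement is known only on the positive reals, and the identity theorem spreads it. It
  is applied on a disc of \<open>half_plane_in_ball\<close> cut off at \<open>Re z = b\<close>: an
  intersection of convex sets, hence connected, where the integral is holomorphic through its power
  series.\<close>

lemma laplace_identity:
  fixes f :: "real \<Rightarrow> real" and \<Phi> :: "complex \<Rightarrow> complex"
  assumes f: "f \<in> borel_measurable borel"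
    and nonneg: "\<And>t. 0 \<le> f t" and neg: "\<And>t. t < 0 \<Longrightarrow> f t = 0"
    and int: "\<And>\<gamma>. 0 < \<gamma> \<Longrightarrow> integrable lborel (\<lambda>t. exp (- \<gamma> * t) * f t)"
    and real: "\<And>\<gamma>. 0 < \<gamma> \<Longrightarrow> \<Phi> (of_real \<gamma>) = of_real (\<integral>t. exp (- \<gamma> * t) * f t \<partial>lborel)"
    and holo: "\<Phi> holomorphic_on {z. 0 < Re z \<and> Re z < b}"
    and z: "0 < Re z" "Re z < b"
  shows "\<Phi> z = (\<integral>t. exp (- z * of_real t) * of_real (f t) \<partial>lborel)"
    and "integrable lborel (\<lambda>t. exp (- z * of_real t) * complex_of_real (f t))"
proof -
  obtain c where c: "0 < c" "z \<in> ball (of_real c) c" using half_plane_in_ball z by blast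
  let ?S = "ball (of_real c) c \<inter> {z. Re z < b}"
  let ?F = "\<lambda>z. \<integral>t. exp (- z * of_real t) * complex_of_real (f t) \<partial>lborel"
  show "integrable lborel (\<lambda>t. exp (- z * of_real t) * complex_of_real (f t))"
    by (rule laplace_power_series(2)[OF f nonneg neg int c(2)]) auto
  have FS: "?F holomorphic_on ball (of_real c) c"
    by (rule power_series_holomorphic[OF laplace_power_series(1)[OF f nonneg neg int]]) auto
  have sub: "?S \<subseteq> {z. 0 < Re z \<and> Re z < b}"
  proof
    fix y assume y: "y \<in> ?S"
    then have "\<bar>Re (of_real c - y)\<bar> < c"
      by (metis IntD1 abs_Re_le_cmod dist_norm le_less_trans mem_ball)
    then show "y \<in> {z. 0 < Re z \<and> Re z < b}" using y by auto
  qed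
  \<comment> \<open>The interval from 0 to \<open>m\<close> is the real trace of the cut disc; its
    midpoint is the limit point that the identity theorem asks for.\<close>
  define m where "m = min b (2 * c)"
  have m: "0 < m" using c z by (auto simp: m_def)
  let ?U = "complex_of_real ` {0<..<m}"
  have "\<Phi> z - ?F z = 0"
  proof (rule analytic_continuation[of "\<lambda>z. \<Phi> z - ?F z" ?S ?U "of_real (m/2)"])
    show "(\<lambda>z. \<Phi> z - ?F z) holomorphic_on ?S"
      by (intro holomorphic_intros holomorphic_on_subset[OF holo sub] holomorphic_on_subset[OF FS]) auto
    show "open ?S" by (intro open_Int open_ball open_halfspace_Re_lt)
    show "connected ?S"
      by (intro convex_connected convex_Int convex_ball convex_halfspace_Re_lt)
    show US: "?U \<subseteq> ?S"
      by (auto simp: m_def dist_norm simp flip: of_real_diff)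
    show "complex_of_real (m/2) \<in> ?S"
      by (rule subsetD[OF US imageI]) (use m in simp)
    have "(m/2) islimpt {0<..<m}"
      by (rule islimpt_subset[OF islimpt_greaterThanLessThan2[of 0 "m/2"]]) (use m in auto)
    then show "complex_of_real (m/2) islimpt ?U"
      by (rule islimpt_isCont_image[where f = complex_of_real])
         (simp_all only: isCont_of_real continuous_ident of_real_eq_iff eventually_at_filter, simp_all)
    fix y assume "y \<in> ?U"
    then obtain \<gamma> where \<gamma>: "y = of_real \<gamma>" "0 < \<gamma>" by auto
    have "?F y = (\<integral>t. complex_of_real (exp (- \<gamma> * t) * f t) \<partial>lborel)"
      by (intro Bochner_Integration.integral_cong) (simp_all only: \<gamma> of_real_mult of_real_minus exp_of_real[symmetric] mult.assoc)
    also have "\<dots> = of_real (\<integral>t. exp (- \<gamma> * t) * f t \<partial>lborel)" by (rule integral_complex_of_real)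
    finally show "\<Phi> y - ?F y = 0" using real[OF \<gamma>(2)] \<gamma>(1) by (simp only: diff_self)
  qed (use c z in auto)
  then show "\<Phi> z = ?F z" by simp
qed

section \<open>Pointwise Fourier inversion for an exponential times a monotone function\<close>

lemma iexp_diff_quotient_tendsto:
  fixes a \<eta> :: "nat \<Rightarrow> real" and s t :: real
  assumes a: "a \<longlonglongrightarrow> s" and \<eta>: "\<eta> \<longlonglongrightarrow> 0" "\<And>n. \<eta> n \<noteq> 0" and t: "t \<noteq> 0"
  shows "(\<lambda>n. (iexp (- (t * a n)) - iexp (- (t * (a n + \<eta> n)))) / (\<i> * t) / of_real (\<eta> n))
     \<longlonglongrightarrow> iexp (- (t * s))"
proof -
  have "((\<lambda>z. exp z) has_field_derivative exp 0) (at (0::complex))" by (rule DERIV_exp)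
  then have e: "((\<lambda>z. (exp z - 1) / z) \<longlongrightarrow> 1) (at (0::complex))"
    by (simp add: has_field_derivative_iff)
  \<comment> \<open>With this \<open>z n\<close> the quotient is \<open>iexp (- (t * a n))\<close>
    times \<open>(exp z - 1) / z\<close>. Letting the base point vary together with the step covers
    intervals on either side of \<open>s\<close>.\<close>
  define z where "z n = - (\<i> * of_real (t * \<eta> n))" for n
  have z0: "z n \<noteq> 0" for n using t \<eta>(2)[of n] by (simp add: z_def)
  have "z \<longlonglongrightarrow> - (\<i> * of_real (t * 0))" unfolding z_def by (intro tendsto_intros \<eta>)
  then have "filterlim z (at 0) sequentially" using z0 by (simp add: filterlim_at)
  then have "(\<lambda>n. (exp (z n) - 1) / z n) \<longlonglongrightarrow> 1" by (rule filterlim_compose[OF e])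
  moreover have "(\<lambda>n. iexp (- (t * a n))) \<longlonglongrightarrow> iexp (- (t * s))" by (intro tendsto_intros a)
  ultimately have "(\<lambda>n. iexp (- (t * a n)) * ((exp (z n) - 1) / z n)) \<longlonglongrightarrow> iexp (- (t * s)) * 1"
    by (intro tendsto_mult)
  moreover have "iexp (- (t * a n)) * ((exp (z n) - 1) / z n) =
     (iexp (- (t * a n)) - iexp (- (t * (a n + \<eta> n)))) / (\<i> * t) / of_real (\<eta> n)" for n
  proof -
    have "iexp (- (t * (a n + \<eta> n))) = iexp (- (t * a n)) * exp (z n)"
      by (simp add: z_def exp_add[symmetric] ring_distribs)
    then have "iexp (- (t * a n)) - iexp (- (t * (a n + \<eta> n))) = - (iexp (- (t * a n)) * (exp (z n) - 1))"
      by (simp add: ring_distribs)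
    moreover have "z n = - (\<i> * t * of_real (\<eta> n))" by (simp add: z_def)
    ultimately show ?thesis by (simp add: divide_simps)
  qed
  ultimately show ?thesis by simp
qed

lemma tendsto_integral_symmetric:
  fixes G :: "real \<Rightarrow> complex"
  assumes int: "integrable lborel G"
  shows "(\<lambda>n. \<integral>y. indicator {-real n..real n} y *\<^sub>R G y \<partial>lborel) \<longlonglongrightarrow> (\<integral>y. G y \<partial>lborel)"
proof (rule integral_dominated_convergence[where w = "\<lambda>y. norm (G y)"])
  show "AE t in lborel. (\<lambda>n. indicator {-real n..real n} t *\<^sub>R G t) \<longlonglongrightarrow> G t"
  proof (rule AE_I2)
    fix t :: real
    obtain N where N: "\<bar>t\<bar> \<le> real N" using real_arch_simple by blast
    show "(\<lambda>n. indicator {-real n..real n} t *\<^sub>R G t) \<longlonglongrightarrow> G t"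
      by (rule tendsto_eventually, rule eventually_sequentiallyI[of N])
         (use N in \<open>auto simp: indicator_def abs_le_iff\<close>)
  qed
  show "integrable lborel (\<lambda>y. norm (G y))" using int by auto
  show "(\<lambda>y. indicator {-real n..real n} y *\<^sub>R G y) \<in> borel_measurable lborel" for n
    using int by measurable
  show "G \<in> borel_measurable lborel" using int by auto
qed (auto simp: indicator_def)

text \<open>
  Levy's inversion formula recovers the primitive of \<open>h\<close>; its difference quotients converge by
  dominated convergence, and the monotonicity of \<open>g\<close> turns this into an identity valid at every
  point, not merely almost everywhere.
\<close>

lemma fourier_inversion_mono:
  fixes g :: "real \<Rightarrow> real" and c :: real
  defines "h \<equiv> \<lambda>s. exp (- c * s) * g s"
  defines "\<phi> \<equiv> \<lambda>y. \<integral>s. iexp (y * s) * of_real (h s) \<partial>lborel"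
  assumes g: "mono g" "\<And>s. 0 \<le> g s" and h: "integrable lborel h" and c: "0 \<le> c"
    and \<phi>: "integrable lborel \<phi>" and pos: "0 < (\<integral>s. h s \<partial>lborel)"
  shows "h s = Re (1 / (2 * pi) * (\<integral>y. iexp (- (y * s)) * \<phi> y \<partial>lborel))"
proof -
  define Z where "Z = (\<integral>s. h s \<partial>lborel)"
  have Z: "0 < Z" using pos by (simp add: Z_def)
  have h0: "0 \<le> h s" for s using g by (simp add: h_def)
  have [measurable]: "h \<in> borel_measurable borel" using h by auto
  have [measurable]: "\<phi> \<in> borel_measurable borel" using \<phi> by auto
  \<comment> \<open>Levy's formula concerns probability measures, hence the normalisation by
    \<open>Z\<close>. Having a density, \<open>M\<close> charges no point, so every pair of
    endpoints is admissible.\<close>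
  define M where "M = density lborel (\<lambda>s. ennreal (h s / Z))"
  have nnZ: "(\<integral>\<^sup>+ s. ennreal (h s / Z) \<partial>lborel) = 1"
  proof -
    have "(\<integral>\<^sup>+ s. ennreal (h s / Z) \<partial>lborel) = ennreal (\<integral>s. h s / Z \<partial>lborel)"
      using h h0 Z by (intro nn_integral_eq_integral) auto
    then show ?thesis using Z by (simp add: Z_def)
  qed
  interpret prob_space M
    by (rule prob_spaceI) (simp add: M_def emeasure_density nnZ)
  interpret real_distribution M
    by standard (simp_all add: M_def)
  have null: "measure M {x} = 0" for x
  proof -
    have "emeasure M {x} = (\<integral>\<^sup>+ s. ennreal (h s / Z) * indicator {x} s \<partial>lborel)"
      by (simp add: M_def emeasure_density)
    also have "\<dots> = 0" using AE_lborel_singleton[of x]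
      by (intro nn_integral_0_iff_AE[THEN iffD2]) (auto simp: indicator_def)
    finally show ?thesis by (simp add: measure_def)
  qed
  have char: "char M y = \<phi> y / Z" for y
  proof -
    have "char M y = (\<integral>s. (h s / Z) *\<^sub>R iexp (y * s) \<partial>lborel)"
      unfolding char_def M_def using h0 Z by (intro integral_density) auto
    also have "\<dots> = (\<integral>s. (iexp (y * s) * of_real (h s)) / Z \<partial>lborel)"
      by (intro Bochner_Integration.integral_cong) (auto simp: scaleR_conv_of_real)
    also have "\<dots> = \<phi> y / Z" unfolding \<phi>_def by (rule integral_divide_zero)
    finally show ?thesis .
  qed
  define F where "F = (\<lambda>a b t :: real. (iexp (- (t * a)) - iexp (- (t * b))) / (\<i> * t))"
  have [measurable]: "F a b \<in> borel_measurable borel" for a b unfolding F_def by measurable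
  \<comment> \<open>Uniform in the frequency and proportional to the length of the interval: after
    division by that length \<open>\<phi>\<close> is still a dominating function.\<close>
  have F_bound: "cmod (F a b t) \<le> b - a" if "a \<le> b" for a b t
  proof (cases "t = 0")
    case False
    have "iexp (- (t * a)) - iexp (- (t * b)) = - (iexp ((- t) * b) - iexp ((- t) * a))" by simp
    then show ?thesis using Levy_Inversion_aux2[OF that, of "- t"] False
      by (simp add: F_def norm_divide norm_minus_commute)
  qed (use that in \<open>simp add: F_def\<close>)
  have int_F: "integrable lborel (\<lambda>t. F a b t * \<phi> t)" if "a \<le> b" for a b
  proof (rule Bochner_Integration.integrable_bound)
    show "integrable lborel (\<lambda>t. (b - a) *\<^sub>R \<phi> t)" using \<phi> by simp
    show "AE t in lborel. norm (F a b t * \<phi> t) \<le> norm ((b - a) *\<^sub>R \<phi> t)"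
      using F_bound[OF that] that by (intro AE_I2) (simp add: norm_mult mult_right_mono)
  qed simp
  have primitive: "complex_of_real (LINT s:{a<..b}|lborel. h s) = 1 / (2 * pi) * (\<integral>t. F a b t * \<phi> t \<partial>lborel)"
    if ab: "a \<le> b" for a b
  proof -
    have meas: "measure M {a<..b} = (LINT s:{a<..b}|lborel. h s) / Z"
    proof -
      have "emeasure M {a<..b} = (\<integral>\<^sup>+ s. ennreal (h s / Z * indicator {a<..b} s) \<partial>lborel)"
        by (subst M_def, subst emeasure_density)
           (auto intro!: nn_integral_cong simp: indicator_def)
      also have "\<dots> = ennreal (\<integral>s. h s / Z * indicator {a<..b} s \<partial>lborel)"
        using h h0 Z
        by (intro nn_integral_eq_integral integrable_real_mult_indicator) auto
      also have "(\<integral>s. h s / Z * indicator {a<..b} s \<partial>lborel) = (\<integral>s. (indicator {a<..b} s *\<^sub>R h s) / Z \<partial>lborel)"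
        by (intro Bochner_Integration.integral_cong) auto
      also have "\<dots> = (LINT s:{a<..b}|lborel. h s) / Z"
        unfolding set_lebesgue_integral_def by (rule integral_divide_zero)
      finally show ?thesis using Z h0
        by (simp add: measure_def set_lebesgue_integral_def integral_nonneg_AE)
    qed
    have "(\<lambda>n. 1 / (2 * pi) * (CLBINT t=-real n..real n. F a b t * char M t)) \<longlonglongrightarrow> measure M {a<..b}"
      using Levy_Inversion[OF ab null null] by (simp add: F_def)
    \<comment> \<open>Levy's formula yields a limit of symmetric integrals; integrability of the
      product with \<open>\<phi>\<close> turns it into an integral over the line.\<close>
    moreover have "(\<lambda>n. CLBINT t=-real n..real n. F a b t * char M t) \<longlonglongrightarrow> (\<integral>t. F a b t * char M t \<partial>lborel)"
    proof -
      have eq: "(CLBINT t=-real n..real n. F a b t * char M t)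
         = (\<integral>t. indicator {-real n..real n} t *\<^sub>R (F a b t * char M t) \<partial>lborel)" for n
        by (subst interval_integral_Icc) (auto simp: set_lebesgue_integral_def)
      have "integrable lborel (\<lambda>t. F a b t * char M t)" using int_F[OF ab] by (simp add: char)
      then show ?thesis unfolding eq by (rule tendsto_integral_symmetric)
    qed
    ultimately have "complex_of_real (measure M {a<..b}) = 1 / (2 * pi) * (\<integral>t. F a b t * char M t \<partial>lborel)"
      by (rule LIMSEQ_unique[OF _ tendsto_mult[OF tendsto_const]])
    also have "(\<integral>t. F a b t * char M t \<partial>lborel) = (\<integral>t. (F a b t * \<phi> t) / Z \<partial>lborel)" by (simp add: char)
    also have "\<dots> = (\<integral>t. F a b t * \<phi> t \<partial>lborel) / Z" by (rule integral_divide_zero)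
    finally show ?thesis using Z by (simp add: meas field_simps)
  qed
  define L where "L = 1 / (2 * pi) * (\<integral>y. iexp (- (y * s)) * \<phi> y \<partial>lborel)"
  have quotient: "(\<lambda>n. (LINT s:{a n<..a n + \<eta> n}|lborel. h s) / \<eta> n) \<longlonglongrightarrow> Re L"
    if a: "a \<longlonglongrightarrow> s" and \<eta>: "\<eta> \<longlonglongrightarrow> 0" "\<And>n. \<eta> n > 0" for a \<eta> :: "nat \<Rightarrow> real"
  proof -
    have "(\<lambda>n. \<integral>t. F (a n) (a n + \<eta> n) t * \<phi> t / \<eta> n \<partial>lborel) \<longlonglongrightarrow> (\<integral>t. iexp (- (t * s)) * \<phi> t \<partial>lborel)"
    proof (rule integral_dominated_convergence[where w = "\<lambda>t. norm (\<phi> t)"])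
      show "integrable lborel (\<lambda>t. norm (\<phi> t))" using \<phi> by auto
      have "(\<lambda>n. F (a n) (a n + \<eta> n) t * \<phi> t / \<eta> n) \<longlonglongrightarrow> iexp (- (t * s)) * \<phi> t" if "t \<noteq> 0" for t
        using tendsto_mult_right[OF iexp_diff_quotient_tendsto[OF a \<eta>(1) _ that], of "\<phi> t"] \<eta>(2)
        by (simp add: F_def less_imp_neq[symmetric] divide_inverse mult_ac)
      then show "AE t in lborel. (\<lambda>n. F (a n) (a n + \<eta> n) t * \<phi> t / \<eta> n) \<longlonglongrightarrow> iexp (- (t * s)) * \<phi> t"
        using AE_lborel_singleton[of 0] by auto
      show "AE t in lborel. norm (F (a n) (a n + \<eta> n) t * \<phi> t / \<eta> n) \<le> norm (\<phi> t)" for n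
      proof (rule AE_I2)
        fix t
        have "cmod (F (a n) (a n + \<eta> n) t) \<le> \<eta> n" using F_bound[of "a n" "a n + \<eta> n" t] \<eta>(2)[of n] by simp
        then show "norm (F (a n) (a n + \<eta> n) t * \<phi> t / \<eta> n) \<le> norm (\<phi> t)"
          using \<eta>(2)[of n] mult_right_mono[of "cmod (F (a n) (a n + \<eta> n) t)" "\<eta> n" "norm (\<phi> t)"]
          by (simp add: norm_mult norm_divide divide_simps mult.commute)
      qed
    qed auto
    then have "(\<lambda>n. 1 / (2 * pi) * (\<integral>t. F (a n) (a n + \<eta> n) t * \<phi> t / \<eta> n \<partial>lborel)) \<longlonglongrightarrow> L"
      unfolding L_def by (intro tendsto_intros)
    moreover have "1 / (2 * pi) * (\<integral>t. F (a n) (a n + \<eta> n) t * \<phi> t / \<eta> n \<partial>lborel)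
      = complex_of_real ((LINT s:{a n<..a n + \<eta> n}|lborel. h s) / \<eta> n)" for n
      using primitive[of "a n" "a n + \<eta> n"] \<eta>(2)[of n] by (simp add: integral_divide_zero)
    ultimately have "(\<lambda>n. complex_of_real ((LINT s:{a n<..a n + \<eta> n}|lborel. h s) / \<eta> n)) \<longlonglongrightarrow> L" by simp
    from tendsto_Re[OF this] show ?thesis by simp
  qed
  define \<eta> where "\<eta> n = 1 / real (Suc n)" for n
  have \<eta>: "\<eta> \<longlonglongrightarrow> 0" "\<And>n. \<eta> n > 0"
    unfolding \<eta>_def using LIMSEQ_inverse_real_of_nat by (auto simp: inverse_eq_divide)
  have set_int: "set_integrable lborel {a<..b} h" for a b
    unfolding set_integrable_def using h by (intro integrable_mult_indicator) auto
  have const: "(LINT u:{a<..b}|lborel. k) = (b - a) * k" "set_integrable lborel {a<..b} (\<lambda>_. k)"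
    if "a \<le> b" for a b k :: real
    using that by (auto simp: set_lebesgue_integral_def set_integrable_def)
  \<comment> \<open>Just to the right of \<open>s\<close> the factor \<open>g\<close> is at least
    \<open>g s\<close> and the exponential at least its value at the right end, so the averages give
    \<open>h s \<le> Re L\<close>. The averages just to the left give the reverse
    inequality.\<close>
  have "(\<lambda>n. exp (- c * (s + \<eta> n)) * g s) \<longlonglongrightarrow> exp (- c * (s + 0)) * g s"
    by (intro tendsto_intros \<eta>)
  moreover have "exp (- c * (s + \<eta> n)) * g s \<le> (LINT s:{s<..s + \<eta> n}|lborel. h s) / \<eta> n" for n
  proof -
    have "(LINT u:{s<..s + \<eta> n}|lborel. exp (- c * (s + \<eta> n)) * g s) \<le> (LINT u:{s<..s + \<eta> n}|lborel. h u)"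
      unfolding h_def
      by (intro set_integral_mono const set_int[unfolded h_def] mult_mono)
         (use \<eta>(2)[of n] c g in \<open>auto intro: mult_left_mono monoD less_imp_le\<close>)
    then show ?thesis using \<eta>(2)[of n] by (simp add: const field_simps)
  qed
  ultimately have "exp (- c * (s + 0)) * g s \<le> Re L"
    by (intro LIMSEQ_le[OF _ quotient[of "\<lambda>_. s" \<eta>]]) (use \<eta> in auto)
  moreover have "(\<lambda>n. exp (- c * (s - \<eta> n)) * g s) \<longlonglongrightarrow> exp (- c * (s - 0)) * g s"
    by (intro tendsto_intros \<eta>)
  moreover have "exp (- c * (s - \<eta> n)) * g s \<ge> (LINT s:{s - \<eta> n<..(s - \<eta> n) + \<eta> n}|lborel. h s) / \<eta> n" for n
  proof -
    have "(LINT u:{s - \<eta> n<..s}|lborel. exp (- c * (s - \<eta> n)) * g s) \<ge> (LINT u:{s - \<eta> n<..s}|lborel. h u)"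
      unfolding h_def
      by (intro set_integral_mono const set_int[unfolded h_def] mult_mono)
         (use \<eta>(2)[of n] c g in \<open>auto intro: mult_left_mono monoD less_imp_le\<close>)
    then show ?thesis using \<eta>(2)[of n] by (simp add: const field_simps)
  qed
  moreover have "(\<lambda>n. s - \<eta> n) \<longlonglongrightarrow> s" using tendsto_diff[OF tendsto_const \<eta>(1), of s] by simp
  ultimately have "h s = Re L"
    using LIMSEQ_le[OF quotient[of "\<lambda>n. s - \<eta> n" \<eta>]] \<eta> unfolding h_def
    by (intro antisym) auto
  then show ?thesis by (simp add: L_def)
qed

section \<open>Shift of the contour across the simple pole\<close>

lemma residue_mult_exp:
  assumes \<Phi>: "\<Phi> holomorphic_on S - {0}" "open S" "0 \<in> S"
    and pole: "is_pole \<Phi> 0" "zorder \<Phi> 0 = -1"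
  shows "residue (\<lambda>z. exp (z * c) * \<Phi> z) 0 = residue \<Phi> 0" and "residue \<Phi> 0 \<noteq> 0"
    and "((\<lambda>w. \<Phi> w * w) \<longlongrightarrow> residue \<Phi> 0) (at 0)"
proof -
  have iso: "isolated_singularity_at \<Phi> 0"
    by (rule isolated_singularity_at_holomorphic[OF \<Phi>])
  have ne: "\<exists>\<^sub>F w in at 0. \<Phi> w \<noteq> 0"
    using non_zero_neighbour_pole[OF pole(1)] by (simp add: eventually_frequently)
  \<comment> \<open>At a pole of order 1, \<open>zor_poly\<close> is \<open>\<Phi> w * w\<close>
    near 0, with nonzero value there. A factor equal to 1 at 0 leaves this limit unchanged.\<close>
  have res: "residue \<Phi> 0 = zor_poly \<Phi> 0 0" by (rule residue_simple_pole[OF iso pole])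
  obtain r where r: "zor_poly \<Phi> 0 0 \<noteq> 0" "0 < r" "zor_poly \<Phi> 0 holomorphic_on cball 0 r"
    "\<And>w. w \<in> cball 0 r - {0} \<Longrightarrow> \<Phi> w = zor_poly \<Phi> 0 w * (w - 0) powi zorder \<Phi> 0"
    using zorder_exist[OF iso _ ne] pole(1) unfolding not_essential_def by blast
  show "residue \<Phi> 0 \<noteq> 0" using r(1) res by simp
  have "isCont (zor_poly \<Phi> 0) 0"
    using r(2,3) by (meson ball_subset_cball centre_in_ball continuous_on_eq_continuous_at
        holomorphic_on_imp_continuous_on holomorphic_on_subset open_ball)
  then have "(zor_poly \<Phi> 0 \<longlongrightarrow> residue \<Phi> 0) (at 0)" by (simp add: isCont_def res)
  moreover have "\<forall>\<^sub>F w in at 0. zor_poly \<Phi> 0 w = \<Phi> w * w"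
    unfolding eventually_at using r pole by (intro exI[of _ r]) (auto simp: power_int_minus)
  ultimately show lim: "((\<lambda>w. \<Phi> w * w) \<longlongrightarrow> residue \<Phi> 0) (at 0)"
    by (rule Lim_transform_eventually)
  show "residue (\<lambda>z. exp (z * c) * \<Phi> z) 0 = residue \<Phi> 0"
  proof (rule residue_simple'[OF \<Phi>(2,3)])
    show "(\<lambda>z. exp (z * c) * \<Phi> z) holomorphic_on S - {0}" by (intro holomorphic_intros \<Phi>)
    have "((\<lambda>w. exp (w * c) * (\<Phi> w * w)) \<longlongrightarrow> exp (0 * c) * residue \<Phi> 0) (at 0)"
      by (intro tendsto_intros lim)
    then show "((\<lambda>w. exp (w * c) * \<Phi> w * (w - 0)) \<longlongrightarrow> residue \<Phi> 0) (at 0)"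
      by (simp add: mult.assoc)
  qed
qed

text \<open>Contour integrals along vertical segments are expressed by Henstock-Kurzweil integrals
  over an interval; this connects them with the Lebesgue integral over the line.\<close>

lemma tendsto_integral_Icc:
  fixes G :: "real \<Rightarrow> complex"
  assumes int: "integrable lborel G"
  shows "(\<lambda>n. integral {-real n..real n} G) \<longlonglongrightarrow> (\<integral>y. G y \<partial>lborel)"
proof -
  have "integral {-real n..real n} G = (\<integral>y. indicator {-real n..real n} y *\<^sub>R G y \<partial>lborel)" for n
  proof -
    have "set_integrable lborel {-real n..real n} G"
      unfolding set_integrable_def using int by (intro integrable_mult_indicator) auto
    from set_borel_integral_eq_integral(2)[OF this] show ?thesis
      by (simp add: set_lebesgue_integral_def)
  qed
  then show ?thesis using tendsto_integral_symmetric[OF int] by simp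
qed

text \<open>Residue theorem on rectangles of half-width \<open>\<delta>\<close> and half-height
  \<open>n\<close>. The horizontal sides keep the length \<open>2 * \<delta>\<close> and
  \<open>exp (z * s)\<close> stays bounded on them, so the uniform decay of \<open>\<Phi>\<close>
  removes them; the vertical sides converge by integrability.\<close>

lemma contour_shift:
  fixes \<Phi> :: "complex \<Rightarrow> complex" and s \<delta> b :: real
  assumes holo: "\<Phi> holomorphic_on {z. \<bar>Re z\<bar> < b} - {0}" and \<delta>: "0 < \<delta>" "\<delta> < b"
    and pole: "is_pole \<Phi> 0" "zorder \<Phi> 0 = -1"
    and int: "integrable lborel (\<lambda>y. \<Phi> (Complex \<delta> y))" "integrable lborel (\<lambda>y. \<Phi> (Complex (-\<delta>) y))"
    and unif: "uniform_limit {-\<delta>..\<delta>} (\<lambda>y u. \<Phi> (Complex u y)) (\<lambda>_. 0) at_top"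
      "uniform_limit {-\<delta>..\<delta>} (\<lambda>y u. \<Phi> (Complex u y)) (\<lambda>_. 0) at_bot"
  shows "(\<integral>y. exp (Complex \<delta> y * s) * \<Phi> (Complex \<delta> y) \<partial>lborel)
    = 2 * pi * residue \<Phi> 0 + (\<integral>y. exp (Complex (-\<delta>) y * s) * \<Phi> (Complex (-\<delta>) y) \<partial>lborel)"
proof -
  define S where "S = {z. \<bar>Re z\<bar> < b}"
  have S_eq: "S = {z. - b < Re z} \<inter> {z. Re z < b}" by (auto simp: S_def abs_less_iff)
  have S: "open S" "connected S" "0 \<in> S"
    unfolding S_eq using \<delta> by (auto intro!: open_Int open_halfspace_Re_gt open_halfspace_Re_lt
        convex_connected convex_Int convex_halfspace_Re_gt convex_halfspace_Re_lt)
  define G where "G z = exp (z * of_real s) * \<Phi> z" for z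
  have G: "G holomorphic_on S - {0}" unfolding G_def S_def by (intro holomorphic_intros holo)
  have resG: "residue G 0 = residue \<Phi> 0"
    unfolding G_def using residue_mult_exp(1)[OF holo[folded S_def] S(1,3) pole] .
  have contG: "continuous_on (S - {0}) G" by (rule holomorphic_on_imp_continuous_on[OF G])
  have lines: "continuous_on UNIV (\<lambda>y. G (Complex u y))" "integrable lborel (\<lambda>y. G (Complex u y))"
    if "u = \<delta> \<or> u = - \<delta>" for u
  proof -
    show cont: "continuous_on UNIV (\<lambda>y. G (Complex u y))"
      by (rule continuous_on_compose2[OF contG])
         (use that \<delta> in \<open>auto simp: S_def Complex_eq intro!: continuous_intros simp: complex_eq_iff\<close>)
    show "integrable lborel (\<lambda>y. G (Complex u y))"
    proof (rule Bochner_Integration.integrable_bound)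
      show "integrable lborel (\<lambda>y. exp (u * s) *\<^sub>R \<Phi> (Complex u y))" using int that by auto
      show "AE y in lborel. norm (G (Complex u y)) \<le> norm (exp (u * s) *\<^sub>R \<Phi> (Complex u y))"
        by (intro AE_I2) (simp add: G_def norm_mult)
      show "(\<lambda>y. G (Complex u y)) \<in> borel_measurable lborel"
        using borel_measurable_continuous_onI[OF cont] by simp
    qed
  qed
  define R L B T where "R n = integral {-real n..real n} (\<lambda>y. G (Complex \<delta> y))"
    and "L n = integral {-real n..real n} (\<lambda>y. G (Complex (-\<delta>) y))"
    and "B n = contour_integral (linepath (Complex (-\<delta>) (-real n)) (Complex \<delta> (-real n))) G"
    and "T n = contour_integral (linepath (Complex \<delta> (real n)) (Complex (-\<delta>) (real n))) G" for n :: nat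
  \<comment> \<open>Sides that avoid the pole: a vertical one at distance \<open>\<delta>\<close>
    from it, or a horizontal one at nonzero height.\<close>
  have seg: "closed_segment (Complex a c) (Complex d e) \<subseteq> S - {0}"
    if "(a = d \<and> \<bar>a\<bar> = \<delta>) \<or> (c = e \<and> c \<noteq> 0)" "\<bar>a\<bar> \<le> \<delta>" "\<bar>d\<bar> \<le> \<delta>" for a c d e
  proof
    fix z assume "z \<in> closed_segment (Complex a c) (Complex d e)"
    then obtain u where u: "0 \<le> u" "u \<le> 1" "z = (1 - u) *\<^sub>R Complex a c + u *\<^sub>R Complex d e"
      by (auto simp: in_segment)
    have re: "Re z = (1 - u) * a + u * d" and im: "Im z = (1 - u) * c + u * e"
      using u by auto
    have "\<bar>Re z\<bar> \<le> (1 - u) * \<delta> + u * \<delta>" unfolding re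
      by (rule order_trans[OF abs_triangle_ineq]) (use u that in \<open>auto simp: abs_mult intro!: add_mono mult_left_mono\<close>)
    then have "\<bar>Re z\<bar> < b" using \<delta> by (simp add: algebra_simps)
    moreover have "z \<noteq> 0"
    proof
      assume "z = 0"
      then have "Re z = 0" "Im z = 0" by auto
      then show False using that(1) re im \<delta> by (auto simp: algebra_simps)
    qed
    ultimately show "z \<in> S - {0}" by (simp add: S_def)
  qed
  have cint: "G contour_integrable_on linepath (Complex a c) (Complex d e)"
    if "(a = d \<and> \<bar>a\<bar> = \<delta>) \<or> (c = e \<and> c \<noteq> 0)" "\<bar>a\<bar> \<le> \<delta>" "\<bar>d\<bar> \<le> \<delta>" for a c d e
    by (rule contour_integrable_continuous_linepath[OF continuous_on_subset[OF contG seg[OF that]]])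
  \<comment> \<open>Along the counterclockwise boundary the vertical sides contribute a factor
    \<open>\<i>\<close>, and the left one is run downwards, hence its minus sign.\<close>
  have key: "B n + \<i> * R n + T n - \<i> * L n = 2 * pi * \<i> * residue \<Phi> 0" if n: "0 < n" for n
  proof -
    let ?a1 = "Complex (-\<delta>) (-real n)" and ?a3 = "Complex \<delta> (real n)"
    have box: "0 \<in> box ?a1 ?a3" using \<delta> n by (simp add: in_box_complex_iff)
    have im: "path_image (rectpath ?a1 ?a3) \<subseteq> S - {0}"
      using \<delta> n by (subst path_image_rectpath) (auto simp: S_def abs_less_iff)
    have out: "\<forall>z. z \<notin> S \<longrightarrow> winding_number (rectpath ?a1 ?a3) z = 0"
    proof (intro allI impI)
      fix z assume "z \<notin> S"
      then show "winding_number (rectpath ?a1 ?a3) z = 0"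
        using \<delta> by (intro winding_number_rectpath_outside) (auto simp: S_def in_cbox_complex_iff abs_less_iff)
    qed
    have "contour_integral (rectpath ?a1 ?a3) G = 2 * pi * \<i> * (\<Sum>p\<in>{0}. winding_number (rectpath ?a1 ?a3) p * residue G p)"
      by (rule Residue_theorem[OF S(1,2) _ G _ _ im out]) auto
    then have 1: "contour_integral (rectpath ?a1 ?a3) G = 2 * pi * \<i> * residue \<Phi> 0"
      by (simp add: winding_number_rectpath[OF box] resG)
    have left: "contour_integral (linepath (Complex (-\<delta>) (real n)) (Complex (-\<delta>) (-real n))) G = - (\<i> * L n)"
    proof -
      have "contour_integral (linepath (Complex (-\<delta>) (real n)) (Complex (-\<delta>) (-real n))) G
        = - contour_integral (linepath (Complex (-\<delta>) (-real n)) (Complex (-\<delta>) (real n))) G"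
        by (rule contour_integral_reverse_linepath, rule continuous_on_subset[OF contG seg]) (use \<delta> in auto)
      also have "contour_integral (linepath (Complex (-\<delta>) (-real n)) (Complex (-\<delta>) (real n))) G = \<i> * L n"
        unfolding L_def using n by (subst contour_integral_linepath_same_Re) auto
      finally show ?thesis .
    qed
    have right: "contour_integral (linepath (Complex \<delta> (-real n)) (Complex \<delta> (real n))) G = \<i> * R n"
      unfolding R_def using n by (subst contour_integral_linepath_same_Re) auto
    have "contour_integral (rectpath ?a1 ?a3) G = B n + (\<i> * R n + (T n + - (\<i> * L n)))"
      unfolding rectpath_def Let_def using \<delta> n
      by (simp add: cint contour_integrable_joinI left right B_def T_def)
    then show ?thesis using 1 by (simp add: algebra_simps)
  qed
  \<comment> \<open>One bound for both horizontal sides: the top runs from \<open>\<delta>\<close>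
    to \<open>- \<delta>\<close> and the bottom runs back, so \<open>a\<close> takes either
    sign.\<close>
  have small: "(\<lambda>n. contour_integral (linepath (Complex a (c n)) (Complex (-a) (c n))) G) \<longlonglongrightarrow> 0"
    if a: "\<bar>a\<bar> = \<delta>" and F: "uniform_limit {-\<delta>..\<delta>} (\<lambda>y u. \<Phi> (Complex u y)) (\<lambda>_. 0) F"
      and c: "filterlim c F sequentially" "\<forall>\<^sub>F n in sequentially. c n \<noteq> 0" for a c F
  proof (rule tendstoI)
    fix e :: real assume e: "0 < e"
    \<comment> \<open>The bound of the exponential times the length of the side, so that
      \<open>e / (2 * K)\<close> for \<open>\<Phi>\<close> leaves \<open>e / 2\<close> for the
      integral.\<close>
    define K where "K = exp (\<delta> * \<bar>s\<bar>) * (2 * \<delta>)"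
    have K: "0 < K" using \<delta> by (simp add: K_def)
    have "\<forall>\<^sub>F n in sequentially. \<forall>u\<in>{-\<delta>..\<delta>}. dist (\<Phi> (Complex u (c n))) 0 < e / (2 * K)"
    proof -
      have "\<forall>\<^sub>F y in F. \<forall>u\<in>{-\<delta>..\<delta>}. dist (\<Phi> (Complex u y)) 0 < e / (2 * K)"
        by (rule uniform_limitD[OF F]) (use e K in simp)
      from eventually_compose_filterlim[OF this c(1)] show ?thesis .
    qed
    from this c(2) show "\<forall>\<^sub>F n in sequentially. dist (contour_integral (linepath (Complex a (c n)) (Complex (-a) (c n))) G) 0 < e"
    proof eventually_elim
      case (elim n)
      have "norm (contour_integral (linepath (Complex a (c n)) (Complex (-a) (c n))) G)
        \<le> (exp (\<delta> * \<bar>s\<bar>) * (e / (2 * K))) * norm (Complex (-a) (c n) - Complex a (c n))"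
      proof (rule contour_integral_bound_linepath)
        show "G contour_integrable_on linepath (Complex a (c n)) (Complex (- a) (c n))"
          by (rule cint) (use a elim in auto)
        show "0 \<le> exp (\<delta> * \<bar>s\<bar>) * (e / (2 * K))" using e K by simp
        fix z assume "z \<in> closed_segment (Complex a (c n)) (Complex (-a) (c n))"
        then obtain u where u: "0 \<le> u" "u \<le> 1" "z = (1 - u) *\<^sub>R Complex a (c n) + u *\<^sub>R Complex (-a) (c n)"
          by (auto simp: in_segment)
        have re: "Re z = (1 - u) * a + u * (-a)" and im: "Im z = c n"
          unfolding u(3) by (simp_all add: left_diff_distrib)
        have "\<bar>Re z\<bar> \<le> (1 - u) * \<delta> + u * \<delta>" unfolding re
          by (rule order_trans[OF abs_triangle_ineq]) (use u a in \<open>auto simp: abs_mult intro!: add_mono mult_left_mono\<close>)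
        then have rz: "\<bar>Re z\<bar> \<le> \<delta>" by (simp add: algebra_simps)
        then have "norm (\<Phi> z) < e / (2 * K)"
          using elim(1)[rule_format, of "Re z"] im by (cases z) (auto simp: abs_le_iff)
        moreover have "Re z * s \<le> \<delta> * \<bar>s\<bar>"
          using mult_mono[OF rz order_refl[of "\<bar>s\<bar>"]] \<delta> by (auto simp: abs_mult[symmetric])
        ultimately show "norm (G z) \<le> exp (\<delta> * \<bar>s\<bar>) * (e / (2 * K))"
          unfolding G_def norm_mult by (intro mult_mono) auto
      qed
      also have "norm (Complex (-a) (c n) - Complex a (c n)) = 2 * \<delta>"
        using a by (simp add: cmod_def real_sqrt_mult)
      also have "exp (\<delta> * \<bar>s\<bar>) * (e / (2 * K)) * (2 * \<delta>) = e / 2" using \<delta> by (simp add: K_def)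
      also have "\<dots> < e" using e by simp
      finally show ?case by simp
    qed
  qed
  have ev: "\<forall>\<^sub>F n in sequentially. real n \<noteq> 0" "\<forall>\<^sub>F n in sequentially. - real n \<noteq> 0"
    using eventually_gt_at_top[of 0] by (auto elim: eventually_mono)
  have "T \<longlonglongrightarrow> 0" unfolding T_def
    by (rule small[OF _ unif(1) filterlim_real_sequentially ev(1)]) (use \<delta> in auto)
  moreover have "B \<longlonglongrightarrow> 0" unfolding B_def
    using small[of "-\<delta>" _ "\<lambda>n. - real n", OF _ unif(2) _ ev(2)] \<delta> filterlim_real_sequentially
    by (simp add: filterlim_uminus_at_bot)
  moreover have "R \<longlonglongrightarrow> (\<integral>y. G (Complex \<delta> y) \<partial>lborel)"
    unfolding R_def by (rule tendsto_integral_Icc) (use lines in auto)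
  moreover have "L \<longlonglongrightarrow> (\<integral>y. G (Complex (-\<delta>) y) \<partial>lborel)"
    unfolding L_def by (rule tendsto_integral_Icc) (use lines in auto)
  ultimately have "(\<lambda>n. B n + \<i> * R n + T n - \<i> * L n) \<longlonglongrightarrow>
      0 + \<i> * (\<integral>y. G (Complex \<delta> y) \<partial>lborel) + 0 - \<i> * (\<integral>y. G (Complex (-\<delta>) y) \<partial>lborel)"
    by (intro tendsto_intros)
  moreover have "(\<lambda>n. B n + \<i> * R n + T n - \<i> * L n) \<longlonglongrightarrow> 2 * pi * \<i> * residue \<Phi> 0"
    by (rule tendsto_eventually, rule eventually_sequentiallyI[of 1]) (use key in simp)
  ultimately have "0 + \<i> * (\<integral>y. G (Complex \<delta> y) \<partial>lborel) + 0 - \<i> * (\<integral>y. G (Complex (-\<delta>) y) \<partial>lborel)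
     = 2 * pi * \<i> * residue \<Phi> 0"
    by (rule LIMSEQ_unique)
  then have "\<i> * ((\<integral>y. G (Complex \<delta> y) \<partial>lborel) - (\<integral>y. G (Complex (-\<delta>) y) \<partial>lborel))
     = \<i> * (2 * pi * residue \<Phi> 0)"
    by (simp add: algebra_simps)
  then have "(\<integral>y. G (Complex \<delta> y) \<partial>lborel) - (\<integral>y. G (Complex (-\<delta>) y) \<partial>lborel) = 2 * pi * residue \<Phi> 0"
    by (simp only: mult_cancel_left complex_i_not_zero simp_thms)
  then show ?thesis unfolding G_def by (simp only: diff_eq_eq)
qed

text \<open>Inversion is applied to \<open>exp (- \<delta> * s) * f s\<close>: it is integrable,
  still an exponential times the monotone \<open>g\<close>, and its Fourier transform is read off
  from \<open>\<Phi>\<close> on the abscissa \<open>\<delta>\<close>. After the shift the kernel has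
  modulus \<open>exp (- \<delta> * s)\<close>, which leaves the integral of the modulus of
  \<open>\<Phi>\<close>.\<close>

lemma laplace_asymptotics:
  fixes g :: "real \<Rightarrow> real" and \<Phi> :: "complex \<Rightarrow> complex" and \<nu> \<delta> \<epsilon> :: real
  defines "f \<equiv> \<lambda>t. exp (- \<nu> * t) * g t"
  assumes g: "mono g" "\<And>t. 0 \<le> g t" "\<And>t. t < 0 \<Longrightarrow> g t = 0" and \<nu>: "0 < \<nu>"
    and int: "\<And>\<gamma>. 0 < \<gamma> \<Longrightarrow> integrable lborel (\<lambda>t. exp (- \<gamma> * t) * f t)"
    and real: "\<And>\<gamma>. 0 < \<gamma> \<Longrightarrow> \<Phi> (of_real \<gamma>) = of_real (\<integral>t. exp (- \<gamma> * t) * f t \<partial>lborel)"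
    and holo: "\<Phi> holomorphic_on {z. \<bar>Re z\<bar> < \<delta> + \<epsilon>} - {0}" and \<delta>: "0 < \<delta>" "0 < \<epsilon>"
    and pole: "is_pole \<Phi> 0" "zorder \<Phi> 0 = -1"
    and right: "(\<integral>\<^sup>+ y. ennreal (cmod (\<Phi> (Complex \<delta> y))) \<partial>lborel) < \<infinity>"
    and left: "(\<integral>\<^sup>+ y. ennreal (cmod (\<Phi> (Complex (-\<delta>) y))) \<partial>lborel) < \<infinity>"
    and unif: "uniform_limit {-\<delta>..\<delta>} (\<lambda>y u. \<Phi> (Complex u y)) (\<lambda>_. 0) at_top"
      "uniform_limit {-\<delta>..\<delta>} (\<lambda>y u. \<Phi> (Complex u y)) (\<lambda>_. 0) at_bot"
  shows "\<bar>f s - Re (residue \<Phi> 0)\<bar> \<le> exp (- \<delta> * s) * enn2real (\<integral>\<^sup>+ y. ennreal (cmod (\<Phi> (Complex (-\<delta>) y))) \<partial>lborel)"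
    and "0 < Re (residue \<Phi> 0)"
proof -
  have [measurable]: "g \<in> borel_measurable borel" by (rule borel_measurable_mono[OF g(1)])
  have [measurable]: "f \<in> borel_measurable borel" unfolding f_def by measurable
  have f0: "0 \<le> f t" "t < 0 \<Longrightarrow> f t = 0" for t using g by (auto simp: f_def)
  let ?S = "{z. \<bar>Re z\<bar> < \<delta> + \<epsilon>}"
  have S_eq: "?S = {z. - (\<delta> + \<epsilon>) < Re z} \<inter> {z. Re z < \<delta> + \<epsilon>}" by (auto simp: abs_less_iff)
  have S: "open ?S" "0 \<in> ?S"
    unfolding S_eq using \<delta> by (auto intro!: open_Int open_halfspace_Re_gt open_halfspace_Re_lt)
  have lim: "((\<lambda>w. \<Phi> w * w) \<longlongrightarrow> residue \<Phi> 0) (at 0)" and ne: "residue \<Phi> 0 \<noteq> 0"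
    using residue_mult_exp(2,3)[OF holo S pole] by auto
  \<comment> \<open>Along \<open>\<gamma> = 1 / (n + 1)\<close> the products
    \<open>\<gamma> * \<Phi> \<gamma>\<close> are integrals of nonnegative functions, up to positive
    factors. The sequence serves \<open>pos\<close> and, at the end, the sign of the
    residue.\<close>
  have lim': "(\<lambda>n. \<Phi> (of_real (1 / real (Suc n))) * of_real (1 / real (Suc n))) \<longlonglongrightarrow> residue \<Phi> 0"
  proof (rule filterlim_compose[OF lim])
    show "filterlim (\<lambda>n. complex_of_real (1 / real (Suc n))) (at 0) sequentially"
      using tendsto_of_real[OF LIMSEQ_inverse_real_of_nat, where 'a = complex]
      by (auto simp: filterlim_at inverse_eq_divide simp del: of_nat_Suc of_real_divide)
  qed
  have cont: "continuous_on UNIV (\<lambda>y. \<Phi> (Complex u y))" if "u = \<delta> \<or> u = - \<delta>" for u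
    by (rule continuous_on_compose2[OF holomorphic_on_imp_continuous_on[OF holo]])
       (use that \<delta> in \<open>auto simp: Complex_eq intro!: continuous_intros simp: complex_eq_iff\<close>)
  have intr: "integrable lborel (\<lambda>y. \<Phi> (Complex u y))" if "u = \<delta> \<or> u = - \<delta>" for u
    using borel_measurable_continuous_onI[OF cont[OF that]] that right left
    by (intro integrableI_bounded) auto
  have holo': "\<Phi> holomorphic_on {z. 0 < Re z \<and> Re z < \<delta> + \<epsilon>}"
    by (rule holomorphic_on_subset[OF holo]) auto
  have lap: "\<Phi> (Complex \<delta> y) = (\<integral>t. exp (- Complex \<delta> y * of_real t) * of_real (f t) \<partial>lborel)" for y
    by (rule laplace_identity(1)[OF _ f0 int real holo']) (use \<delta> in auto)
  define h where "h s = exp (- (\<delta> + \<nu>) * s) * g s" for s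
  have h_eq: "h s = exp (- \<delta> * s) * f s" for s by (simp add: h_def f_def exp_add[symmetric] algebra_simps)
  define \<phi> where "\<phi> y = (\<integral>t. iexp (y * t) * of_real (h t) \<partial>lborel)" for y
  \<comment> \<open>The Fourier kernel has the opposite sign to the Laplace kernel, hence the
    reflected frequency.\<close>
  have \<phi>_eq: "\<phi> y = \<Phi> (Complex \<delta> (- y))" for y
    unfolding \<phi>_def lap
  proof (rule Bochner_Integration.integral_cong[OF refl])
    fix t
    have "exp (- Complex \<delta> (- y) * of_real t) = iexp (y * t) * of_real (exp (- \<delta> * t))"
      unfolding exp_of_real[symmetric] exp_add[symmetric]
      by (rule arg_cong[where f = exp]) (simp add: complex_eq_iff)
    then show "iexp (y * t) * of_real (h t) = exp (- Complex \<delta> (- y) * of_real t) * of_real (f t)"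
      by (simp add: h_eq)
  qed
  \<comment> \<open>Otherwise \<open>f\<close> would vanish almost everywhere and
    \<open>\<Phi>\<close> on the positive reals, against the nonzero residue.\<close>
  have pos: "0 < (\<integral>s. h s \<partial>lborel)"
  proof (rule ccontr)
    assume "\<not> 0 < (\<integral>s. h s \<partial>lborel)"
    moreover have "0 \<le> (\<integral>s. h s \<partial>lborel)" using f0 by (intro integral_nonneg_AE) (auto simp: h_eq)
    ultimately have "(\<integral>s. h s \<partial>lborel) = 0" by simp
    then have "AE s in lborel. h s = 0"
      using int[OF \<delta>(1)] f0 by (subst (asm) integral_nonneg_eq_0_iff_AE) (auto simp: h_eq[abs_def])
    then have ae: "AE s in lborel. f s = 0" by (auto simp: h_eq)
    have "\<Phi> (of_real \<gamma>) = 0" if "0 < \<gamma>" for \<gamma>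
    proof -
      have "(\<integral>t. exp (- \<gamma> * t) * f t \<partial>lborel) = 0"
        using ae by (intro integral_eq_zero_AE) auto
      then show ?thesis using real[OF that] by simp
    qed
    then have "(\<lambda>n. \<Phi> (of_real (1 / real (Suc n))) * of_real (1 / real (Suc n))) \<longlonglongrightarrow> 0"
      by (simp del: of_nat_Suc of_real_divide)
    then have "residue \<Phi> 0 = 0" using lim' LIMSEQ_unique by blast
    then show False using ne by simp
  qed
  have int_h: "integrable lborel h" using int[OF \<delta>(1)] by (simp add: h_eq[abs_def])
  have int_\<phi>: "integrable lborel \<phi>"
    unfolding \<phi>_eq[abs_def] using intr[of \<delta>] lborel_integrable_real_affine[of "\<lambda>y. \<Phi> (Complex \<delta> y)" "-1" 0] by simp
  have inv: "h s = Re (1 / (2 * pi) * (\<integral>y. iexp (- (y * s)) * \<phi> y \<partial>lborel))" for s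
  proof -
    have h: "h = (\<lambda>s. exp (- (\<delta> + \<nu>) * s) * g s)" by (simp add: h_def[abs_def])
    have \<phi>: "\<phi> = (\<lambda>y. \<integral>s. iexp (y * s) * of_real (h s) \<partial>lborel)" by (simp add: \<phi>_def[abs_def])
    show ?thesis unfolding h \<phi>
      by (rule fourier_inversion_mono[OF g(1,2) int_h[unfolded h] _ int_\<phi>[unfolded \<phi>, unfolded h] pos[unfolded h]])
         (use \<delta> \<nu> in simp)
  qed
  define J where "J s = (\<integral>y. exp (Complex (-\<delta>) y * s) * \<Phi> (Complex (-\<delta>) y) \<partial>lborel)" for s :: real
  define \<Psi> where "\<Psi> = enn2real (\<integral>\<^sup>+ y. ennreal (cmod (\<Phi> (Complex (-\<delta>) y))) \<partial>lborel)"
  have f_eq: "f s = Re (residue \<Phi> 0) + Re (J s) / (2 * pi)" for s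
  proof -
    have "(\<integral>y. iexp (- (y * s)) * \<phi> y \<partial>lborel) = (\<integral>y. iexp (- ((- y) * s)) * \<phi> (- y) \<partial>lborel)"
      using lborel_integral_real_affine[of "-1" "\<lambda>y. iexp (- (y * s)) * \<phi> y" 0] by simp
    then have "of_real (exp (\<delta> * s)) * (\<integral>y. iexp (- (y * s)) * \<phi> y \<partial>lborel)
      = (\<integral>y. of_real (exp (\<delta> * s)) * (iexp (- ((- y) * s)) * \<phi> (- y)) \<partial>lborel)"
      by (simp only: integral_mult_right_zero)
    also have "\<dots> = (\<integral>y. exp (Complex \<delta> y * s) * \<Phi> (Complex \<delta> y) \<partial>lborel)"
    proof (rule Bochner_Integration.integral_cong[OF refl])
      fix y
      have "exp (Complex \<delta> y * s) = of_real (exp (\<delta> * s)) * iexp (- ((- y) * s))"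
        unfolding exp_of_real[symmetric] exp_add[symmetric]
        by (rule arg_cong[where f = exp]) (simp add: complex_eq_iff)
      then show "of_real (exp (\<delta> * s)) * (iexp (- ((- y) * s)) * \<phi> (- y)) = exp (Complex \<delta> y * s) * \<Phi> (Complex \<delta> y)"
        by (simp add: \<phi>_eq)
    qed
    also have "\<dots> = 2 * pi * residue \<Phi> 0 + J s" unfolding J_def
      by (rule contour_shift[OF holo \<delta>(1) _ pole intr intr unif]) (use \<delta> in auto)
    finally have *: "of_real (exp (\<delta> * s)) * (\<integral>y. iexp (- (y * s)) * \<phi> y \<partial>lborel) = 2 * pi * residue \<Phi> 0 + J s" .
    have "f s = exp (\<delta> * s) * h s" by (simp add: h_eq exp_minus)
    also have "\<dots> = Re (1 / (2 * pi) * (of_real (exp (\<delta> * s)) * (\<integral>y. iexp (- (y * s)) * \<phi> y \<partial>lborel)))"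
      unfolding inv by (simp add: mult_ac)
    also have "\<dots> = Re (residue \<Phi> 0) + Re (J s) / (2 * pi)"
      unfolding * by (simp add: add_divide_distrib distrib_left)
    finally show ?thesis .
  qed
  have J: "norm (J s) \<le> exp (- \<delta> * s) * \<Psi>" for s
  proof -
    have "norm (J s) \<le> (\<integral>y. norm (exp (Complex (-\<delta>) y * s) * \<Phi> (Complex (-\<delta>) y)) \<partial>lborel)"
      unfolding J_def by (rule integral_norm_bound)
    also have "\<dots> = (\<integral>y. exp (- \<delta> * s) * norm (\<Phi> (Complex (-\<delta>) y)) \<partial>lborel)"
      by (simp add: norm_mult)
    also have "\<dots> = exp (- \<delta> * s) * (\<integral>y. norm (\<Phi> (Complex (-\<delta>) y)) \<partial>lborel)"
      by (rule integral_mult_right_zero)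
    also have "(\<integral>y. norm (\<Phi> (Complex (-\<delta>) y)) \<partial>lborel) = \<Psi>"
      unfolding \<Psi>_def using borel_measurable_continuous_onI[OF cont[of "-\<delta>"]] by (intro integral_eq_nn_integral) auto
    finally show ?thesis .
  qed
  have bound: "\<bar>f s - Re (residue \<Phi> 0)\<bar> \<le> exp (- \<delta> * s) * \<Psi>" for s
  proof -
    \<comment> \<open>The factor \<open>1 / (2 * pi)\<close> of the inversion formula is below 1 and
      is given away.\<close>
    have "1 * \<bar>Re (J s)\<bar> \<le> (2 * pi) * norm (J s)"
      using pi_gt3 by (intro mult_mono abs_Re_le_cmod) auto
    then have "\<bar>Re (J s)\<bar> / (2 * pi) \<le> norm (J s)" by (simp add: field_simps)
    then show ?thesis using J[of s] by (simp add: f_eq)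
  qed
  then show "\<bar>f s - Re (residue \<Phi> 0)\<bar> \<le> exp (- \<delta> * s) * enn2real (\<integral>\<^sup>+ y. ennreal (cmod (\<Phi> (Complex (-\<delta>) y))) \<partial>lborel)"
    by (simp add: \<Psi>_def)
  have eq: "\<Phi> (of_real (1 / real (Suc n))) * of_real (1 / real (Suc n)) = of_real
     ((\<integral>t. exp (- (1 / real (Suc n)) * t) * f t \<partial>lborel) * (1 / real (Suc n)))" for n
    by (subst real) auto
  \<comment> \<open>A limit of nonnegative reals is a nonnegative real; the simple pole excludes
    0.\<close>
  have "Im (residue \<Phi> 0) = 0"
    using LIMSEQ_unique[OF tendsto_Im[OF lim'[unfolded eq]]] by simp
  moreover have "0 \<le> Re (residue \<Phi> 0)"
  proof (rule LIMSEQ_le_const[OF tendsto_Re[OF lim'[unfolded eq]]], intro exI allI impI)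
    fix n show "0 \<le> Re (complex_of_real ((\<integral>t. exp (- (1 / real (Suc n)) * t) * f t \<partial>lborel) * (1 / real (Suc n))))"
      using f0 by (auto intro!: integral_nonneg_AE)
  qed
  ultimately show "0 < Re (residue \<Phi> 0)" using ne by (simp add: complex_eq_iff less_le)
qed

section \<open>Two lines of descent as conditionally independent chains\<close>

text \<open>The hypothesis \<open>rect\<close> says that \<open>K\<close> is a conditional law of
  \<open>V\<close> given \<open>U\<close>, tested on rectangles. These form an intersection-stable
  generator, so the law of the pair is a mixture of the measures \<open>N u\<close>, and integrals
  of arbitrary \<open>F\<close> disintegrate.\<close>

lemma nn_integral_kernel_rectangles:
  assumes P: "prob_space P" and U[measurable]: "U \<in> P \<rightarrow>\<^sub>M A" and V[measurable]: "V \<in> P \<rightarrow>\<^sub>M B"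
    and K: "K \<in> A \<rightarrow>\<^sub>M prob_algebra B"
    and rect: "\<And>D b. D \<in> sets A \<Longrightarrow> b \<in> sets B \<Longrightarrow>
      (\<integral>\<omega>. indicat_real D (U \<omega>) * indicat_real b (V \<omega>) \<partial>P) = (\<integral>\<omega>. indicator D (U \<omega>) * measure (K (U \<omega>)) b \<partial>P)"
    and F[measurable]: "F \<in> borel_measurable (A \<Otimes>\<^sub>M B)"
  shows "(\<integral>\<^sup>+\<omega>. F (U \<omega>, V \<omega>) \<partial>P) = (\<integral>\<^sup>+\<omega>. (\<integral>\<^sup>+v. F (U \<omega>, v) \<partial>K (U \<omega>)) \<partial>P)"
proof -
  interpret prob_space P by fact
  have K'[measurable]: "K \<in> A \<rightarrow>\<^sub>M subprob_algebra B" by (rule measurable_prob_algebraD[OF K])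
  have Kp: "prob_space (K u)" "sets (K u) = sets B" if "u \<in> space A" for u
    using measurable_space[OF K that] by (auto simp: space_prob_algebra)
  \<comment> \<open>The law of \<open>(u, V)\<close> when \<open>V\<close> has law
    \<open>K u\<close>: a kernel into the product space, so that mixing over \<open>u\<close> is a
    monadic bind.\<close>
  define N where "N u = distr (K u) (A \<Otimes>\<^sub>M B) (Pair u)" for u
  have N: "N \<in> A \<rightarrow>\<^sub>M subprob_algebra (A \<Otimes>\<^sub>M B)"
    unfolding N_def by (rule measurable_distr2[OF _ K']) simp
  have N': "N \<in> distr P A U \<rightarrow>\<^sub>M subprob_algebra (A \<Otimes>\<^sub>M B)" using N by simp
  have ne: "space (distr P A U) \<noteq> {}"
    using not_empty measurable_space[OF U] by auto
  have em_N: "emeasure (N u) (D \<times> b) = indicator D u * ennreal (measure (K u) b)"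
    if "u \<in> space A" "D \<in> sets A" "b \<in> sets B" for u D b
  proof -
    interpret Ku: prob_space "K u" by (rule Kp[OF that(1)])
    have m: "Pair u \<in> K u \<rightarrow>\<^sub>M A \<Otimes>\<^sub>M B"
      using that(1) by (simp add: Kp measurable_cong_sets[OF Kp(2)[OF that(1)] refl])
    have "emeasure (N u) (D \<times> b) = emeasure (K u) (Pair u -` (D \<times> b) \<inter> space (K u))"
      unfolding N_def using that by (intro emeasure_distr m) auto
    also have "Pair u -` (D \<times> b) \<inter> space (K u) = (if u \<in> D then b else {})"
      using that sets.sets_into_space[OF that(3)] sets_eq_imp_space_eq[OF Kp(2)[OF that(1)]] by auto
    finally show ?thesis by (simp add: Ku.emeasure_eq_measure indicator_def)
  qed
  let ?M1 = "distr P (A \<Otimes>\<^sub>M B) (\<lambda>\<omega>. (U \<omega>, V \<omega>))" and ?M2 = "distr P A U \<bind> N"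
  have eq: "?M1 = ?M2"
  proof (rule measure_eqI_generator_eq[where E = "{a \<times> b | a b. a \<in> sets A \<and> b \<in> sets B}"
        and \<Omega> = "space A \<times> space B" and A = "\<lambda>_. space A \<times> space B"])
    show "Int_stable {a \<times> b |a b. a \<in> sets A \<and> b \<in> sets B}" by (rule Int_stable_pair_measure_generator)
    show "{a \<times> b |a b. a \<in> sets A \<and> b \<in> sets B} \<subseteq> Pow (space A \<times> space B)"
      by (rule pair_measure_closed)
    show "sets ?M1 = sigma_sets (space A \<times> space B) {a \<times> b |a b. a \<in> sets A \<and> b \<in> sets B}"
      by (simp add: sets_pair_measure)
    show "sets ?M2 = sigma_sets (space A \<times> space B) {a \<times> b |a b. a \<in> sets A \<and> b \<in> sets B}"
      using sets_bind[of "distr P A U" N "A \<Otimes>\<^sub>M B"] subprob_measurableD(2)[OF N'] ne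
      by (simp add: sets_pair_measure)
    fix C assume "C \<in> {a \<times> b |a b. a \<in> sets A \<and> b \<in> sets B}"
    then obtain D b where C: "C = D \<times> b" and [measurable]: "D \<in> sets A" "b \<in> sets B" by auto
    have "emeasure ?M1 C = emeasure P {\<omega> \<in> space P. U \<omega> \<in> D \<and> V \<omega> \<in> b}"
      unfolding C by (subst emeasure_distr) (auto intro!: arg_cong[where f = "emeasure P"])
    also have "\<dots> = ennreal (\<integral>\<omega>. indicat_real {\<omega> \<in> space P. U \<omega> \<in> D \<and> V \<omega> \<in> b} \<omega> \<partial>P)"
      by (simp add: emeasure_eq_measure)
    also have "(\<integral>\<omega>. indicat_real {\<omega> \<in> space P. U \<omega> \<in> D \<and> V \<omega> \<in> b} \<omega> \<partial>P) = (\<integral>\<omega>. indicat_real D (U \<omega>) * indicat_real b (V \<omega>) \<partial>P)"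
      by (intro Bochner_Integration.integral_cong) (auto simp: indicator_def)
    also have "\<dots> = (\<integral>\<omega>. indicator D (U \<omega>) * measure (K (U \<omega>)) b \<partial>P)" by (rule rect) auto
    also have "ennreal \<dots> = (\<integral>\<^sup>+\<omega>. ennreal (indicator D (U \<omega>) * measure (K (U \<omega>)) b) \<partial>P)"
    proof (rule nn_integral_eq_integral[symmetric])
      show "integrable P (\<lambda>\<omega>. indicator D (U \<omega>) * measure (K (U \<omega>)) b)"
      proof (rule integrable_const_bound[of _ 1])
        show "AE \<omega> in P. norm (indicator D (U \<omega>) * measure (K (U \<omega>)) b :: real) \<le> 1"
          using Kp(1) measurable_space[OF U] by (intro AE_I2) (auto simp: indicator_def prob_space.prob_le_1)
      qed measurable
    qed auto
    also have "\<dots> = (\<integral>\<^sup>+\<omega>. emeasure (N (U \<omega>)) C \<partial>P)"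
      using em_N measurable_space[OF U] unfolding C
      by (intro nn_integral_cong) (auto simp: indicator_def)
    also have "\<dots> = (\<integral>\<^sup>+u. emeasure (N u) C \<partial>distr P A U)"
      by (subst nn_integral_distr[OF U])
         (auto intro!: measurable_compose[OF N measurable_emeasure_subprob_algebra] simp: C)
    also have "\<dots> = emeasure ?M2 C"
      by (rule emeasure_bind[OF ne N', symmetric]) (simp add: C)
    finally show "emeasure ?M1 C = emeasure ?M2 C" .
  next
    interpret M1: prob_space ?M1 by (rule prob_space_distr) simp
    show "emeasure ?M1 (space A \<times> space B) \<noteq> \<infinity>" for i :: nat by simp
  qed auto
  have "(\<integral>\<^sup>+\<omega>. F (U \<omega>, V \<omega>) \<partial>P) = (\<integral>\<^sup>+z. F z \<partial>?M1)" by (simp add: nn_integral_distr)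
  also have "\<dots> = (\<integral>\<^sup>+u. (\<integral>\<^sup>+z. F z \<partial>N u) \<partial>distr P A U)"
    unfolding eq by (rule nn_integral_bind[OF F N'])
  also have "\<dots> = (\<integral>\<^sup>+\<omega>. (\<integral>\<^sup>+z. F z \<partial>N (U \<omega>)) \<partial>P)"
    by (rule nn_integral_distr[OF U]) (simp, rule measurable_compose[OF N nn_integral_measurable_subprob_algebra[OF F]])
  also have "\<dots> = (\<integral>\<^sup>+\<omega>. (\<integral>\<^sup>+v. F (U \<omega>, v) \<partial>K (U \<omega>)) \<partial>P)"
  proof (rule nn_integral_cong)
    fix \<omega> assume "\<omega> \<in> space P"
    then have u: "U \<omega> \<in> space A" using measurable_space[OF U] by auto
    have m: "Pair (U \<omega>) \<in> K (U \<omega>) \<rightarrow>\<^sub>M A \<Otimes>\<^sub>M B"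
      using u by (simp add: measurable_cong_sets[OF Kp(2)[OF u] refl])
    show "(\<integral>\<^sup>+z. F z \<partial>N (U \<omega>)) = (\<integral>\<^sup>+v. F (U \<omega>, v) \<partial>K (U \<omega>))"
      unfolding N_def by (rule nn_integral_distr[OF m]) (simp add: F)
  qed
  finally show ?thesis .
qed

section \<open>Past and future of a path, and the Markov kernel\<close>

definition past :: "nat \<Rightarrow> (nat \<Rightarrow> 'x) \<Rightarrow> nat \<Rightarrow> 'x" where
  "past k w = restrict w {..k}"

text \<open>The start is generation \<open>k + 1\<close>: the state of generation \<open>k\<close>,
  common to both lines of a pair branching there, belongs to \<open>past k\<close> alone.\<close>

definition future :: "nat \<Rightarrow> (nat \<Rightarrow> 'x) \<Rightarrow> nat \<Rightarrow> 'x" where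
  "future k w = (\<lambda>n. w (Suc k + n))"

lemma measurable_past [measurable]: "past k \<in> path_space E \<rightarrow>\<^sub>M PiM {..k} (\<lambda>_. E)"
  unfolding past_def by measurable

lemma measurable_future [measurable]: "future k \<in> path_space E \<rightarrow>\<^sub>M path_space E"
  unfolding future_def by (rule measurable_PiM_single') (auto simp: space_PiM)

lemma past_apply [simp]: "i \<le> k \<Longrightarrow> past k w i = w i"
  by (simp add: past_def)

lemma future_apply [simp]: "future k w n = w (Suc (k + n))"
  by (simp add: future_def)

locale branching =
  fixes E :: "'x measure"
    and \<xi> :: "'x \<Rightarrow> real"
    and \<kappa> :: "'x \<Rightarrow> nat"
    and P :: "'p measure"
    and X :: "nat \<Rightarrow> 'p \<Rightarrow> 'x"
    and X' :: "nat \<Rightarrow> nat \<Rightarrow> 'p \<Rightarrow> 'x"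
    and Q :: "'x \<Rightarrow> (nat \<Rightarrow> 'x) measure"
    and T :: "'t measure"
    and Y :: "nat list \<Rightarrow> 't \<Rightarrow> 'x"
  assumes model: "branching_model E \<xi> \<kappa> P X T Y"
    and markov: "markov_independence E \<xi> \<kappa> P X X' Q T Y"
begin

sublocale P: prob_space P using model by (simp add: branching_model_def)
sublocale T: prob_space T using model by (simp add: branching_model_def)

lemma measurable_\<xi> [measurable]: "\<xi> \<in> borel_measurable E"
  and measurable_\<kappa> [measurable]: "\<kappa> \<in> E \<rightarrow>\<^sub>M count_space UNIV"
  and measurable_X [measurable]: "X n \<in> P \<rightarrow>\<^sub>M E"
  and measurable_X' [measurable]: "X' k n \<in> P \<rightarrow>\<^sub>M E"
  and measurable_Y: "v \<in> labels \<Longrightarrow> Y v \<in> T \<rightarrow>\<^sub>M E"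
  and \<xi>_nonneg: "x \<in> space E \<Longrightarrow> 0 \<le> \<xi> x"
  and \<kappa>_ge_2: "x \<in> space E \<Longrightarrow> 2 \<le> \<kappa> x"
  using model markov by (auto simp: branching_model_def markov_independence_def coupled_lines_def)

definition x :: "'p \<Rightarrow> nat \<Rightarrow> 'x" where "x \<omega> = (\<lambda>n. X n \<omega>)"
definition x' :: "nat \<Rightarrow> 'p \<Rightarrow> nat \<Rightarrow> 'x" where "x' k \<omega> = (\<lambda>n. X' k n \<omega>)"
text \<open>The law of generations 1, 2, ... given state \<open>a\<close> in generation 0. Without
  generation 0 it is the conditional law of \<open>future k\<close> given \<open>X k = a\<close>,
  for either line of a pair.\<close>

definition K :: "'x \<Rightarrow> (nat \<Rightarrow> 'x) measure" where "K a = distr (Q a) (path_space E) (future 0)"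

lemma x_apply [simp]: "x \<omega> n = X n \<omega>" and x'_apply [simp]: "x' k \<omega> n = X' k n \<omega>"
  by (simp_all add: x_def x'_def)

lemma measurable_x [measurable]: "x \<in> P \<rightarrow>\<^sub>M path_space E"
  and measurable_x' [measurable]: "x' k \<in> P \<rightarrow>\<^sub>M path_space E"
  unfolding x_def x'_def by (auto intro!: measurable_PiM_single' simp: space_PiM dest: measurable_space[OF measurable_X] measurable_space[OF measurable_X'])

lemma Q_measurable: "Q \<in> E \<rightarrow>\<^sub>M prob_algebra (path_space E)"
  using markov by (simp add: markov_independence_def stationary_markov_def)

lemma Q_space: "a \<in> space E \<Longrightarrow> prob_space (Q a)" "a \<in> space E \<Longrightarrow> sets (Q a) = sets (path_space E)"
  "a \<in> space E \<Longrightarrow> space (Q a) = space (path_space E)"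
  using measurable_space[OF Q_measurable, of a] by (auto simp: space_prob_algebra dest: sets_eq_imp_space_eq)

lemma K_measurable: "K \<in> E \<rightarrow>\<^sub>M prob_algebra (path_space E)"
  unfolding K_def by (rule measurable_distr_prob_space2[OF Q_measurable]) measurable

lemma K_measurable' [measurable]: "K \<in> E \<rightarrow>\<^sub>M subprob_algebra (path_space E)"
  by (rule measurable_prob_algebraD[OF K_measurable])

lemma K_space: "a \<in> space E \<Longrightarrow> prob_space (K a)" "sets (K a) = sets (path_space E)"
  "space (K a) = space (path_space E)"
  using measurable_space[OF K_measurable, of a] by (auto simp: space_prob_algebra K_def)

lemma X_space: "\<omega> \<in> space P \<Longrightarrow> X n \<omega> \<in> space E" and X'_space: "\<omega> \<in> space P \<Longrightarrow> X' k n \<omega> \<in> space E"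
  using measurable_space[OF measurable_X] measurable_space[OF measurable_X'] by auto

lemma K_le_1: "a \<in> space E \<Longrightarrow> measure (K a) b \<le> 1"
  using K_space(1) prob_space.prob_le_1 by blast

lemma measurable_K_b [measurable]:
  assumes "b \<in> sets (path_space E)"
  shows "(\<lambda>a. measure (K a) b) \<in> borel_measurable E"
  using measurable_compose[OF K_measurable' measurable_measure_subprob_algebra[OF assms]] by simp

lemma X'_eq_X: "AE \<omega> in P. \<forall>n\<le>k. X' k n \<omega> = X n \<omega>"
  and distr_x': "distr P (path_space E) (x' k) = distr P (path_space E) x"
  using markov by (auto simp: markov_independence_def coupled_lines_def x_def[abs_def] x'_def[abs_def])

lemma integrable_boundedI:
  assumes "f \<in> borel_measurable P" "\<And>\<omega>. \<omega> \<in> space P \<Longrightarrow> \<bar>f \<omega>\<bar> \<le> (1::real)"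
  shows "integrable P f"
  using assms by (intro P.integrable_const_bound[of _ 1]) auto

text \<open>A bounded function of the past is pulled out of the conditional expectation. A general
  \<open>\<phi>\<close> in place of an indicator allows the conditional probability of
  \<open>b\<close> itself to be inserted, as \<open>siblings_uncorrelated\<close> does.\<close>

lemma markov_integral:
  assumes \<phi>[measurable]: "\<phi> \<in> borel_measurable (PiM {..k} (\<lambda>_. E))"
    and \<phi>1: "\<And>g. g \<in> space (PiM {..k} (\<lambda>_. E)) \<Longrightarrow> \<bar>\<phi> g\<bar> \<le> 1"
    and b[measurable]: "b \<in> sets (path_space E)"
  shows "(\<integral>\<omega>. \<phi> (past k (x \<omega>)) * indicat_real b (future k (x \<omega>)) \<partial>P)
       = (\<integral>\<omega>. \<phi> (past k (x \<omega>)) * measure (K (X k \<omega>)) b \<partial>P)"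
proof -
  have px: "(\<lambda>\<omega>. past k (x \<omega>)) = (\<lambda>\<omega>. \<lambda>i\<in>{..k}. X i \<omega>)"
    by (auto simp: past_def restrict_def fun_eq_iff)
  have pxm: "(\<lambda>\<omega>. past k (x \<omega>)) \<in> P \<rightarrow>\<^sub>M PiM {..k} (\<lambda>_. E)" by measurable
  define F where "F = vimage_algebra (space P) (\<lambda>\<omega>. past k (x \<omega>)) (PiM {..k} (\<lambda>_. E))"
  have sF: "sets F = {(\<lambda>\<omega>. past k (x \<omega>)) -` A \<inter> space P | A. A \<in> sets (PiM {..k} (\<lambda>_. E))}"
    unfolding F_def by (rule sets_vimage_algebra2) (use measurable_space[OF pxm] in auto)
  have "subalgebra P F"
    unfolding subalgebra_def sF using measurable_sets[OF pxm] by (auto simp: F_def)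
  then interpret F: finite_measure_subalgebra P F by unfold_locales
  \<comment> \<open>\<open>Q\<close> describes the path from generation \<open>k\<close> on and
    \<open>K\<close> that from \<open>k + 1\<close> on; \<open>B\<close> is \<open>b\<close> with a
    free coordinate put in front.\<close>
  define B where "B = {w \<in> space (path_space E). future 0 w \<in> b}"
  have B[measurable]: "B \<in> sets (path_space E)" unfolding B_def by measurable
  have ind: "indicat_real b (future k (x \<omega>)) = indicator B (\<lambda>n. X (k + n) \<omega>)" if "\<omega> \<in> space P" for \<omega>
    using X_space[OF that] by (auto simp: B_def indicator_def space_PiM future_def)
  have mK: "measure (K a) b = measure (Q a) B" if "a \<in> space E" for a
  proof -
    have "future 0 \<in> Q a \<rightarrow>\<^sub>M path_space E"
      by (simp add: measurable_cong_sets[OF Q_space(2)[OF that] refl])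
    then show ?thesis unfolding K_def
      by (subst measure_distr) (auto simp: B_def Q_space(3)[OF that] vimage_def Int_def conj_commute)
  qed
  have phF: "(\<lambda>\<omega>. \<phi> (past k (x \<omega>))) \<in> borel_measurable F"
    unfolding F_def by (rule measurable_compose[OF measurable_vimage_algebra1 \<phi>]) (use measurable_space[OF pxm] in auto)
  have indm: "(\<lambda>\<omega>. indicator B (\<lambda>n. X (k + n) \<omega>) :: real) \<in> borel_measurable P"
  proof -
    have "(\<lambda>\<omega>. indicat_real b (future k (x \<omega>))) \<in> borel_measurable P" by measurable
    then show ?thesis by (rule measurable_cong[THEN iffD1, rotated]) (simp add: ind)
  qed
  have ae: "AE \<omega> in P. real_cond_exp P F (\<lambda>\<omega>. indicator B (\<lambda>n. X (k + n) \<omega>)) \<omega> = measure (Q (X k \<omega>)) B"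
    using markov B unfolding F_def px markov_independence_def stationary_markov_def by auto
  have phi_bd: "\<bar>\<phi> (past k (x \<omega>))\<bar> \<le> 1" if "\<omega> \<in> space P" for \<omega>
    using \<phi>1 measurable_space[OF pxm that] by auto
  have "(\<integral>\<omega>. \<phi> (past k (x \<omega>)) * indicat_real b (future k (x \<omega>)) \<partial>P)
    = (\<integral>\<omega>. \<phi> (past k (x \<omega>)) * indicator B (\<lambda>n. X (k + n) \<omega>) \<partial>P)"
    by (intro Bochner_Integration.integral_cong) (auto simp: ind)
  also have "\<dots> = (\<integral>\<omega>. \<phi> (past k (x \<omega>)) * real_cond_exp P F (\<lambda>\<omega>. indicator B (\<lambda>n. X (k + n) \<omega>)) \<omega> \<partial>P)"
  proof (rule F.real_cond_exp_intg(2)[OF _ phF indm, symmetric])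
    show "integrable P (\<lambda>\<omega>. \<phi> (past k (x \<omega>)) * indicator B (\<lambda>n. X (k + n) \<omega>))"
      using indm by (intro integrable_boundedI) (auto simp: abs_mult indicator_def phi_bd)
  qed
  also have "\<dots> = (\<integral>\<omega>. \<phi> (past k (x \<omega>)) * measure (K (X k \<omega>)) b \<partial>P)"
  proof (rule integral_cong_AE)
    show "AE \<omega> in P. \<phi> (past k (x \<omega>)) * real_cond_exp P F (\<lambda>\<omega>. indicator B (\<lambda>n. X (k + n) \<omega>)) \<omega>
        = \<phi> (past k (x \<omega>)) * measure (K (X k \<omega>)) b"
      using ae AE_space by eventually_elim (simp add: mK X_space)
  qed measurable
  finally show ?thesis .
qed

section \<open>Independence of two sibling subtrees given the past\<close>

lemma integral_x':
  assumes "f \<in> borel_measurable (path_space E)"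
  shows "(\<integral>\<omega>. f (x' k \<omega>) \<partial>P) = (\<integral>\<omega>. (f (x \<omega>) :: real) \<partial>P)"
  using integral_distr[OF measurable_x' assms] integral_distr[OF measurable_x assms] distr_x'[of k] by metis

text \<open>Given \<open>X k\<close>, the event \<open>b\<close> has conditional probability
  \<open>measure (K (X k \<omega>)) b\<close> on both lines: on \<open>X\<close> by the Markov
  property, on \<open>X'\<close> because both paths have one law and agree at generation
  \<open>k\<close>. Conditional independence multiplies the two. This is the covariance needed for
  \<open>siblings_uncorrelated\<close>.\<close>

lemma cond_indep_square:
  assumes b[measurable]: "b \<in> sets (path_space E)"
  shows "(\<integral>\<omega>. indicat_real b (future k (x \<omega>)) * indicat_real b (future k (x' k \<omega>)) \<partial>P)
       = (\<integral>\<omega>. (measure (K (X k \<omega>)) b)\<^sup>2 \<partial>P)"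
proof -
  define F where "F = vimage_algebra (space P) (X k) E"
  have sF: "sets F = {X k -` A \<inter> space P | A. A \<in> sets E}"
    unfolding F_def by (rule sets_vimage_algebra2) (auto simp: X_space)
  have "subalgebra P F"
    unfolding subalgebra_def sF using measurable_sets[OF measurable_X] by (auto simp: F_def)
  then interpret F: finite_measure_subalgebra P F by unfold_locales
  have mF: "(\<lambda>\<omega>. measure (K (X k \<omega>)) b) \<in> borel_measurable F"
    unfolding F_def by (rule measurable_compose[OF measurable_vimage_algebra1 measurable_K_b[OF b]]) (auto simp: X_space)
  let ?m = "\<lambda>\<omega>. measure (K (X k \<omega>)) b"
  have int_m: "integrable P ?m" by (rule integrable_boundedI) (auto simp: K_le_1 X_space)
  have m1: "(\<integral>\<omega>. indicat_real A (X k \<omega>) * indicat_real b (future k (x \<omega>)) \<partial>P) = (\<integral>\<omega>. indicat_real A (X k \<omega>) * ?m \<omega> \<partial>P)"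
    if [measurable]: "A \<in> sets E" for A
    using markov_integral[of "\<lambda>g. indicat_real A (g k)" k b] by simp
  have ae1: "AE \<omega> in P. real_cond_exp P F (\<lambda>\<omega>. indicat_real b (future k (x \<omega>))) \<omega> = ?m \<omega>"
  proof (rule F.real_cond_exp_charact[OF _ _ int_m mF])
    fix C assume "C \<in> sets F"
    then obtain A where A[measurable]: "A \<in> sets E" and C: "C = X k -` A \<inter> space P" by (auto simp: sF)
    have "set_lebesgue_integral P C f = (\<integral>\<omega>. indicat_real A (X k \<omega>) * f \<omega> \<partial>P)" for f :: "'p \<Rightarrow> real"
      unfolding set_lebesgue_integral_def C by (intro Bochner_Integration.integral_cong) (auto simp: indicator_def)
    then show "set_lebesgue_integral P C (\<lambda>\<omega>. indicat_real b (future k (x \<omega>))) = set_lebesgue_integral P C ?m"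
      using m1[OF A] by simp
  qed (rule integrable_boundedI; simp)
  have ae2: "AE \<omega> in P. real_cond_exp P F (\<lambda>\<omega>. indicat_real b (future k (x' k \<omega>))) \<omega> = ?m \<omega>"
  proof (rule F.real_cond_exp_charact[OF _ _ int_m mF])
    fix C assume "C \<in> sets F"
    then obtain A where A[measurable]: "A \<in> sets E" and C: "C = X k -` A \<inter> space P" by (auto simp: sF)
    have *: "set_lebesgue_integral P C f = (\<integral>\<omega>. indicat_real A (X k \<omega>) * f \<omega> \<partial>P)" for f :: "'p \<Rightarrow> real"
      unfolding set_lebesgue_integral_def C by (intro Bochner_Integration.integral_cong) (auto simp: indicator_def)
    have "(\<integral>\<omega>. indicat_real A (X k \<omega>) * indicat_real b (future k (x' k \<omega>)) \<partial>P)
      = (\<integral>\<omega>. indicat_real A (x' k \<omega> k) * indicat_real b (future k (x' k \<omega>)) \<partial>P)"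
    proof (rule integral_cong_AE)
      show "AE \<omega> in P. indicat_real A (X k \<omega>) * indicat_real b (future k (x' k \<omega>))
         = indicat_real A (x' k \<omega> k) * indicat_real b (future k (x' k \<omega>))"
        using X'_eq_X[of k] by eventually_elim simp
    qed (simp_all, measurable)
    also have "\<dots> = (\<integral>\<omega>. indicat_real A (x \<omega> k) * indicat_real b (future k (x \<omega>)) \<partial>P)"
      by (rule integral_x') measurable
    finally show "set_lebesgue_integral P C (\<lambda>\<omega>. indicat_real b (future k (x' k \<omega>))) = set_lebesgue_integral P C ?m"
      using m1[OF A] by (simp add: *)
  qed (rule integrable_boundedI; simp)
  have fut: "(\<lambda>n. X' k (Suc k + n) \<omega>) = future k (x' k \<omega>)" "(\<lambda>n. X (Suc k + n) \<omega>) = future k (x \<omega>)" for \<omega>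
    by (auto simp: future_def)
  have ci: "AE \<omega> in P. real_cond_exp P F (\<lambda>\<omega>. indicat_real b (future k (x' k \<omega>)) * indicat_real b (future k (x \<omega>))) \<omega>
     = real_cond_exp P F (\<lambda>\<omega>. indicat_real b (future k (x' k \<omega>))) \<omega> * real_cond_exp P F (\<lambda>\<omega>. indicat_real b (future k (x \<omega>))) \<omega>"
  proof -
    have "cond_indep_given P E (X k) (path_space E) (\<lambda>\<omega>. future k (x' k \<omega>)) (path_space E) (\<lambda>\<omega>. future k (x \<omega>))"
      using markov by (simp add: markov_independence_def flip: fut)
    then show ?thesis using b unfolding cond_indep_given_def Let_def F_def by blast
  qed
  have int2: "integrable P (\<lambda>\<omega>. indicat_real b (future k (x' k \<omega>)) * indicat_real b (future k (x \<omega>)))"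
    by (rule integrable_boundedI) (auto simp: indicator_def)
  have "(\<integral>\<omega>. indicat_real b (future k (x \<omega>)) * indicat_real b (future k (x' k \<omega>)) \<partial>P)
    = (\<integral>\<omega>. real_cond_exp P F (\<lambda>\<omega>. indicat_real b (future k (x' k \<omega>)) * indicat_real b (future k (x \<omega>))) \<omega> \<partial>P)"
    by (subst F.real_cond_exp_int(2)[OF int2]) (simp add: mult.commute)
  also have "\<dots> = (\<integral>\<omega>. (?m \<omega>)\<^sup>2 \<partial>P)"
  proof (rule integral_cong_AE)
    show "AE \<omega> in P. real_cond_exp P F (\<lambda>\<omega>. indicat_real b (future k (x' k \<omega>)) * indicat_real b (future k (x \<omega>))) \<omega> = (?m \<omega>)\<^sup>2"
      using ci ae1 ae2 by eventually_elim (simp add: power2_eq_square)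
  qed measurable
  finally show ?thesis .
qed

text \<open>Lines through the children of the cell labelled by \<open>k\<close> ones; any two of
  them part exactly at that cell. The letter is \<open>Suc i\<close> because letters are
  positive.\<close>

definition sibling_line :: "nat \<Rightarrow> nat \<Rightarrow> nat \<Rightarrow> nat" where
  "sibling_line k i n = (if n = k then Suc i else 1)"

lemma sibling_line_in_lines: "sibling_line k i \<in> lines" by (simp add: sibling_line_def lines_def)

definition y :: "(nat \<Rightarrow> nat) \<Rightarrow> 't \<Rightarrow> nat \<Rightarrow> 'x" where
  "y l \<omega> = (\<lambda>n. Y (ancestor l n) \<omega>)"

lemma ancestor_in_labels: "l \<in> lines \<Longrightarrow> ancestor l n \<in> labels"
  by (auto simp: lines_def labels_def ancestor_def lists_eq_set)

lemma measurable_y: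
  assumes "l \<in> lines" shows "y l \<in> T \<rightarrow>\<^sub>M path_space E"
  unfolding y_def using measurable_Y[OF ancestor_in_labels[OF assms]]
  by (intro measurable_PiM_single') (auto simp: space_PiM dest: measurable_space)

lemma ancestor_eq: "(\<And>i. i < n \<Longrightarrow> l i = l' i) \<Longrightarrow> ancestor l n = ancestor l' n"
  by (simp add: ancestor_def)

lemma distr_pair_lines:
  assumes "l \<in> lines" "l' \<in> lines" "ancestor l k = ancestor l' k" "l k \<noteq> l' k"
  shows "distr T (path_space E \<Otimes>\<^sub>M path_space E) (\<lambda>\<omega>. (y l \<omega>, y l' \<omega>))
    = distr P (path_space E \<Otimes>\<^sub>M path_space E) (\<lambda>\<omega>. (x \<omega>, x' k \<omega>))"
proof -
  have "ancestor l (Suc k) \<noteq> ancestor l' (Suc k)" using assms(3,4) by (simp add: ancestor_def)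
  then show ?thesis
    using markov assms(1-3) unfolding markov_independence_def coupled_lines_def y_def[abs_def] x_def[abs_def] x'_def[abs_def]
    by blast
qed

lemma distr_line:
  assumes "l \<in> lines"
  shows "distr T (path_space E) (y l) = distr P (path_space E) x"
  using model assms unfolding branching_model_def y_def[abs_def] x_def[abs_def] by blast

lemma integral_pair_lines:
  assumes l: "l \<in> lines" "l' \<in> lines" "ancestor l k = ancestor l' k" "l k \<noteq> l' k"
    and f: "(\<lambda>(w, w'). f w w') \<in> borel_measurable (path_space E \<Otimes>\<^sub>M path_space E)"
  shows "(\<integral>\<omega>. f (y l \<omega>) (y l' \<omega>) \<partial>T) = (\<integral>\<omega>. (f (x \<omega>) (x' k \<omega>) :: real) \<partial>P)"
proof -
  have "(\<lambda>\<omega>. (y l \<omega>, y l' \<omega>)) \<in> T \<rightarrow>\<^sub>M path_space E \<Otimes>\<^sub>M path_space E"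
    using measurable_y l by (intro measurable_Pair)
  from integral_distr[OF this f] show ?thesis
    unfolding distr_pair_lines[OF l] by (subst (asm) integral_distr[OF _ f]) simp_all
qed

text \<open>
  The hypotheses only provide conditional independence given \<open>X k\<close>, whereas the birth time of the
  cells of generation \<open>k\<close> depends on the whole past.  Conditional independence given the past holds
  because a label has infinitely many children, all pairs of which have the same joint law: the
  centred indicators attached to the children are uncorrelated, so their averages tend to \<open>0\<close>
  in \<open>L\<^sup>2\<close>, and the correlation of any one of them with an event of the past and of the first
  subtree, being the same for all children, vanishes.
\<close>

lemma siblings_uncorrelated:
  assumes D[measurable]: "D \<in> sets (PiM {..k} (\<lambda>_. E) \<Otimes>\<^sub>M path_space E)" and b[measurable]: "b \<in> sets (path_space E)"
  shows "(\<integral>\<omega>. indicat_real D (past k (x \<omega>), future k (x \<omega>)) * indicat_real b (future k (x' k \<omega>)) \<partial>P)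
    = (\<integral>\<omega>. indicat_real D (past k (x \<omega>), future k (x \<omega>)) * measure (K (X k \<omega>)) b \<partial>P)"
proof -
  define v where "v w = indicat_real b (future k w) - measure (K (w k)) b" for w :: "nat \<Rightarrow> 'x"
  have v[measurable]: "v \<in> borel_measurable (path_space E)" unfolding v_def by measurable
  have v1: "\<bar>v w\<bar> \<le> 1" if "w \<in> space (path_space E)" for w
  proof -
    have "w k \<in> space E" using that by (auto simp: space_PiM)
    from K_le_1[OF this, of b] show ?thesis by (auto simp: v_def indicator_def)
  qed
  define W where "W w = indicat_real D (past k w, future k w)" for w :: "nat \<Rightarrow> 'x"
  have W[measurable]: "W \<in> borel_measurable (path_space E)" unfolding W_def by measurable
  have W1: "\<bar>W w\<bar> \<le> 1" for w by (simp add: W_def indicator_def)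
  let ?l = "sibling_line k"
  have l: "?l i \<in> lines" "?l j \<in> lines" "ancestor (?l i) k = ancestor (?l j) k" for i j
    by (auto simp: sibling_line_in_lines intro!: ancestor_eq simp: sibling_line_def)
  define V where "V i \<omega> = v (y (?l i) \<omega>)" for i \<omega>
  have yl[measurable]: "y (?l i) \<in> T \<rightarrow>\<^sub>M path_space E" for i by (rule measurable_y[OF l(1)])
  have V[measurable]: "V i \<in> borel_measurable T" for i unfolding V_def by measurable
  have V1: "\<bar>V i \<omega>\<bar> \<le> 1" if "\<omega> \<in> space T" for i \<omega>
    unfolding V_def by (rule v1[OF measurable_space[OF yl that]])
  have intT: "integrable T f" if "f \<in> borel_measurable T" "\<And>\<omega>. \<omega> \<in> space T \<Longrightarrow> \<bar>f \<omega>\<bar> \<le> (1::real)" for f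
    using that by (intro T.integrable_const_bound[of _ 1]) auto
  have spx: "x \<omega> \<in> space (path_space E)" "x' k \<omega> \<in> space (path_space E)" if "\<omega> \<in> space P" for \<omega>
    using measurable_space[OF measurable_x that] measurable_space[OF measurable_x' that] by auto
  \<comment> \<open>The product of centred indicators expands into four terms, each with mean plus
    or minus that of the square of \<open>?m\<close>: the mixed ones by the Markov property, the
    product of indicators by \<open>cond_indep_square\<close>. They cancel.\<close>
  have VV: "(\<integral>\<omega>. V i \<omega> * V j \<omega> \<partial>T) = 0" if "i \<noteq> j" for i j
  proof -
    let ?i = "\<lambda>\<omega>. indicat_real b (future k (x \<omega>))" and ?i' = "\<lambda>\<omega>. indicat_real b (future k (x' k \<omega>))"
      and ?m = "\<lambda>\<omega>. measure (K (X k \<omega>)) b"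
    have m01: "0 \<le> ?m \<omega>" "?m \<omega> \<le> 1" if "\<omega> \<in> space P" for \<omega> using K_le_1 X_space that by auto
    have im: "(\<integral>\<omega>. ?i \<omega> * ?m \<omega> \<partial>P) = (\<integral>\<omega>. (?m \<omega>)\<^sup>2 \<partial>P)"
    proof -
      have "(\<integral>\<omega>. measure (K (past k (x \<omega>) k)) b * ?i \<omega> \<partial>P) = (\<integral>\<omega>. measure (K (past k (x \<omega>) k)) b * ?m \<omega> \<partial>P)"
        by (rule markov_integral[of "\<lambda>g. measure (K (g k)) b"])
           (auto simp: space_PiM PiE_def Pi_def K_le_1 intro!: measurable_compose[OF _ measurable_K_b[OF b]])
      then show ?thesis by (simp add: mult.commute power2_eq_square)
    qed
    have i'm: "(\<integral>\<omega>. ?i' \<omega> * ?m \<omega> \<partial>P) = (\<integral>\<omega>. (?m \<omega>)\<^sup>2 \<partial>P)"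
    proof -
      have "(\<integral>\<omega>. ?i' \<omega> * ?m \<omega> \<partial>P) = (\<integral>\<omega>. ?i' \<omega> * measure (K (x' k \<omega> k)) b \<partial>P)"
      proof (rule integral_cong_AE)
        show "AE \<omega> in P. ?i' \<omega> * ?m \<omega> = ?i' \<omega> * measure (K (x' k \<omega> k)) b"
          using X'_eq_X[of k] by eventually_elim simp
      qed (simp_all, measurable)
      also have "\<dots> = (\<integral>\<omega>. ?i \<omega> * measure (K (x \<omega> k)) b \<partial>P)" by (rule integral_x') measurable
      finally show ?thesis using im by simp
    qed
    have "(\<integral>\<omega>. V i \<omega> * V j \<omega> \<partial>T) = (\<integral>\<omega>. v (x \<omega>) * v (x' k \<omega>) \<partial>P)"
      unfolding V_def
      by (rule integral_pair_lines[OF l(1,2,3), of i j "\<lambda>w w'. v w * v w'"]) (use that in \<open>simp_all add: sibling_line_def\<close>)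
    also have "\<dots> = (\<integral>\<omega>. ?i \<omega> * ?i' \<omega> - ?i \<omega> * ?m \<omega> - ?i' \<omega> * ?m \<omega> + (?m \<omega>)\<^sup>2 \<partial>P)"
    proof (rule integral_cong_AE)
      show "AE \<omega> in P. v (x \<omega>) * v (x' k \<omega>) = ?i \<omega> * ?i' \<omega> - ?i \<omega> * ?m \<omega> - ?i' \<omega> * ?m \<omega> + (?m \<omega>)\<^sup>2"
        using X'_eq_X[of k] by eventually_elim (simp add: v_def algebra_simps power2_eq_square)
    qed measurable
    also have "\<dots> = (\<integral>\<omega>. ?i \<omega> * ?i' \<omega> \<partial>P) - (\<integral>\<omega>. ?i \<omega> * ?m \<omega> \<partial>P) - (\<integral>\<omega>. ?i' \<omega> * ?m \<omega> \<partial>P) + (\<integral>\<omega>. (?m \<omega>)\<^sup>2 \<partial>P)"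
    proof -
      have "integrable P (\<lambda>\<omega>. ?i \<omega> * ?i' \<omega>)" "integrable P (\<lambda>\<omega>. ?i \<omega> * ?m \<omega>)"
        "integrable P (\<lambda>\<omega>. ?i' \<omega> * ?m \<omega>)" "integrable P (\<lambda>\<omega>. (?m \<omega>)\<^sup>2)"
        using m01 by (auto intro!: integrable_boundedI simp: indicator_def power_le_one)
      then show ?thesis by simp
    qed
    also have "(\<integral>\<omega>. ?i \<omega> * ?i' \<omega> \<partial>P) = (\<integral>\<omega>. (?m \<omega>)\<^sup>2 \<partial>P)" by (rule cond_indep_square[OF b])
    finally show ?thesis unfolding im i'm by simp
  qed
  \<comment> \<open>The correlation to be proved zero. The function \<open>W\<close> is carried by
    child 0, and every other child yields the same \<open>c\<close>.\<close>
  define c where "c = (\<integral>\<omega>. W (x \<omega>) * v (x' k \<omega>) \<partial>P)"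
  have WV: "(\<integral>\<omega>. W (y (?l 0) \<omega>) * V (Suc i) \<omega> \<partial>T) = c" for i
    unfolding V_def c_def
    by (rule integral_pair_lines[OF l(1,2,3), of 0 "Suc i" "\<lambda>w w'. W w * v w'"]) (simp_all add: sibling_line_def)
  have bound: "real n * c\<^sup>2 \<le> 1" if n: "0 < n" for n :: nat
  proof -
    define Z where "Z \<omega> = (\<Sum>i<n. V (Suc i) \<omega>)" for \<omega>
    have Zm[measurable]: "Z \<in> borel_measurable T" unfolding Z_def by measurable
    have intVV: "integrable T (\<lambda>\<omega>. V i \<omega> * V j \<omega>)" for i j
      by (rule intT) (auto simp: abs_mult V1 intro!: mult_le_one)
    have Z2eq: "(Z \<omega>)\<^sup>2 = (\<Sum>i<n. \<Sum>j<n. V (Suc i) \<omega> * V (Suc j) \<omega>)" for \<omega>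
      by (simp add: Z_def power2_eq_square sum_product)
    have intZ2: "integrable T (\<lambda>\<omega>. (Z \<omega>)\<^sup>2)" unfolding Z2eq
      by (intro Bochner_Integration.integrable_sum intVV)
    have "(\<integral>\<omega>. (Z \<omega>)\<^sup>2 \<partial>T) = (\<Sum>i<n. \<Sum>j<n. \<integral>\<omega>. V (Suc i) \<omega> * V (Suc j) \<omega> \<partial>T)"
      unfolding Z2eq by (simp add: intVV)
    also have "\<dots> = (\<Sum>i<n. \<Sum>j<n. if i = j then \<integral>\<omega>. V (Suc i) \<omega> * V (Suc i) \<omega> \<partial>T else 0)"
      by (intro sum.cong refl) (simp add: VV)
    also have "\<dots> = (\<Sum>i<n. \<integral>\<omega>. V (Suc i) \<omega> * V (Suc i) \<omega> \<partial>T)" by simp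
    also have "\<dots> \<le> (\<Sum>i<n. 1)"
    proof (rule sum_mono)
      fix i
      have "(\<integral>\<omega>. V (Suc i) \<omega> * V (Suc i) \<omega> \<partial>T) \<le> (\<integral>\<omega>. 1 \<partial>T)"
      proof (rule integral_mono[OF intVV])
        fix \<omega> assume "\<omega> \<in> space T"
        from V1[OF this, of "Suc i"] show "V (Suc i) \<omega> * V (Suc i) \<omega> \<le> 1"
          by (simp add: abs_square_le_1[unfolded power2_eq_square])
      qed simp
      then show "(\<integral>\<omega>. V (Suc i) \<omega> * V (Suc i) \<omega> \<partial>T) \<le> 1" by (simp add: T.prob_space)
    qed
    finally have EZ2: "(\<integral>\<omega>. (Z \<omega>)\<^sup>2 \<partial>T) \<le> real n" by simp
    have intWV: "integrable T (\<lambda>\<omega>. W (y (?l 0) \<omega>) * V (Suc i) \<omega>)" for i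
      by (rule intT) (auto simp: abs_mult V1 W1 intro!: mult_le_one)
    have WZ_eq: "W (y (?l 0) \<omega>) * Z \<omega> = (\<Sum>i<n. W (y (?l 0) \<omega>) * V (Suc i) \<omega>)" for \<omega>
      by (simp add: Z_def sum_distrib_left)
    have intWZ: "integrable T (\<lambda>\<omega>. W (y (?l 0) \<omega>) * Z \<omega>)"
      unfolding WZ_eq by (intro Bochner_Integration.integrable_sum intWV)
    have EWZ: "(\<integral>\<omega>. W (y (?l 0) \<omega>) * Z \<omega> \<partial>T) = real n * c"
      unfolding WZ_eq by (simp add: intWV WV)
    \<comment> \<open>The integrand below is \<open>(Z - a)^2\<close> where \<open>W\<close> is 1
      and \<open>Z^2 + a^2\<close> where \<open>W\<close> is 0. Since \<open>a\<close> is the mean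
      of \<open>W * Z\<close>, nonnegativity gives that \<open>a^2\<close> is at most the mean of
      \<open>Z^2\<close>, hence at most \<open>n\<close>; as \<open>a = n * c\<close>, the square of
      \<open>c\<close> is at most \<open>1 / n\<close>.\<close>
    define a where "a = real n * c"
    have "0 \<le> (\<integral>\<omega>. (Z \<omega>)\<^sup>2 - 2 * a * (W (y (?l 0) \<omega>) * Z \<omega>) + a\<^sup>2 \<partial>T)"
    proof (rule integral_nonneg_AE, rule AE_I2)
      fix \<omega>
      have "W (y (?l 0) \<omega>) = 0 \<or> W (y (?l 0) \<omega>) = 1" by (simp add: W_def indicator_def)
      then show "0 \<le> (Z \<omega>)\<^sup>2 - 2 * a * (W (y (?l 0) \<omega>) * Z \<omega>) + a\<^sup>2"
        using zero_le_power2[of "Z \<omega> - a"] by (auto simp: power2_diff algebra_simps)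
    qed
    also have "\<dots> = (\<integral>\<omega>. (Z \<omega>)\<^sup>2 \<partial>T) - 2 * a * a + a\<^sup>2"
      using intZ2 intWZ by (simp add: EWZ T.prob_space a_def[symmetric])
    finally have "a\<^sup>2 \<le> real n" using EZ2 by (simp add: power2_eq_square)
    then have "real n * (real n * c\<^sup>2) \<le> real n * 1" by (simp add: a_def power2_eq_square mult_ac)
    then show ?thesis using n by (simp only: mult_le_cancel_left_pos of_nat_0_less_iff)
  qed
  have "c = 0"
  proof (rule ccontr)
    assume "c \<noteq> 0"
    then have "0 < c\<^sup>2" by simp
    then obtain n where "1 < real n * c\<^sup>2" using reals_Archimedean3[of "c\<^sup>2"] by blast
    moreover from this have "0 < n" by (cases n) auto
    ultimately show False using bound[of n] by simp
  qed
  moreover have "c = (\<integral>\<omega>. W (x \<omega>) * indicat_real b (future k (x' k \<omega>)) - W (x \<omega>) * measure (K (X k \<omega>)) b \<partial>P)"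
    unfolding c_def
  proof (rule integral_cong_AE)
    show "AE \<omega> in P. W (x \<omega>) * v (x' k \<omega>) = W (x \<omega>) * indicat_real b (future k (x' k \<omega>)) - W (x \<omega>) * measure (K (X k \<omega>)) b"
      using X'_eq_X[of k] by eventually_elim (simp add: v_def algebra_simps)
  qed measurable
  moreover have "\<dots> = (\<integral>\<omega>. W (x \<omega>) * indicat_real b (future k (x' k \<omega>)) \<partial>P) - (\<integral>\<omega>. W (x \<omega>) * measure (K (X k \<omega>)) b \<partial>P)"
    by (intro Bochner_Integration.integral_diff integrable_boundedI)
       (auto simp: abs_mult W1 K_le_1 X_space indicator_def W_def)
  ultimately show ?thesis by (simp add: W_def)
qed

text \<open>Two disintegrations in succession: the future of the second line given the past and the
  first future, by \<open>siblings_uncorrelated\<close>, then the first future given the past, by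
  the Markov property. The kernel is \<open>K\<close> at the state of generation \<open>k\<close>
  both times.\<close>

lemma nn_integral_siblings:
  assumes F[measurable]: "F \<in> borel_measurable ((PiM {..k} (\<lambda>_. E) \<Otimes>\<^sub>M path_space E) \<Otimes>\<^sub>M path_space E)"
  shows "(\<integral>\<^sup>+\<omega>. F ((past k (x \<omega>), future k (x \<omega>)), future k (x' k \<omega>)) \<partial>P)
    = (\<integral>\<^sup>+\<omega>. (\<integral>\<^sup>+z. (\<integral>\<^sup>+z'. F ((past k (x \<omega>), z), z') \<partial>K (X k \<omega>)) \<partial>K (X k \<omega>)) \<partial>P)"
proof -
  let ?G = "PiM {..k} (\<lambda>_. E)"
  have "(\<integral>\<^sup>+\<omega>. F ((past k (x \<omega>), future k (x \<omega>)), future k (x' k \<omega>)) \<partial>P)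
    = (\<integral>\<^sup>+\<omega>. (\<integral>\<^sup>+z'. F ((past k (x \<omega>), future k (x \<omega>)), z') \<partial>K (fst (past k (x \<omega>), future k (x \<omega>)) k)) \<partial>P)"
  proof (rule nn_integral_kernel_rectangles[OF P.prob_space_axioms _ _ _ _ F, where K = "\<lambda>u. K (fst u k)"])
    show "(\<lambda>u. K (fst u k)) \<in> ?G \<Otimes>\<^sub>M path_space E \<rightarrow>\<^sub>M prob_algebra (path_space E)"
      by (rule measurable_compose[OF _ K_measurable]) measurable
    show "(\<integral>\<omega>. indicat_real D (past k (x \<omega>), future k (x \<omega>)) * indicat_real b (future k (x' k \<omega>)) \<partial>P)
      = (\<integral>\<omega>. indicat_real D (past k (x \<omega>), future k (x \<omega>)) * measure (K (fst (past k (x \<omega>), future k (x \<omega>)) k)) b \<partial>P)"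
      if "D \<in> sets (?G \<Otimes>\<^sub>M path_space E)" "b \<in> sets (path_space E)" for D b
      using siblings_uncorrelated[OF that] by simp
  qed measurable
  also have "\<dots> = (\<integral>\<^sup>+\<omega>. (\<lambda>(g, z). \<integral>\<^sup>+z'. F ((g, z), z') \<partial>K (g k)) (past k (x \<omega>), future k (x \<omega>)) \<partial>P)"
    by simp
  also have "\<dots> = (\<integral>\<^sup>+\<omega>. (\<integral>\<^sup>+z. (\<lambda>(g, z). \<integral>\<^sup>+z'. F ((g, z), z') \<partial>K (g k)) (past k (x \<omega>), z) \<partial>K (past k (x \<omega>) k)) \<partial>P)"
  proof (rule nn_integral_kernel_rectangles[OF P.prob_space_axioms, where K = "\<lambda>u. K (u k)"])
    show "(\<lambda>u. K (u k)) \<in> ?G \<rightarrow>\<^sub>M prob_algebra (path_space E)"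
      by (rule measurable_compose[OF _ K_measurable]) measurable
    show "(\<lambda>(g, z). \<integral>\<^sup>+z'. F ((g, z), z') \<partial>K (g k)) \<in> borel_measurable (?G \<Otimes>\<^sub>M path_space E)"
      unfolding split_beta'
    proof (rule nn_integral_measurable_subprob_algebra2[where N = "path_space E"])
      show "(\<lambda>p. K (fst p k)) \<in> ?G \<Otimes>\<^sub>M path_space E \<rightarrow>\<^sub>M subprob_algebra (path_space E)"
        by (rule measurable_compose[OF _ K_measurable']) measurable
    qed measurable
    show "(\<integral>\<omega>. indicat_real D (past k (x \<omega>)) * indicat_real b (future k (x \<omega>)) \<partial>P)
      = (\<integral>\<omega>. indicat_real D (past k (x \<omega>)) * measure (K (past k (x \<omega>) k)) b \<partial>P)"
      if [measurable]: "D \<in> sets ?G" "b \<in> sets (path_space E)" for D b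
      using markov_integral[of "indicat_real D" k b] by simp
  qed measurable
  finally show ?thesis by simp
qed

end

section \<open>Summation over labels and pairs of labels\<close>

lemma nn_integral_lists_of_length:
  fixes g :: "'a \<Rightarrow> ennreal"
  shows "(\<integral>\<^sup>+v. prod_list (map g v) * indicator {v. length v = n} v \<partial>count_space UNIV)
     = (\<integral>\<^sup>+j. g j \<partial>count_space UNIV) ^ n"
proof (induction n)
  case 0
  have "(\<integral>\<^sup>+v. prod_list (map g v) * indicator {v. length v = 0} v \<partial>count_space UNIV)
    = (\<integral>\<^sup>+v. prod_list (map g v) * indicator {[]} v \<partial>count_space UNIV)"
    by (intro nn_integral_cong) (auto simp: indicator_def)
  also have "\<dots> = 1" by (subst nn_integral_indicator_singleton) auto
  finally show ?case by simp
next
  case (Suc n)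
  let ?L = "\<lambda>n. {v :: 'a list. length v = n}"
  have bij: "bij_betw (\<lambda>(j, v). j # v) (UNIV \<times> ?L n) (?L (Suc n))"
    by (rule bij_betwI[where g = "\<lambda>v. (hd v, tl v)"]) (auto simp: length_Suc_conv)
  have "(\<integral>\<^sup>+v. prod_list (map g v) * indicator (?L (Suc n)) v \<partial>count_space UNIV)
    = (\<integral>\<^sup>+v. prod_list (map g v) \<partial>count_space (?L (Suc n)))"
    by (rule nn_integral_count_space_indicator[symmetric]) simp
  also have "\<dots> = (\<integral>\<^sup>+z. prod_list (map g (case z of (j, v) \<Rightarrow> j # v)) \<partial>count_space (UNIV \<times> ?L n))"
    by (rule nn_integral_bij_count_space[OF bij, symmetric])
  also have "\<dots> = (\<integral>\<^sup>+z. prod_list (map g (case z of (j, v) \<Rightarrow> j # v)) * indicator (UNIV \<times> ?L n) z \<partial>count_space UNIV)"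
    by (rule nn_integral_count_space_indicator) simp
  also have "\<dots> = (\<integral>\<^sup>+j. \<integral>\<^sup>+v. g j * (prod_list (map g v) * indicator (?L n) v) \<partial>count_space UNIV \<partial>count_space UNIV)"
    by (subst nn_integral_fst_count_space[symmetric])
       (auto intro!: nn_integral_cong simp: indicator_def)
  also have "\<dots> = (\<integral>\<^sup>+j. g j \<partial>count_space UNIV) ^ Suc n"
    by (simp add: nn_integral_cmult nn_integral_multc Suc.IH)
  finally show ?case .
qed

text \<open>A weight that is multiplicative in the letters gives the lists of length
  \<open>n\<close> a total mass which is an \<open>n\<close>-th power. With \<open>g j\<close> the
  probability of having at least \<open>j\<close> children, the base of this power is the mean
  offspring number.\<close>

lemma nn_integral_lists:
  fixes g :: "'a \<Rightarrow> ennreal" and h :: "nat \<Rightarrow> ennreal"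
  shows "(\<integral>\<^sup>+v. prod_list (map g v) * h (length v) \<partial>count_space UNIV)
     = (\<Sum>n. (\<integral>\<^sup>+j. g j \<partial>count_space UNIV) ^ n * h n)"
proof -
  let ?L = "\<lambda>n. {v :: 'a list. length v = n}"
  have "(\<integral>\<^sup>+v. prod_list (map g v) * h (length v) \<partial>count_space UNIV)
    = (\<integral>\<^sup>+v. \<integral>\<^sup>+n. (\<lambda>(n, v). prod_list (map g v) * h n * indicator (?L n) v) (n, v) \<partial>count_space UNIV \<partial>count_space UNIV)"
  proof (rule nn_integral_cong)
    fix v :: "'a list"
    have "(\<integral>\<^sup>+n. (\<lambda>(n, v). prod_list (map g v) * h n * indicator (?L n) v) (n, v) \<partial>count_space UNIV)
      = (\<integral>\<^sup>+n. (prod_list (map g v) * h n) * indicator {length v} n \<partial>count_space UNIV)"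
      by (intro nn_integral_cong) (auto simp: indicator_def)
    also have "\<dots> = prod_list (map g v) * h (length v)" by (subst nn_integral_indicator_singleton) auto
    finally show "prod_list (map g v) * h (length v) = (\<integral>\<^sup>+n. (\<lambda>(n, v). prod_list (map g v) * h n * indicator (?L n) v) (n, v) \<partial>count_space UNIV)"
      by simp
  qed
  also have "\<dots> = (\<integral>\<^sup>+n. \<integral>\<^sup>+v. (\<lambda>(n, v). prod_list (map g v) * h n * indicator (?L n) v) (n, v) \<partial>count_space UNIV \<partial>count_space UNIV)"
    unfolding nn_integral_fst_count_space nn_integral_snd_count_space ..
  also have "\<dots> = (\<integral>\<^sup>+n. (\<integral>\<^sup>+v. (prod_list (map g v) * indicator (?L n) v) * h n \<partial>count_space UNIV) \<partial>count_space UNIV)"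
    by (simp add: mult_ac)
  also have "\<dots> = (\<integral>\<^sup>+n. (\<integral>\<^sup>+j. g j \<partial>count_space UNIV) ^ n * h n \<partial>count_space UNIV)"
    by (simp add: nn_integral_multc nn_integral_lists_of_length)
  finally show ?thesis by (simp add: nn_integral_count_space_nat)
qed

text \<open>Incomparable labels have a unique longest common prefix \<open>u\<close>, followed by
  distinct letters and then arbitrary tails; this parametrisation is a bijection.\<close>

lemma nn_integral_parallel:
  fixes f :: "'a list \<Rightarrow> 'a list \<Rightarrow> ennreal"
  shows "(\<integral>\<^sup>+v. \<integral>\<^sup>+v'. f v v' * indicator {(v, v'). v \<parallel> v'} (v, v') \<partial>count_space UNIV \<partial>count_space UNIV)
    = (\<integral>\<^sup>+u. \<integral>\<^sup>+i. \<integral>\<^sup>+j. \<integral>\<^sup>+p. \<integral>\<^sup>+q. f (u @ i # p) (u @ j # q) * indicator {(i, j). i \<noteq> j} (i, j)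
        \<partial>count_space UNIV \<partial>count_space UNIV \<partial>count_space UNIV \<partial>count_space UNIV \<partial>count_space UNIV)"
proof -
  let ?I = "{(u, i, j, p, q). i \<noteq> j} :: ('a list \<times> 'a \<times> 'a \<times> 'a list \<times> 'a list) set"
  let ?b = "\<lambda>(u, i, j, p, q). (u @ i # p, u @ j # q) :: 'a list \<times> 'a list"
  let ?J = "{(v, v'). v \<parallel> v'} :: ('a list \<times> 'a list) set"
  have bij: "bij_betw ?b ?I ?J"
  proof (rule bij_betw_imageI)
    have uniq: "u = u' \<and> i = i' \<and> j = j' \<and> p = p' \<and> q = q'"
      if "i \<noteq> j" "i' \<noteq> j'" "u @ i # p = u' @ i' # p'" "u @ j # q = u' @ j' # q'"
      for u u' p p' q q' :: "'a list" and i i' j j'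
      using that
    proof (induction u arbitrary: u')
      case Nil
      then show ?case by (cases u') auto
    next
      case (Cons a u)
      then show ?case by (cases u') auto
    qed
    show "inj_on ?b ?I"
    proof (rule inj_onI)
      fix y z assume yz: "y \<in> ?I" "z \<in> ?I" "?b y = ?b z"
      obtain u i j p q where y: "y = (u, i, j, p, q)" by (cases y)
      obtain u' i' j' p' q' where z: "z = (u', i', j', p', q')" by (cases z)
      show "y = z" using uniq[of i j i' j' u p u' p' q q'] yz unfolding y z by simp
    qed
    show "?b ` ?I = ?J"
    proof (intro equalityI subsetI)
      fix z assume "z \<in> ?b ` ?I"
      then show "z \<in> ?J" by (auto simp: parallel_def)
    next
      fix z assume "z \<in> ?J"
      then obtain v v' where z: "z = (v, v')" "v \<parallel> v'" by auto
      from parallel_decomp[OF z(2)] obtain u i p j q where "i \<noteq> j" "v = u @ i # p" "v' = u @ j # q" by blast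
      then show "z \<in> ?b ` ?I" by (auto simp: z intro!: image_eqI[of _ _ "(u, i, j, p, q)"])
    qed
  qed
  have "(\<integral>\<^sup>+v. \<integral>\<^sup>+v'. f v v' * indicator ?J (v, v') \<partial>count_space UNIV \<partial>count_space UNIV)
    = (\<integral>\<^sup>+z. (case z of (v, v') \<Rightarrow> f v v') * indicator ?J z \<partial>count_space UNIV)"
    by (subst nn_integral_fst_count_space[symmetric]) simp
  also have "\<dots> = (\<integral>\<^sup>+z. (case z of (v, v') \<Rightarrow> f v v') \<partial>count_space ?J)"
    by (rule nn_integral_count_space_indicator[symmetric]) simp
  also have "\<dots> = (\<integral>\<^sup>+y. (case ?b y of (v, v') \<Rightarrow> f v v') \<partial>count_space ?I)"
    by (rule nn_integral_bij_count_space[OF bij, symmetric])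
  also have "\<dots> = (\<integral>\<^sup>+y. (case ?b y of (v, v') \<Rightarrow> f v v') * indicator ?I y \<partial>count_space UNIV)"
    by (rule nn_integral_count_space_indicator) simp
  also have "\<dots> = (\<integral>\<^sup>+u. \<integral>\<^sup>+i. \<integral>\<^sup>+j. \<integral>\<^sup>+p. \<integral>\<^sup>+q. f (u @ i # p) (u @ j # q) * indicator {(i, j). i \<noteq> j} (i, j)
        \<partial>count_space UNIV \<partial>count_space UNIV \<partial>count_space UNIV \<partial>count_space UNIV \<partial>count_space UNIV)"
    unfolding nn_integral_fst_count_space[symmetric]
    by (intro nn_integral_cong) (simp add: indicator_def)
  finally show ?thesis .
qed

text \<open>Prefix and tails have weights multiplicative in the letters, but \<open>i\<close> and
  \<open>j\<close> number children of one and the same cell and therefore need a joint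
  weight.\<close>

lemma nn_integral_parallel_weights:
  fixes g :: "nat \<Rightarrow> ennreal" and g2 :: "nat \<Rightarrow> nat \<Rightarrow> ennreal" and D :: "nat \<Rightarrow> nat \<Rightarrow> nat \<Rightarrow> ennreal"
  defines "c \<equiv> (\<integral>\<^sup>+j. g j \<partial>count_space UNIV)"
    and "c2 \<equiv> (\<integral>\<^sup>+i. \<integral>\<^sup>+j. g2 i j * indicator {(i, j). i \<noteq> j} (i, j) \<partial>count_space UNIV \<partial>count_space UNIV)"
  assumes f: "\<And>u i j p q. i \<noteq> j \<Longrightarrow> f (u @ i # p) (u @ j # q)
      = prod_list (map g u) * g2 i j * prod_list (map g p) * prod_list (map g q) * D (length u) (length p) (length q)"
  shows "(\<integral>\<^sup>+v. \<integral>\<^sup>+v'. f v v' * indicator {(v, v'). v \<parallel> v'} (v, v') \<partial>count_space UNIV \<partial>count_space UNIV)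
    = (\<Sum>k. c ^ k * (c2 * (\<Sum>a. c ^ a * (\<Sum>b. c ^ b * D k a b))))"
proof -
  let ?S = "\<lambda>k. \<Sum>a. c ^ a * (\<Sum>b. c ^ b * D k a b)"
  have "(\<integral>\<^sup>+v. \<integral>\<^sup>+v'. f v v' * indicator {(v, v'). v \<parallel> v'} (v, v') \<partial>count_space UNIV \<partial>count_space UNIV)
    = (\<integral>\<^sup>+u. \<integral>\<^sup>+i. \<integral>\<^sup>+j. \<integral>\<^sup>+p. \<integral>\<^sup>+q. prod_list (map g u) * (g2 i j * indicator {(i, j). i \<noteq> j} (i, j)) * prod_list (map g p)
         * (prod_list (map g q) * D (length u) (length p) (length q))
        \<partial>count_space UNIV \<partial>count_space UNIV \<partial>count_space UNIV \<partial>count_space UNIV \<partial>count_space UNIV)"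
    unfolding nn_integral_parallel by (intro nn_integral_cong) (simp add: f indicator_def mult_ac)
  also have "\<dots> = (\<integral>\<^sup>+u. \<integral>\<^sup>+i. \<integral>\<^sup>+j. \<integral>\<^sup>+p. prod_list (map g u) * (g2 i j * indicator {(i, j). i \<noteq> j} (i, j)) *
         (prod_list (map g p) * (\<Sum>b. c ^ b * D (length u) (length p) b))
        \<partial>count_space UNIV \<partial>count_space UNIV \<partial>count_space UNIV \<partial>count_space UNIV)"
    by (simp add: nn_integral_cmult nn_integral_lists c_def mult.assoc)
  also have "\<dots> = (\<integral>\<^sup>+u. \<integral>\<^sup>+i. \<integral>\<^sup>+j. prod_list (map g u) * ((g2 i j * indicator {(i, j). i \<noteq> j} (i, j)) * ?S (length u))
        \<partial>count_space UNIV \<partial>count_space UNIV \<partial>count_space UNIV)"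
    by (simp add: nn_integral_cmult nn_integral_lists[where h = "\<lambda>a. \<Sum>b. c ^ b * D k a b" for k] c_def[symmetric] mult.assoc)
  also have "\<dots> = (\<integral>\<^sup>+u. prod_list (map g u) * (c2 * ?S (length u)) \<partial>count_space UNIV)"
    by (simp add: nn_integral_cmult nn_integral_multc c2_def)
  also have "\<dots> = (\<Sum>k. c ^ k * (c2 * ?S k))"
    unfolding c_def by (rule nn_integral_lists)
  finally show ?thesis .
qed

section \<open>Moments of the population size\<close>

definition born :: "nat list \<Rightarrow> (nat \<Rightarrow> nat) \<Rightarrow> bool" where
  "born v c \<longleftrightarrow> (\<forall>i<length v. 1 \<le> v ! i \<and> v ! i \<le> c i)"

text \<open>Lifetimes enter only here and offspring numbers only in \<open>born\<close>: a cell
  being alive is split into two events that the independence hypotheses separate.\<close>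

definition alive :: "real \<Rightarrow> nat \<Rightarrow> (nat \<Rightarrow> real) \<Rightarrow> bool" where
  "alive s n r \<longleftrightarrow> (\<Sum>i<n. r i) \<le> s \<and> s < (\<Sum>i<Suc n. r i)"

lemma measurable_born [measurable]: "Measurable.pred (path_space (count_space UNIV)) (born v)"
  unfolding born_def by measurable

lemma measurable_alive [measurable]: "Measurable.pred (path_space borel) (alive s n)"
  unfolding alive_def by measurable

text \<open>
  Both components of \<open>indep_var\<close> have the same type, so the offspring numbers in
  \<open>independent_offspring\<close> are coerced to \<open>real\<close> whenever they are paired with lifetimes.
\<close>

lemma measurable_born_real:
  "Measurable.pred (path_space (count_space (UNIV :: real set))) (\<lambda>c. born v (\<lambda>n. nat \<lfloor>c n\<rfloor>))"
proof -
  have "(\<lambda>c n. nat \<lfloor>c n\<rfloor>) \<in> path_space (count_space (UNIV :: real set)) \<rightarrow>\<^sub>M path_space (count_space UNIV)"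
    by (rule measurable_PiM_single')
       (auto intro!: measurable_compose[OF measurable_component_singleton[where I = UNIV and M = "\<lambda>_. count_space (UNIV :: real set)"]])
  then show ?thesis by (rule measurable_compose[OF _ measurable_born])
qed

text \<open>The hypotheses concern infinite lines, the events finite labels. Events about
  \<open>v\<close> involve only prefixes of \<open>v\<close>, itself included, so any padding by
  positive letters gives the same event.\<close>

definition extend :: "nat list \<Rightarrow> nat \<Rightarrow> nat" where
  "extend v i = (if i < length v then v ! i else 1)"

lemma zero_in_non_label: "v \<notin> labels \<Longrightarrow> 0 \<in> set v"
  by (auto simp: labels_def lists_eq_set Suc_le_eq) (metis gr0I)

lemma extend_in_lines: "v \<in> labels \<Longrightarrow> extend v \<in> lines"
  by (auto simp: extend_def lines_def labels_def lists_eq_set dest!: nth_mem)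

lemma ancestor_extend: "n \<le> length v \<Longrightarrow> ancestor (extend v) n = take n v"
  by (rule nth_equalityI) (auto simp: ancestor_def extend_def)

context branching begin

lemma alive_at_labels: "v \<in> alive_at \<xi> \<kappa> Y s \<omega> \<Longrightarrow> v \<in> labels"
  by (auto simp: alive_at_def cell_born_def labels_def lists_eq_set in_set_conv_nth)

lemma alive_at_iff:
  "v \<in> alive_at \<xi> \<kappa> Y s \<omega> \<longleftrightarrow> born v (\<lambda>n. \<kappa> (y (extend v) \<omega> n)) \<and> alive s (length v) (\<lambda>n. \<xi> (y (extend v) \<omega> n))"
  by (auto simp: alive_at_def cell_born_def birth_time_def born_def alive_def y_def ancestor_extend)

lemma measurable_\<kappa>_path [measurable]: "(\<lambda>w n. \<kappa> (w n)) \<in> path_space E \<rightarrow>\<^sub>M path_space (count_space UNIV)"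
  by (rule measurable_PiM_single') (auto simp: space_PiM)

lemma measurable_\<xi>_path [measurable]: "(\<lambda>w n. \<xi> (w n)) \<in> path_space E \<rightarrow>\<^sub>M path_space borel"
  by (rule measurable_PiM_single') (auto simp: space_PiM)

lemma measurable_born_path [measurable]: "Measurable.pred (path_space E) (\<lambda>w. born v (\<lambda>n. \<kappa> (w n)))"
  by (rule measurable_compose[OF measurable_\<kappa>_path measurable_born])

lemma measurable_alive_path [measurable]: "Measurable.pred (path_space E) (\<lambda>w. alive s m (\<lambda>n. \<xi> (w n)))"
  by (rule measurable_compose[OF measurable_\<xi>_path measurable_alive])

lemma measurable_alive_at: "{\<omega> \<in> space T. v \<in> alive_at \<xi> \<kappa> Y s \<omega>} \<in> sets T"
proof (cases "v \<in> labels")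
  case True
  note [measurable] = measurable_y[OF extend_in_lines[OF True]]
  show ?thesis unfolding alive_at_iff by measurable
next
  case False
  then have "{\<omega> \<in> space T. v \<in> alive_at \<xi> \<kappa> Y s \<omega>} = {}" using alive_at_labels by auto
  then show ?thesis by (simp only: sets.empty_sets)
qed

definition g :: "nat \<Rightarrow> ennreal" where
  "g j = (if 1 \<le> j then emeasure P {\<omega> \<in> space P. j \<le> \<kappa> (X 0 \<omega>)} else 0)"

text \<open>Children \<open>i\<close> and \<open>j\<close> of one cell both exist exactly when its
  offspring number reaches the larger of the two.\<close>

definition g2 :: "nat \<Rightarrow> nat \<Rightarrow> ennreal" where
  "g2 i j = (if 1 \<le> i \<and> 1 \<le> j then g (max i j) else 0)"

definition D :: "real \<Rightarrow> real \<Rightarrow> nat \<Rightarrow> nat \<Rightarrow> nat \<Rightarrow> ennreal" where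
  "D s t k a b = emeasure P {\<omega> \<in> space P. alive s (Suc k + a) (\<lambda>n. \<xi> (x \<omega> n)) \<and> alive t (Suc k + b) (\<lambda>n. \<xi> (x' k \<omega> n))}"

lemma offspring:
  "P.indep_vars (\<lambda>_. count_space UNIV) (\<lambda>n \<omega>. \<kappa> (X n \<omega>)) UNIV"
  "distr P (count_space UNIV) (\<lambda>\<omega>. \<kappa> (X n \<omega>)) = distr P (count_space UNIV) (\<lambda>\<omega>. \<kappa> (X 0 \<omega>))"
  "integrable P (\<lambda>\<omega>. (real (\<kappa> (X 0 \<omega>)))\<^sup>2)"
  "P.indep_var (path_space (count_space UNIV)) (\<lambda>\<omega> n. \<kappa> (X n \<omega>)) (path_space borel) (\<lambda>\<omega> n. \<xi> (X n \<omega>))"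
  "P.indep_var (path_space (count_space UNIV)) (\<lambda>\<omega> n. \<kappa> (X n \<omega>))
       (path_space (count_space UNIV)) (\<lambda>\<omega> n. \<kappa> (X' k (Suc k + n) \<omega>))"
  "P.indep_var (path_space (count_space UNIV) \<Otimes>\<^sub>M path_space (count_space UNIV))
         (\<lambda>\<omega>. (\<lambda>n. \<kappa> (X n \<omega>), \<lambda>n. \<kappa> (X' k n \<omega>)))
       (path_space borel \<Otimes>\<^sub>M path_space borel)
         (\<lambda>\<omega>. (\<lambda>n. \<xi> (X n \<omega>), \<lambda>n. \<xi> (X' k n \<omega>)))"
  using markov unfolding markov_independence_def independent_offspring_def by blast+

lemma indep_emeasure:
  assumes ind: "P.indep_var A U B V" and "Measurable.pred A R" "Measurable.pred B S"
  shows "emeasure P {\<omega> \<in> space P. R (U \<omega>) \<and> S (V \<omega>)}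
    = emeasure P {\<omega> \<in> space P. R (U \<omega>)} * emeasure P {\<omega> \<in> space P. S (V \<omega>)}"
proof -
  have U: "U \<in> P \<rightarrow>\<^sub>M A" and V: "V \<in> P \<rightarrow>\<^sub>M B"
    using P.indep_var_rv1[OF ind] P.indep_var_rv2[OF ind] by auto
  have RS: "{u \<in> space A. R u} \<in> sets A" "{u \<in> space B. S u} \<in> sets B"
    using assms(2,3) by (auto simp: pred_def)
  have "P.prob ((\<lambda>\<omega>. (U \<omega>, V \<omega>)) -` ({u \<in> space A. R u} \<times> {u \<in> space B. S u}) \<inter> space P)
    = P.prob (U -` {u \<in> space A. R u} \<inter> space P) * P.prob (V -` {u \<in> space B. S u} \<inter> space P)"
    by (rule P.indep_varD[OF ind RS])
  moreover have "(\<lambda>\<omega>. (U \<omega>, V \<omega>)) -` ({u \<in> space A. R u} \<times> {u \<in> space B. S u}) \<inter> space P = {\<omega> \<in> space P. R (U \<omega>) \<and> S (V \<omega>)}"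
    "U -` {u \<in> space A. R u} \<inter> space P = {\<omega> \<in> space P. R (U \<omega>)}"
    "V -` {u \<in> space B. S u} \<inter> space P = {\<omega> \<in> space P. S (V \<omega>)}"
    using measurable_space[OF U] measurable_space[OF V] by auto
  ultimately show ?thesis by (simp add: P.emeasure_eq_measure ennreal_mult)
qed

lemma emeasure_\<kappa>_ge: "emeasure P {\<omega> \<in> space P. 1 \<le> j \<and> j \<le> \<kappa> (X n \<omega>)} = g j"
proof -
  have "emeasure P {\<omega> \<in> space P. 1 \<le> j \<and> j \<le> \<kappa> (X n \<omega>)} = emeasure (distr P (count_space UNIV) (\<lambda>\<omega>. \<kappa> (X n \<omega>))) {c. 1 \<le> j \<and> j \<le> c}"
    by (subst emeasure_distr) (auto intro!: arg_cong[where f = "emeasure P"])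
  also have "\<dots> = emeasure P {\<omega> \<in> space P. 1 \<le> j \<and> j \<le> \<kappa> (X 0 \<omega>)}"
    unfolding offspring(2)[of n] by (subst emeasure_distr) (auto intro!: arg_cong[where f = "emeasure P"])
  finally show ?thesis by (simp add: g_def)
qed

text \<open>Offspring numbers along a line are independent and identically distributed, whatever the
  starting generation. The offset \<open>m\<close> serves the tail of a second line, which begins at
  generation \<open>Suc k\<close>.\<close>

lemma emeasure_born: "emeasure P {\<omega> \<in> space P. born v (\<lambda>i. \<kappa> (X (m + i) \<omega>))} = prod_list (map g v)"
\<comment> \<open>The product rule for independent variables requires a nonempty index set.\<close>
proof (cases "v = []")
  case True
  then show ?thesis by (simp add: born_def P.emeasure_space_1)
next
  case False
  let ?n = "length v" and ?A = "\<lambda>i. {c. 1 \<le> v ! (i - m) \<and> v ! (i - m) \<le> c}"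
  have eq: "{\<omega> \<in> space P. born v (\<lambda>i. \<kappa> (X (m + i) \<omega>))} = (\<Inter>i\<in>{m..<m + ?n}. (\<lambda>\<omega>. \<kappa> (X i \<omega>)) -` ?A i \<inter> space P)"
  proof (intro equalityI subsetI)
    fix \<omega> assume "\<omega> \<in> {\<omega> \<in> space P. born v (\<lambda>i. \<kappa> (X (m + i) \<omega>))}"
    then have \<omega>: "\<omega> \<in> space P" "\<And>i. i < ?n \<Longrightarrow> 1 \<le> v ! i \<and> v ! i \<le> \<kappa> (X (m + i) \<omega>)" by (auto simp: born_def)
    show "\<omega> \<in> (\<Inter>i\<in>{m..<m + ?n}. (\<lambda>\<omega>. \<kappa> (X i \<omega>)) -` ?A i \<inter> space P)"
    proof (rule INT_I)
      fix i assume i: "i \<in> {m..<m + ?n}"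
      then have "m + (i - m) = i" "i - m < ?n" by auto
      then show "\<omega> \<in> (\<lambda>\<omega>. \<kappa> (X i \<omega>)) -` ?A i \<inter> space P"
        using \<omega>(1) \<omega>(2)[of "i - m"] by simp
    qed
  next
    fix \<omega> assume A: "\<omega> \<in> (\<Inter>i\<in>{m..<m + ?n}. (\<lambda>\<omega>. \<kappa> (X i \<omega>)) -` ?A i \<inter> space P)"
    have \<omega>: "\<omega> \<in> space P \<and> 1 \<le> v ! (i - m) \<and> v ! (i - m) \<le> \<kappa> (X i \<omega>)" if "i \<in> {m..<m + ?n}" for i
      using INT_D[OF A that] by auto
    show "\<omega> \<in> {\<omega> \<in> space P. born v (\<lambda>i. \<kappa> (X (m + i) \<omega>))}"
      unfolding born_def using \<omega>[of m] \<omega>[of "m + i" for i] False by auto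
  qed
  have "P.prob (\<Inter>i\<in>{m..<m + ?n}. (\<lambda>\<omega>. \<kappa> (X i \<omega>)) -` ?A i \<inter> space P)
    = (\<Prod>i\<in>{m..<m + ?n}. P.prob ((\<lambda>\<omega>. \<kappa> (X i \<omega>)) -` ?A i \<inter> space P))"
    by (rule P.indep_varsD[OF offspring(1)]) (use False in auto)
  then have "emeasure P {\<omega> \<in> space P. born v (\<lambda>i. \<kappa> (X (m + i) \<omega>))}
    = (\<Prod>i\<in>{m..<m + ?n}. emeasure P ((\<lambda>\<omega>. \<kappa> (X i \<omega>)) -` ?A i \<inter> space P))"
    unfolding eq by (simp add: P.emeasure_eq_measure prod_ennreal)
  also have "\<dots> = (\<Prod>i\<in>{m..<m + ?n}. g (v ! (i - m)))"
  proof (rule prod.cong[OF refl])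
    fix i
    have "(\<lambda>\<omega>. \<kappa> (X i \<omega>)) -` ?A i \<inter> space P = {\<omega> \<in> space P. 1 \<le> v ! (i - m) \<and> v ! (i - m) \<le> \<kappa> (X i \<omega>)}" by auto
    then show "emeasure P ((\<lambda>\<omega>. \<kappa> (X i \<omega>)) -` ?A i \<inter> space P) = g (v ! (i - m))"
      using emeasure_\<kappa>_ge by simp
  qed
  also have "\<dots> = (\<Prod>i<?n. g (v ! i))"
    by (rule prod.reindex_bij_witness[where i = "\<lambda>i. m + i" and j = "\<lambda>i. i - m"]) auto
  also have "\<dots> = prod_list (map g v)"
    by (subst prod.list_conv_set_nth) (auto intro!: prod.cong)
  finally show ?thesis .
qed

lemma emeasure_alive_at:
  "emeasure T {\<omega> \<in> space T. v \<in> alive_at \<xi> \<kappa> Y s \<omega>}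
    = prod_list (map g v) * emeasure P {\<omega> \<in> space P. alive s (length v) (\<lambda>n. \<xi> (x \<omega> n))}"
proof (cases "v \<in> labels")
  case True
  let ?l = "extend v" and ?R = "\<lambda>w. born v (\<lambda>n. \<kappa> (w n)) \<and> alive s (length v) (\<lambda>n. \<xi> (w n))"
  have l: "?l \<in> lines" by (rule extend_in_lines[OF True])
  have R: "{w \<in> space (path_space E). ?R w} \<in> sets (path_space E)" by measurable
  have "emeasure T {\<omega> \<in> space T. v \<in> alive_at \<xi> \<kappa> Y s \<omega>} = emeasure (distr T (path_space E) (y ?l)) {w \<in> space (path_space E). ?R w}"
    using measurable_space[OF measurable_y[OF l]]
    by (subst emeasure_distr[OF measurable_y[OF l] R]) (auto simp: alive_at_iff intro!: arg_cong[where f = "emeasure T"])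
  also have "\<dots> = emeasure P {\<omega> \<in> space P. ?R (x \<omega>)}"
    unfolding distr_line[OF l] using measurable_space[OF measurable_x]
    by (subst emeasure_distr[OF measurable_x R]) (auto intro!: arg_cong[where f = "emeasure P"])
  also have "\<dots> = emeasure P {\<omega> \<in> space P. born v (\<lambda>n. \<kappa> (X n \<omega>))} * emeasure P {\<omega> \<in> space P. alive s (length v) (\<lambda>n. \<xi> (X n \<omega>))}"
    using indep_emeasure[OF offspring(4) measurable_born_real measurable_alive] by simp
  finally show ?thesis using emeasure_born[of v 0] by simp
next
  case False
  \<comment> \<open>A list with a zero letter is never alive, and \<open>g 0 = 0\<close> cancels its
    weight; sums may therefore run over all lists.\<close>
  then have "0 \<in> set v" by (rule zero_in_non_label)
  then have "prod_list (map g v) = 0" by (auto simp: prod_list_zero_iff g_def image_iff)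
  moreover have "{\<omega> \<in> space T. v \<in> alive_at \<xi> \<kappa> Y s \<omega>} = {}" using alive_at_labels False by auto
  ultimately show ?thesis by (simp only: emeasure_empty mult_zero_left)
qed

text \<open>The lines share the cells up to generation \<open>k\<close>, so the two requirements on
  the branching cell merge into one for \<open>max i j\<close>. The rest concerns the whole first
  line and the second line beyond generation \<open>k\<close>, which are independent; that second
  part has the law of the corresponding part of \<open>X\<close>.\<close>

lemma emeasure_born_pair:
  assumes "1 \<le> i" "1 \<le> j"
  shows "emeasure P {\<omega> \<in> space P. born (u @ i # p) (\<lambda>n. \<kappa> (X n \<omega>)) \<and> born (u @ j # q) (\<lambda>n. \<kappa> (X' (length u) n \<omega>))}
    = prod_list (map g u) * g2 i j * prod_list (map g p) * prod_list (map g q)"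
proof -
  let ?k = "length u"
  have iff: "born (u @ i # p) (\<lambda>n. \<kappa> (X n \<omega>)) \<and> born (u @ j # q) (\<lambda>n. \<kappa> (X' ?k n \<omega>))
     \<longleftrightarrow> born (u @ max i j # p) (\<lambda>n. \<kappa> (X n \<omega>)) \<and> born q (\<lambda>n. \<kappa> (X' ?k (Suc ?k + n) \<omega>))"
    if eq: "\<forall>n\<le>?k. X' ?k n \<omega> = X n \<omega>" for \<omega>
  proof -
    have b: "born (u @ c # r) z \<longleftrightarrow> born u z \<and> 1 \<le> c \<and> c \<le> z ?k \<and> born r (\<lambda>n. z (Suc ?k + n))" for c r and z :: "nat \<Rightarrow> nat"
    proof -
      have "(\<forall>n < length (u @ c # r). Q n) \<longleftrightarrow> (\<forall>n < ?k. Q n) \<and> Q ?k \<and> (\<forall>n < length r. Q (Suc ?k + n))" for Q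
      proof (intro iffI conjI allI impI)
        fix n assume *: "(\<forall>n<?k. Q n) \<and> Q ?k \<and> (\<forall>n<length r. Q (Suc ?k + n))" and n: "n < length (u @ c # r)"
        have "n < ?k \<or> n = ?k \<or> (n = Suc ?k + (n - Suc ?k) \<and> n - Suc ?k < length r)"
          using n by auto
        then show "Q n" using * by metis
      qed auto
      then show ?thesis unfolding born_def by (simp add: nth_append)
    qed
    have "born u (\<lambda>n. \<kappa> (X' ?k n \<omega>)) \<longleftrightarrow> born u (\<lambda>n. \<kappa> (X n \<omega>))" using eq by (simp add: born_def)
    then show ?thesis unfolding b using eq assms by auto
  qed
  have mX: "(\<lambda>\<omega> n. \<kappa> (X n \<omega>)) \<in> P \<rightarrow>\<^sub>M path_space (count_space UNIV)" "(\<lambda>\<omega> n. \<kappa> (X' ?k n \<omega>)) \<in> P \<rightarrow>\<^sub>M path_space (count_space UNIV)"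
     "(\<lambda>\<omega> n. \<kappa> (X' ?k (Suc ?k + n) \<omega>)) \<in> P \<rightarrow>\<^sub>M path_space (count_space UNIV)"
    by (rule measurable_PiM_single'; auto simp: space_PiM)+
  note [measurable] = measurable_compose[OF mX(1) measurable_born] measurable_compose[OF mX(2) measurable_born] measurable_compose[OF mX(3) measurable_born]
  have "emeasure P {\<omega> \<in> space P. born (u @ i # p) (\<lambda>n. \<kappa> (X n \<omega>)) \<and> born (u @ j # q) (\<lambda>n. \<kappa> (X' ?k n \<omega>))}
    = emeasure P {\<omega> \<in> space P. born (u @ max i j # p) (\<lambda>n. \<kappa> (X n \<omega>)) \<and> born q (\<lambda>n. \<kappa> (X' ?k (Suc ?k + n) \<omega>))}"
  proof (rule emeasure_eq_AE)
    show "AE \<omega> in P. (\<omega> \<in> {\<omega> \<in> space P. born (u @ i # p) (\<lambda>n. \<kappa> (X n \<omega>)) \<and> born (u @ j # q) (\<lambda>n. \<kappa> (X' ?k n \<omega>))}) =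
       (\<omega> \<in> {\<omega> \<in> space P. born (u @ max i j # p) (\<lambda>n. \<kappa> (X n \<omega>)) \<and> born q (\<lambda>n. \<kappa> (X' ?k (Suc ?k + n) \<omega>))})"
      using X'_eq_X[of ?k] by eventually_elim (simp add: iff)
  qed measurable
  also have "\<dots> = emeasure P {\<omega> \<in> space P. born (u @ max i j # p) (\<lambda>n. \<kappa> (X n \<omega>))} * emeasure P {\<omega> \<in> space P. born q (\<lambda>n. \<kappa> (X' ?k (Suc ?k + n) \<omega>))}"
    by (rule indep_emeasure[OF offspring(5) measurable_born measurable_born])
  also have "emeasure P {\<omega> \<in> space P. born q (\<lambda>n. \<kappa> (X' ?k (Suc ?k + n) \<omega>))} = emeasure P {\<omega> \<in> space P. born q (\<lambda>n. \<kappa> (X (Suc ?k + n) \<omega>))}"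
  proof -
    let ?C = "{w \<in> space (path_space E). born q (\<lambda>n. \<kappa> (future ?k w n))}"
    have C: "?C \<in> sets (path_space E)"
      using measurable_compose[OF measurable_future measurable_born_path[of q]] by (auto simp: pred_def)
    have "emeasure (distr P (path_space E) (x' ?k)) ?C = emeasure P {\<omega> \<in> space P. born q (\<lambda>n. \<kappa> (X' ?k (Suc ?k + n) \<omega>))}"
      using measurable_space[OF measurable_x'] by (subst emeasure_distr[OF measurable_x' C]) (auto intro!: arg_cong[where f = "emeasure P"])
    moreover have "emeasure (distr P (path_space E) x) ?C = emeasure P {\<omega> \<in> space P. born q (\<lambda>n. \<kappa> (X (Suc ?k + n) \<omega>))}"
      using measurable_space[OF measurable_x] by (subst emeasure_distr[OF measurable_x C]) (auto intro!: arg_cong[where f = "emeasure P"])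
    ultimately show ?thesis by (simp add: distr_x')
  qed
  finally show ?thesis
    using emeasure_born[of "u @ max i j # p" 0] emeasure_born[of q "Suc ?k"] assms by (simp add: g2_def mult_ac)
qed

text \<open>The offspring numbers of a pair of lines are jointly independent of its lifetimes.
  Births thus give the letter weights, and lifetimes the factor \<open>D\<close>, which sees the
  labels only through their lengths.\<close>

lemma emeasure_alive_pair:
  assumes ij: "i \<noteq> j"
  shows "emeasure T {\<omega> \<in> space T. u @ i # p \<in> alive_at \<xi> \<kappa> Y s \<omega> \<and> u @ j # q \<in> alive_at \<xi> \<kappa> Y t \<omega>}
    = prod_list (map g u) * g2 i j * prod_list (map g p) * prod_list (map g q) * D s t (length u) (length p) (length q)"
proof (cases "u @ i # p \<in> labels \<and> u @ j # q \<in> labels")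
  case True
  let ?k = "length u" and ?v = "u @ i # p" and ?v' = "u @ j # q"
  let ?l = "extend ?v" and ?l' = "extend ?v'"
  have l: "?l \<in> lines" "?l' \<in> lines" using True by (auto intro: extend_in_lines)
  have anc: "ancestor ?l ?k = ancestor ?l' ?k" "?l ?k \<noteq> ?l' ?k" using ij by (simp_all add: ancestor_extend) (simp add: extend_def)
  have i: "1 \<le> i" "1 \<le> j" using True by (auto simp: labels_def)
  let ?B = "\<lambda>w w'. born ?v (\<lambda>n. \<kappa> (w n)) \<and> born ?v' (\<lambda>n. \<kappa> (w' n))"
  let ?A = "\<lambda>w w'. alive s (length ?v) (\<lambda>n. \<xi> (w n)) \<and> alive t (length ?v') (\<lambda>n. \<xi> (w' n))"
  let ?C = "{z \<in> space (path_space E \<Otimes>\<^sub>M path_space E). ?B (fst z) (snd z) \<and> ?A (fst z) (snd z)}"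
  have C: "?C \<in> sets (path_space E \<Otimes>\<^sub>M path_space E)"
  proof -
    note [measurable] = measurable_compose[OF measurable_fst measurable_born_path] measurable_compose[OF measurable_snd measurable_born_path]
      measurable_compose[OF measurable_fst measurable_alive_path] measurable_compose[OF measurable_snd measurable_alive_path]
    show ?thesis by measurable
  qed
  have my: "(\<lambda>\<omega>. (y ?l \<omega>, y ?l' \<omega>)) \<in> T \<rightarrow>\<^sub>M path_space E \<Otimes>\<^sub>M path_space E"
    using measurable_y l by (intro measurable_Pair)
  have mx: "(\<lambda>\<omega>. (x \<omega>, x' ?k \<omega>)) \<in> P \<rightarrow>\<^sub>M path_space E \<Otimes>\<^sub>M path_space E" by measurable
  have "emeasure T {\<omega> \<in> space T. ?v \<in> alive_at \<xi> \<kappa> Y s \<omega> \<and> ?v' \<in> alive_at \<xi> \<kappa> Y t \<omega>}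
    = emeasure (distr T (path_space E \<Otimes>\<^sub>M path_space E) (\<lambda>\<omega>. (y ?l \<omega>, y ?l' \<omega>))) ?C"
    using measurable_space[OF my]
    by (subst emeasure_distr[OF my C]) (auto simp: alive_at_iff intro!: arg_cong[where f = "emeasure T"])
  also have "\<dots> = emeasure P {\<omega> \<in> space P. ?B (x \<omega>) (x' ?k \<omega>) \<and> ?A (x \<omega>) (x' ?k \<omega>)}"
    unfolding distr_pair_lines[OF l anc] using measurable_space[OF mx]
    by (subst emeasure_distr[OF mx C]) (auto intro!: arg_cong[where f = "emeasure P"])
  also have "\<dots> = emeasure P {\<omega> \<in> space P. ?B (x \<omega>) (x' ?k \<omega>)} * emeasure P {\<omega> \<in> space P. ?A (x \<omega>) (x' ?k \<omega>)}"
  proof -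
    note b = measurable_compose[OF measurable_fst measurable_born_real] measurable_compose[OF measurable_snd measurable_born_real]
    note a = measurable_compose[OF measurable_fst measurable_alive] measurable_compose[OF measurable_snd measurable_alive]
    have "Measurable.pred (path_space (count_space UNIV) \<Otimes>\<^sub>M path_space (count_space UNIV)) (\<lambda>z. born ?v (\<lambda>n. nat \<lfloor>fst z n :: real\<rfloor>) \<and> born ?v' (\<lambda>n. nat \<lfloor>snd z n :: real\<rfloor>))"
      "Measurable.pred (path_space borel \<Otimes>\<^sub>M path_space borel) (\<lambda>z. alive s (length ?v) (fst z) \<and> alive t (length ?v') (snd z))"
      by (intro pred_intros_logic b a)+
    from indep_emeasure[OF offspring(6) this, of ?k] show ?thesis by simp
  qed
  finally show ?thesis using emeasure_born_pair[OF i, of u p q] by (simp add: D_def)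
next
  case False
  then have "0 \<in> set (u @ i # p) \<union> set (u @ j # q)" using zero_in_non_label by blast
  then have "prod_list (map g u) * g2 i j * prod_list (map g p) * prod_list (map g q) = 0"
    by (auto simp: prod_list_zero_iff g_def g2_def image_iff)
  moreover have "{\<omega> \<in> space T. u @ i # p \<in> alive_at \<xi> \<kappa> Y s \<omega> \<and> u @ j # q \<in> alive_at \<xi> \<kappa> Y t \<omega>} = {}"
    using alive_at_labels False by blast
  ultimately show ?thesis by (simp only: emeasure_empty mult_zero_left)
qed

end

lemma sum_split_Suc:
  fixes r :: "nat \<Rightarrow> real"
  shows "(\<Sum>i<Suc k + a. r i) = (\<Sum>i\<le>k. r i) + (\<Sum>n<a. r (Suc k + n))"
proof (induction a)
  case (Suc a)
  then show ?case by (simp only: add_Suc_right sum.lessThan_Suc add.assoc)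
qed (simp add: lessThan_Suc_atMost)

text \<open>The clock is restarted when the cell of generation \<open>k\<close> dies, so that
  generation \<open>Suc k + a\<close> becomes generation \<open>a\<close>.\<close>

lemma alive_shift:
  "alive s (Suc k + a) r \<longleftrightarrow> alive (s - (\<Sum>i\<le>k. r i)) a (\<lambda>n. r (Suc k + n))"
  unfolding alive_def using sum_split_Suc[where k = k and r = r and a = a] sum_split_Suc[where k = k and r = r and a = "Suc a"]
  by (simp only: add_Suc_right) (auto simp: algebra_simps)

section \<open>Offspring moments and the mean progeny of one child\<close>

context branching begin

abbreviation "k1 \<equiv> kappa1 \<kappa> P X"
abbreviation "k2 \<equiv> kappa2 \<kappa> P X"

lemma integrable_\<kappa>2: "integrable P (\<lambda>\<omega>. real (\<kappa> (X 0 \<omega>)) * (real (\<kappa> (X 0 \<omega>)) - 1))"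
  and integrable_\<kappa>: "integrable P (\<lambda>\<omega>. real (\<kappa> (X 0 \<omega>)))"
proof -
  show int: "integrable P (\<lambda>\<omega>. real (\<kappa> (X 0 \<omega>)))"
  proof (rule Bochner_Integration.integrable_bound[OF offspring(3)])
    show "AE \<omega> in P. norm (real (\<kappa> (X 0 \<omega>))) \<le> norm ((real (\<kappa> (X 0 \<omega>)))\<^sup>2)"
    proof (rule AE_I2)
      fix \<omega> assume "\<omega> \<in> space P"
      then have "1 \<le> real (\<kappa> (X 0 \<omega>))" using \<kappa>_ge_2[OF X_space, of \<omega> 0] by simp
      then show "norm (real (\<kappa> (X 0 \<omega>))) \<le> norm ((real (\<kappa> (X 0 \<omega>)))\<^sup>2)"
        using mult_left_mono[of 1 "real (\<kappa> (X 0 \<omega>))" "real (\<kappa> (X 0 \<omega>))"] by (simp add: power2_eq_square)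
    qed
  qed measurable
  have "(\<lambda>\<omega>. real (\<kappa> (X 0 \<omega>)) * (real (\<kappa> (X 0 \<omega>)) - 1)) = (\<lambda>\<omega>. (real (\<kappa> (X 0 \<omega>)))\<^sup>2 - real (\<kappa> (X 0 \<omega>)))"
    by (simp add: algebra_simps power2_eq_square)
  then show "integrable P (\<lambda>\<omega>. real (\<kappa> (X 0 \<omega>)) * (real (\<kappa> (X 0 \<omega>)) - 1))"
    using int offspring(3) by simp
qed

lemma k1_ge_2: "2 \<le> k1"
proof -
  have "(\<integral>\<omega>. 2 \<partial>P) \<le> k1" unfolding kappa1_def
    by (rule integral_mono[OF _ integrable_\<kappa>]) (use \<kappa>_ge_2[OF X_space, of _ 0] in auto)
  then show ?thesis by (simp add: P.prob_space)
qed

lemma k2_eq: "k2 = (\<integral>\<omega>. real (\<kappa> (X 0 \<omega>)) * (real (\<kappa> (X 0 \<omega>)) - 1) \<partial>P)"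
proof -
  have "(\<integral>c. real c * (real c - 1) \<partial>distr P (count_space UNIV) (\<lambda>\<omega>. \<kappa> (X 1 \<omega>)))
    = (\<integral>c. real c * (real c - 1) \<partial>distr P (count_space UNIV) (\<lambda>\<omega>. \<kappa> (X 0 \<omega>)))"
    by (simp only: offspring(2)[of 1])
  then show ?thesis by (simp add: integral_distr kappa2_def)
qed

lemma k2_ge_2: "2 \<le> k2"
proof -
  have "(\<integral>\<omega>. 2 \<partial>P) \<le> k2" unfolding k2_eq
  proof (rule integral_mono[OF _ integrable_\<kappa>2])
    fix \<omega> assume "\<omega> \<in> space P"
    then have "2 \<le> real (\<kappa> (X 0 \<omega>))" using \<kappa>_ge_2[OF X_space, of \<omega> 0] by simp
    then show "2 \<le> real (\<kappa> (X 0 \<omega>)) * (real (\<kappa> (X 0 \<omega>)) - 1)"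
      using mult_mono[of 2 "real (\<kappa> (X 0 \<omega>))" 1 "real (\<kappa> (X 0 \<omega>)) - 1"] by simp
  qed simp
  then show ?thesis by (simp add: P.prob_space)
qed

text \<open>The tail-sum formula for an expectation: under the integral, the sum counts the
  children.\<close>

lemma sum_g: "(\<integral>\<^sup>+j. g j \<partial>count_space UNIV) = ennreal k1"
proof -
  have g_eq: "g j = (\<integral>\<^sup>+\<omega>. indicator {1..\<kappa> (X 0 \<omega>)} j \<partial>P)" for j
  proof -
    have "g j = emeasure P {\<omega> \<in> space P. 1 \<le> j \<and> j \<le> \<kappa> (X 0 \<omega>)}" by (rule emeasure_\<kappa>_ge[symmetric])
    also have "\<dots> = (\<integral>\<^sup>+\<omega>. indicator {\<omega> \<in> space P. 1 \<le> j \<and> j \<le> \<kappa> (X 0 \<omega>)} \<omega> \<partial>P)" by simp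
    also have "\<dots> = (\<integral>\<^sup>+\<omega>. indicator {1..\<kappa> (X 0 \<omega>)} j \<partial>P)"
      by (intro nn_integral_cong) (auto simp: indicator_def)
    finally show ?thesis .
  qed
  have [measurable]: "(\<lambda>\<omega>. indicator {1..\<kappa> (X 0 \<omega>)} j :: ennreal) \<in> borel_measurable P" for j
    unfolding indicator_def by measurable
  have "(\<integral>\<^sup>+j. g j \<partial>count_space UNIV) = (\<integral>\<^sup>+\<omega>. (\<integral>\<^sup>+j. indicator {1..\<kappa> (X 0 \<omega>)} j \<partial>count_space UNIV) \<partial>P)"
    unfolding g_eq by (rule nn_integral_count_space_nn_integral[symmetric]) auto
  also have "\<dots> = (\<integral>\<^sup>+\<omega>. ennreal (real (\<kappa> (X 0 \<omega>))) \<partial>P)"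
    by (simp add: ennreal_of_nat_eq_real_of_nat)
  also have "\<dots> = ennreal k1" unfolding kappa1_def
    by (rule nn_integral_eq_integral[OF integrable_\<kappa>]) simp
  finally show ?thesis .
qed

text \<open>Under the integral the double sum counts ordered pairs of distinct children,
  \<open>c * (c - 1)\<close> of them for offspring number \<open>c\<close>. This is the origin of
  the factor \<open>k2\<close>.\<close>

lemma sum_g2: "(\<integral>\<^sup>+i. \<integral>\<^sup>+j. g2 i j * indicator {(i, j). i \<noteq> j} (i, j) \<partial>count_space UNIV \<partial>count_space UNIV) = ennreal k2"
proof -
  define I where "I c i j = (if i \<in> {1..c} \<and> j \<in> {1..c} - {i} then 1 else 0 :: ennreal)" for c i j :: nat
  have g_eq: "g2 i j * indicator {(i, j). i \<noteq> j} (i, j) = (\<integral>\<^sup>+\<omega>. I (\<kappa> (X 0 \<omega>)) i j \<partial>P)" for i j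
  proof (cases "1 \<le> i \<and> 1 \<le> j \<and> i \<noteq> j")
    case True
    then have "g2 i j * indicator {(i, j). i \<noteq> j} (i, j) = emeasure P {\<omega> \<in> space P. max i j \<le> \<kappa> (X 0 \<omega>)}"
      by (simp add: g2_def g_def le_max_iff_disj)
    also have "\<dots> = (\<integral>\<^sup>+\<omega>. indicator {\<omega> \<in> space P. max i j \<le> \<kappa> (X 0 \<omega>)} \<omega> \<partial>P)" by simp
    also have "\<dots> = (\<integral>\<^sup>+\<omega>. I (\<kappa> (X 0 \<omega>)) i j \<partial>P)"
      using True by (intro nn_integral_cong) (auto simp: indicator_def I_def)
    finally show ?thesis .
  qed (auto simp: g2_def I_def)
  have [measurable]: "(\<lambda>\<omega>. I (\<kappa> (X 0 \<omega>)) i j) \<in> borel_measurable P" for i j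
    by (rule measurable_compose[of "\<lambda>\<omega>. \<kappa> (X 0 \<omega>)" P "count_space UNIV" "\<lambda>c. I c i j"]) auto
  have inner: "(\<integral>\<^sup>+i. (\<integral>\<^sup>+j. I c i j \<partial>count_space UNIV) \<partial>count_space UNIV) = ennreal (real c * (real c - 1))" if "2 \<le> c" for c
  proof -
    have "(\<integral>\<^sup>+j. I c i j \<partial>count_space UNIV) = ennreal (real c - 1) * indicator {1..c} i" for i
    proof -
      have "(\<integral>\<^sup>+j. I c i j \<partial>count_space UNIV) = (\<integral>\<^sup>+j. indicator (if i \<in> {1..c} then {1..c} - {i} else {}) j \<partial>count_space UNIV)"
        by (intro nn_integral_cong) (simp add: I_def indicator_def)
      also have "\<dots> = (if i \<in> {1..c} then of_nat (c - 1) else 0)"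
        by (auto simp: card_Diff_singleton)
      finally show ?thesis using that by (simp add: indicator_def ennreal_of_nat_eq_real_of_nat of_nat_diff)
    qed
    then have "(\<integral>\<^sup>+i. (\<integral>\<^sup>+j. I c i j \<partial>count_space UNIV) \<partial>count_space UNIV) = ennreal (real c - 1) * of_nat c"
      by (simp add: nn_integral_cmult)
    then show ?thesis using that
      by (simp add: ennreal_of_nat_eq_real_of_nat mult.commute flip: ennreal_mult)
  qed
  have "(\<integral>\<^sup>+i. \<integral>\<^sup>+j. g2 i j * indicator {(i, j). i \<noteq> j} (i, j) \<partial>count_space UNIV \<partial>count_space UNIV)
     = (\<integral>\<^sup>+i. (\<integral>\<^sup>+\<omega>. (\<integral>\<^sup>+j. I (\<kappa> (X 0 \<omega>)) i j \<partial>count_space UNIV) \<partial>P) \<partial>count_space UNIV)"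
    unfolding g_eq by (intro nn_integral_cong nn_integral_count_space_nn_integral[symmetric]) auto
  also have "\<dots> = (\<integral>\<^sup>+\<omega>. (\<integral>\<^sup>+i. (\<integral>\<^sup>+j. I (\<kappa> (X 0 \<omega>)) i j \<partial>count_space UNIV) \<partial>count_space UNIV) \<partial>P)"
  proof (rule nn_integral_count_space_nn_integral[symmetric])
    show "(\<lambda>\<omega>. \<integral>\<^sup>+j. I (\<kappa> (X 0 \<omega>)) i j \<partial>count_space UNIV) \<in> borel_measurable P" for i
      by (rule measurable_compose[of "\<lambda>\<omega>. \<kappa> (X 0 \<omega>)" P "count_space UNIV" "\<lambda>c. \<integral>\<^sup>+j. I c i j \<partial>count_space UNIV"]) auto
  qed simp
  also have "\<dots> = (\<integral>\<^sup>+\<omega>. ennreal (real (\<kappa> (X 0 \<omega>)) * (real (\<kappa> (X 0 \<omega>)) - 1)) \<partial>P)"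
    by (intro nn_integral_cong inner \<kappa>_ge_2 X_space)
  also have "\<dots> = ennreal k2" unfolding k2_eq
    by (rule nn_integral_eq_integral[OF integrable_\<kappa>2])
       (use \<kappa>_ge_2[OF X_space, of _ 0] in \<open>force intro!: AE_I2 mult_nonneg_nonneg\<close>)
  finally show ?thesis .
qed

text \<open>For a child of a cell in state \<open>c\<close>: the probability, as far as lifetimes
  are concerned, that on a line through this child the cell \<open>a\<close> generations below it is
  alive \<open>s\<close> units of time after the child's birth.\<close>

definition H :: "nat \<Rightarrow> 'x \<Rightarrow> real \<Rightarrow> ennreal" where
  "H a c s = (\<integral>\<^sup>+z. (if alive s a (\<lambda>n. \<xi> (z n)) then 1 else 0) \<partial>K c)"

text \<open>The mean number of living cells descending from such a child, itself included,
  \<open>s\<close> units of time after its birth. Its closed form is \<open>h_eq\<close>.\<close>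

definition h :: "'x \<Rightarrow> real \<Rightarrow> ennreal" where
  "h c s = (\<Sum>a. ennreal k1 ^ a * H a c s)"

abbreviation "S k \<omega> \<equiv> life_sum \<xi> (\<lambda>j. X j \<omega>) k"

lemma measurable_S [measurable]: "(\<lambda>\<omega>. S k \<omega>) \<in> borel_measurable P"
  unfolding life_sum_def by measurable

lemma measurable_H [measurable]:
  assumes [measurable]: "f \<in> M \<rightarrow>\<^sub>M E" "r \<in> borel_measurable M"
  shows "(\<lambda>\<omega>. H a (f \<omega>) (r \<omega>)) \<in> borel_measurable M"
  unfolding H_def
proof (rule nn_integral_measurable_subprob_algebra2[where N = "path_space E"])
  show "(\<lambda>(\<omega>, z). if alive (r \<omega>) a (\<lambda>n. \<xi> (z n)) then 1 else 0 :: ennreal) \<in> borel_measurable (M \<Otimes>\<^sub>M path_space E)"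
    unfolding alive_def split_beta' by measurable
  show "(\<lambda>\<omega>. K (f \<omega>)) \<in> M \<rightarrow>\<^sub>M subprob_algebra (path_space E)"
    by (rule measurable_compose[OF assms(1) K_measurable'])
qed

lemma measurable_h [measurable]:
  assumes [measurable]: "f \<in> M \<rightarrow>\<^sub>M E" "r \<in> borel_measurable M"
  shows "(\<lambda>\<omega>. h (f \<omega>) (r \<omega>)) \<in> borel_measurable M"
  unfolding h_def by measurable

lemma measurable_coordinates:
  "i \<in> {..k} \<Longrightarrow> (\<lambda>p. \<xi> (fst (fst p) i)) \<in> borel_measurable ((PiM {..k} (\<lambda>_. E) \<Otimes>\<^sub>M path_space E) \<Otimes>\<^sub>M path_space E)"
  "(\<lambda>p. \<Sum>i\<le>k. \<xi> (fst (fst p) i)) \<in> borel_measurable ((PiM {..k} (\<lambda>_. E) \<Otimes>\<^sub>M path_space E) \<Otimes>\<^sub>M path_space E)"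
  "(\<lambda>p. \<xi> (fst (fst p) 0)) \<in> borel_measurable ((PiM {..k} (\<lambda>_. E) \<Otimes>\<^sub>M path_space E) \<Otimes>\<^sub>M path_space E)"
  "(\<lambda>p. \<xi> (snd (fst p) i)) \<in> borel_measurable ((PiM {..k} (\<lambda>_. E) \<Otimes>\<^sub>M path_space E) \<Otimes>\<^sub>M path_space E)"
  "(\<lambda>p. \<xi> (snd p i)) \<in> borel_measurable ((PiM {..k} (\<lambda>_. E) \<Otimes>\<^sub>M path_space E) \<Otimes>\<^sub>M path_space E)"
proof -
  show *: "(\<lambda>p. \<xi> (fst (fst p) i)) \<in> borel_measurable ((PiM {..k} (\<lambda>_. E) \<Otimes>\<^sub>M path_space E) \<Otimes>\<^sub>M path_space E)"
    if "i \<in> {..k}" for i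
    by (rule measurable_compose[OF measurable_compose[OF measurable_compose[OF measurable_fst measurable_fst]
          measurable_component_singleton[OF that, where M = "\<lambda>_. E"]] measurable_\<xi>])
  show "(\<lambda>p. \<xi> (fst (fst p) 0)) \<in> borel_measurable ((PiM {..k} (\<lambda>_. E) \<Otimes>\<^sub>M path_space E) \<Otimes>\<^sub>M path_space E)"
    by (rule *) simp
  show "(\<lambda>p. \<Sum>i\<le>k. \<xi> (fst (fst p) i)) \<in> borel_measurable ((PiM {..k} (\<lambda>_. E) \<Otimes>\<^sub>M path_space E) \<Otimes>\<^sub>M path_space E)"
    by (rule borel_measurable_sum[OF *])
  show "(\<lambda>p. \<xi> (snd (fst p) i)) \<in> borel_measurable ((PiM {..k} (\<lambda>_. E) \<Otimes>\<^sub>M path_space E) \<Otimes>\<^sub>M path_space E)"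
    by (rule measurable_compose[OF measurable_compose[OF measurable_compose[OF measurable_fst measurable_snd]
          measurable_component_singleton[OF UNIV_I, where M = "\<lambda>_. E"]] measurable_\<xi>])
  show "(\<lambda>p. \<xi> (snd p i)) \<in> borel_measurable ((PiM {..k} (\<lambda>_. E) \<Otimes>\<^sub>M path_space E) \<Otimes>\<^sub>M path_space E)"
    by (rule measurable_compose[OF measurable_compose[OF measurable_snd
          measurable_component_singleton[OF UNIV_I, where M = "\<lambda>_. E"]] measurable_\<xi>])
qed

text \<open>Both clocks are restarted at the end of life \<open>S k \<omega>\<close> of the
  branching cell. That time depends on the past alone, and given the past the two subtrees are
  independent with the same kernel.\<close>

lemma D_eq: "D s t k a b = (\<integral>\<^sup>+\<omega>. H a (X k \<omega>) (s - S k \<omega>) * H b (X k \<omega>) (t - S k \<omega>) \<partial>P)"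
proof -
  let ?\<sigma> = "\<lambda>w. \<Sum>i\<le>k. \<xi> (w i)"
  let ?i = "\<lambda>s a w z. if alive (s - ?\<sigma> w) a (\<lambda>n. \<xi> (z n)) then 1 else 0 :: ennreal"
  define F where "F = (\<lambda>p. ?i s a (fst (fst p)) (snd (fst p)) * ?i t b (fst (fst p)) (snd p))"
  have F: "F \<in> borel_measurable ((PiM {..k} (\<lambda>_. E) \<Otimes>\<^sub>M path_space E) \<Otimes>\<^sub>M path_space E)"
  proof -
    note [measurable] = measurable_coordinates[where k = k]
    show ?thesis unfolding F_def alive_def by measurable
  qed
  have \<sigma>: "?\<sigma> (past k (x \<omega>)) = S k \<omega>" for \<omega> by (simp add: life_sum_def)
  note [measurable] = measurable_compose[OF measurable_x measurable_alive_path] measurable_compose[OF measurable_x' measurable_alive_path]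
  have "D s t k a b = (\<integral>\<^sup>+\<omega>. indicator {\<omega> \<in> space P. alive s (Suc k + a) (\<lambda>n. \<xi> (x \<omega> n)) \<and> alive t (Suc k + b) (\<lambda>n. \<xi> (x' k \<omega> n))} \<omega> \<partial>P)"
    unfolding D_def by (rule nn_integral_indicator[symmetric]) measurable
  also have "\<dots> = (\<integral>\<^sup>+\<omega>. F ((past k (x \<omega>), future k (x \<omega>)), future k (x' k \<omega>)) \<partial>P)"
  proof (rule nn_integral_cong_AE)
    show "AE \<omega> in P. indicator {\<omega> \<in> space P. alive s (Suc k + a) (\<lambda>n. \<xi> (x \<omega> n)) \<and> alive t (Suc k + b) (\<lambda>n. \<xi> (x' k \<omega> n))} \<omega>
       = F ((past k (x \<omega>), future k (x \<omega>)), future k (x' k \<omega>))"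
      using X'_eq_X[of k] AE_space
    proof eventually_elim
      case (elim \<omega>)
      then have "(\<Sum>i\<le>k. \<xi> (X' k i \<omega>)) = (\<Sum>i\<le>k. \<xi> (X i \<omega>))" by (intro sum.cong) auto
      then show ?case using elim unfolding alive_shift F_def fst_conv snd_conv \<sigma>
        by (simp add: life_sum_def indicator_def)
    qed
  qed
  also have "\<dots> = (\<integral>\<^sup>+\<omega>. (\<integral>\<^sup>+z. (\<integral>\<^sup>+z'. F ((past k (x \<omega>), z), z') \<partial>K (X k \<omega>)) \<partial>K (X k \<omega>)) \<partial>P)"
    by (rule nn_integral_siblings[OF F])
  also have "\<dots> = (\<integral>\<^sup>+\<omega>. H a (X k \<omega>) (s - S k \<omega>) * H b (X k \<omega>) (t - S k \<omega>) \<partial>P)"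
  proof (rule nn_integral_cong)
    fix \<omega> assume "\<omega> \<in> space P"
    have m: "(\<lambda>z. if alive r a (\<lambda>n. \<xi> (z n)) then 1 else 0 :: ennreal) \<in> borel_measurable (K (X k \<omega>))" for r a
      unfolding measurable_cong_sets[OF K_space(2) refl] by measurable
    show "(\<integral>\<^sup>+z. (\<integral>\<^sup>+z'. F ((past k (x \<omega>), z), z') \<partial>K (X k \<omega>)) \<partial>K (X k \<omega>)) = H a (X k \<omega>) (s - S k \<omega>) * H b (X k \<omega>) (t - S k \<omega>)"
      unfolding F_def fst_conv snd_conv \<sigma> H_def
      by (subst nn_integral_cmult[OF m], subst nn_integral_multc[OF m]) simp
  qed
  finally show ?thesis .
qed

text \<open>This is \<open>nn_integral_siblings\<close> at \<open>k = 0\<close> for an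
  \<open>F\<close> constant in its last argument; the innermost integral is then the total mass
  1.\<close>

lemma emeasure_alive_eq:
  "emeasure P {\<omega> \<in> space P. alive s (Suc a) (\<lambda>n. \<xi> (x \<omega> n))} = (\<integral>\<^sup>+\<omega>. H a (X 0 \<omega>) (s - S 0 \<omega>) \<partial>P)"
proof -
  let ?i = "\<lambda>w z. if alive (s - \<xi> (w (0::nat))) a (\<lambda>n. \<xi> (z n)) then 1 else 0 :: ennreal"
  define F where "F = (\<lambda>p :: ((nat \<Rightarrow> 'x) \<times> (nat \<Rightarrow> 'x)) \<times> (nat \<Rightarrow> 'x). ?i (fst (fst p)) (snd (fst p)))"
  have F: "F \<in> borel_measurable ((PiM {..0} (\<lambda>_. E) \<Otimes>\<^sub>M path_space E) \<Otimes>\<^sub>M path_space E)"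
  proof -
    note [measurable] = measurable_coordinates[where k = 0]
    show ?thesis unfolding F_def alive_def by measurable
  qed
  note [measurable] = measurable_compose[OF measurable_x measurable_alive_path]
  have "emeasure P {\<omega> \<in> space P. alive s (Suc a) (\<lambda>n. \<xi> (x \<omega> n))} = (\<integral>\<^sup>+\<omega>. indicator {\<omega> \<in> space P. alive s (Suc 0 + a) (\<lambda>n. \<xi> (x \<omega> n))} \<omega> \<partial>P)"
  proof -
    have "{\<omega> \<in> space P. alive s (Suc 0 + a) (\<lambda>n. \<xi> (x \<omega> n))} \<in> sets P" by measurable
    from nn_integral_indicator[OF this] show ?thesis by (simp only: add_Suc add_0)
  qed
  also have "\<dots> = (\<integral>\<^sup>+\<omega>. F ((past 0 (x \<omega>), future 0 (x \<omega>)), future 0 (x' 0 \<omega>)) \<partial>P)"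
    unfolding alive_shift F_def by (intro nn_integral_cong) (simp add: indicator_def)
  also have "\<dots> = (\<integral>\<^sup>+\<omega>. (\<integral>\<^sup>+z. (\<integral>\<^sup>+z'. F ((past 0 (x \<omega>), z), z') \<partial>K (X 0 \<omega>)) \<partial>K (X 0 \<omega>)) \<partial>P)"
    by (rule nn_integral_siblings[OF F])
  also have "\<dots> = (\<integral>\<^sup>+\<omega>. H a (X 0 \<omega>) (s - S 0 \<omega>) \<partial>P)"
    unfolding F_def fst_conv snd_conv H_def
    by (intro nn_integral_cong) (simp add: life_sum_def X_space K_space(1) prob_space.emeasure_space_1)
  finally show ?thesis .
qed

lemma sum_D: "(\<Sum>a. ennreal k1 ^ a * (\<Sum>b. ennreal k1 ^ b * D s t k a b))
   = (\<integral>\<^sup>+\<omega>. h (X k \<omega>) (s - S k \<omega>) * h (X k \<omega>) (t - S k \<omega>) \<partial>P)"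
proof -
  have "(\<Sum>a. ennreal k1 ^ a * (\<Sum>b. ennreal k1 ^ b * D s t k a b))
    = (\<Sum>a. ennreal k1 ^ a * (\<Sum>b. (\<integral>\<^sup>+\<omega>. H a (X k \<omega>) (s - S k \<omega>) * (ennreal k1 ^ b * H b (X k \<omega>) (t - S k \<omega>)) \<partial>P)))"
    unfolding D_eq by (subst nn_integral_cmult[symmetric]) (simp_all add: mult_ac)
  also have "\<dots> = (\<Sum>a. ennreal k1 ^ a * (\<integral>\<^sup>+\<omega>. H a (X k \<omega>) (s - S k \<omega>) * h (X k \<omega>) (t - S k \<omega>) \<partial>P))"
    by (subst nn_integral_suminf[symmetric]) (simp_all add: h_def)
  also have "\<dots> = (\<Sum>a. (\<integral>\<^sup>+\<omega>. ennreal k1 ^ a * H a (X k \<omega>) (s - S k \<omega>) * h (X k \<omega>) (t - S k \<omega>) \<partial>P))"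
    by (subst nn_integral_cmult[symmetric]) (simp_all add: mult_ac)
  also have "\<dots> = (\<integral>\<^sup>+\<omega>. (\<Sum>a. ennreal k1 ^ a * H a (X k \<omega>) (s - S k \<omega>) * h (X k \<omega>) (t - S k \<omega>)) \<partial>P)"
    by (subst nn_integral_suminf) simp_all
  finally show ?thesis by (simp add: h_def[symmetric])
qed

end

lemma borel_measurable_nn_integral_count_space:
  fixes f :: "'i :: countable \<Rightarrow> 'a \<Rightarrow> ennreal"
  assumes "infinite (UNIV :: 'i set)" and [measurable]: "\<And>i. f i \<in> borel_measurable M"
  shows "(\<lambda>\<omega>. \<integral>\<^sup>+i. f i \<omega> \<partial>count_space UNIV) \<in> borel_measurable M"
proof -
  have bij: "bij_betw (from_nat_into (UNIV :: 'i set)) UNIV UNIV"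
    using assms(1) by (intro bij_betw_from_nat_into) auto
  have "(\<integral>\<^sup>+i. f i \<omega> \<partial>count_space UNIV) = (\<Sum>n. f (from_nat_into UNIV n) \<omega>)" for \<omega>
    unfolding nn_integral_bij_count_space[OF bij, symmetric] by (rule nn_integral_count_space_nat)
  then show ?thesis by simp
qed

section \<open>Comparable and incomparable pairs of living cells\<close>

context branching begin

lemma Y_\<xi>_nonneg: "v \<in> labels \<Longrightarrow> \<omega> \<in> space T \<Longrightarrow> 0 \<le> \<xi> (Y v \<omega>)"
  using measurable_space[OF measurable_Y] \<xi>_nonneg by auto

lemma death_le_birth:
  assumes v: "v \<in> labels" and \<omega>: "\<omega> \<in> space T" and u: "strict_prefix u v"
  shows "birth_time \<xi> Y u \<omega> + \<xi> (Y u \<omega>) \<le> birth_time \<xi> Y v \<omega>"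
proof -
  from u obtain w where w: "v = u @ w" "w \<noteq> []" by (auto elim!: strict_prefixE')
  have "birth_time \<xi> Y u \<omega> + \<xi> (Y u \<omega>) = (\<Sum>i<Suc (length u). \<xi> (Y (take i v) \<omega>))"
    unfolding birth_time_def by (simp add: w)
  also have "\<dots> \<le> birth_time \<xi> Y v \<omega>"
    unfolding birth_time_def
  proof (rule sum_mono2)
    show "{..<Suc (length u)} \<subseteq> {..<length v}" using w by (cases w) auto
    fix i
    have "take i v \<in> labels" using v by (auto simp: labels_def lists_eq_set dest: in_set_takeD)
    then show "0 \<le> \<xi> (Y (take i v) \<omega>)" using \<omega> by (rule Y_\<xi>_nonneg)
  qed simp
  finally show ?thesis .
qed

abbreviation "N s \<omega> \<equiv> alive_at \<xi> \<kappa> Y s \<omega>"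
abbreviation "I s v \<omega> \<equiv> indicator (N s \<omega>) v :: ennreal"

text \<open>An ancestor dies no later than its descendant is born, and the instant of death does not
  belong to life.\<close>

lemma alive_strict_prefix:
  assumes "s \<le> t" "\<omega> \<in> space T" "strict_prefix v' v" "v \<in> N s \<omega>" "v' \<in> N t \<omega>"
  shows False
  using death_le_birth[OF alive_at_labels[OF assms(4)] assms(2,3)] assms(1,4,5) by (auto simp: alive_at_def)

lemma measurable_I [measurable]: "(\<lambda>\<omega>. I s v \<omega>) \<in> borel_measurable T"
proof -
  have "(\<lambda>\<omega>. I s v \<omega>) \<in> borel_measurable T \<longleftrightarrow> (\<lambda>\<omega>. indicator {\<omega> \<in> space T. v \<in> N s \<omega>} \<omega> :: ennreal) \<in> borel_measurable T"
    by (rule measurable_cong) (auto simp: indicator_def)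
  then show ?thesis using measurable_alive_at[of v s] by simp
qed

lemma pop_eq: "pop \<xi> \<kappa> Y s \<omega> = (\<integral>\<^sup>+v. I s v \<omega> \<partial>count_space UNIV)"
  by (simp add: pop_def)

lemma nn_integral_I: "(\<integral>\<^sup>+\<omega>. I s v \<omega> \<partial>T) = emeasure T {\<omega> \<in> space T. v \<in> N s \<omega>}"
proof -
  have "(\<integral>\<^sup>+\<omega>. I s v \<omega> \<partial>T) = (\<integral>\<^sup>+\<omega>. indicator {\<omega> \<in> space T. v \<in> N s \<omega>} \<omega> \<partial>T)"
    by (intro nn_integral_cong) (auto simp: indicator_def)
  then show ?thesis using measurable_alive_at[of v s] by simp
qed

text \<open>As \<open>h\<close> starts from a child, the initial cell is counted apart, for at most
  1; the factor \<open>k1\<close> is its mean number of children.\<close>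

lemma pop_mean_le:
  "(\<integral>\<^sup>+\<omega>. pop \<xi> \<kappa> Y s \<omega> \<partial>T) \<le> 1 + ennreal k1 * (\<integral>\<^sup>+\<omega>. h (X 0 \<omega>) (s - S 0 \<omega>) \<partial>P)"
proof -
  let ?p = "\<lambda>n. emeasure P {\<omega> \<in> space P. alive s n (\<lambda>n. \<xi> (x \<omega> n))}"
  have "(\<integral>\<^sup>+\<omega>. pop \<xi> \<kappa> Y s \<omega> \<partial>T) = (\<integral>\<^sup>+v. (\<integral>\<^sup>+\<omega>. I s v \<omega> \<partial>T) \<partial>count_space UNIV)"
    unfolding pop_eq by (rule nn_integral_count_space_nn_integral) auto
  also have "\<dots> = (\<integral>\<^sup>+v. prod_list (map g v) * ?p (length v) \<partial>count_space UNIV)"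
    by (simp add: nn_integral_I emeasure_alive_at)
  also have "\<dots> = (\<Sum>n. ennreal k1 ^ n * ?p n)" unfolding nn_integral_lists[where h = ?p] sum_g ..
  also have "\<dots> = (\<Sum>n. ennreal k1 ^ Suc n * ?p (Suc n)) + ennreal k1 ^ 0 * ?p 0"
    by (subst suminf_offset[of _ 1]) (simp_all add: add.commute)
  also have "\<dots> = ennreal k1 * (\<Sum>n. ennreal k1 ^ n * ?p (Suc n)) + ?p 0"
    by (simp add: mult.assoc)
  also have "(\<Sum>n. ennreal k1 ^ n * ?p (Suc n)) = (\<integral>\<^sup>+\<omega>. h (X 0 \<omega>) (s - S 0 \<omega>) \<partial>P)"
    unfolding emeasure_alive_eq h_def by (subst nn_integral_suminf) (simp_all add: nn_integral_cmult)
  finally show ?thesis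
    using P.emeasure_le_1 by (metis (no_types, lifting) add.commute add_left_mono)
qed

text \<open>The product form of \<open>emeasure_alive_pair\<close> lets the sums over letters and
  tails be carried out, so that only the generation of branching remains.\<close>

lemma parallel_pairs:
  "(\<integral>\<^sup>+\<omega>. (\<integral>\<^sup>+v. \<integral>\<^sup>+v'. I s v \<omega> * I t v' \<omega> * indicator {(v, v'). v \<parallel> v'} (v, v') \<partial>count_space UNIV \<partial>count_space UNIV) \<partial>T)
    = (\<Sum>k. ennreal k1 ^ k * (ennreal k2 * (\<integral>\<^sup>+\<omega>. h (X k \<omega>) (s - S k \<omega>) * h (X k \<omega>) (t - S k \<omega>) \<partial>P)))"
proof -
  let ?f = "\<lambda>v v'. \<integral>\<^sup>+\<omega>. I s v \<omega> * I t v' \<omega> \<partial>T"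
  have meas: "(\<lambda>\<omega>. I s v \<omega> * I t v' \<omega> * indicator {(v, v'). v \<parallel> v'} (v, v')) \<in> borel_measurable T" for v v' by measurable
  have "(\<integral>\<^sup>+\<omega>. (\<integral>\<^sup>+v. \<integral>\<^sup>+v'. I s v \<omega> * I t v' \<omega> * indicator {(v, v'). v \<parallel> v'} (v, v') \<partial>count_space UNIV \<partial>count_space UNIV) \<partial>T)
    = (\<integral>\<^sup>+\<omega>. (\<integral>\<^sup>+z. (case z of (v, v') \<Rightarrow> I s v \<omega> * I t v' \<omega> * indicator {(v, v'). v \<parallel> v'} (v, v')) \<partial>count_space UNIV) \<partial>T)"
    by (subst nn_integral_fst_count_space[symmetric]) simp
  also have "\<dots> = (\<integral>\<^sup>+z. (\<integral>\<^sup>+\<omega>. (case z of (v, v') \<Rightarrow> I s v \<omega> * I t v' \<omega> * indicator {(v, v'). v \<parallel> v'} (v, v')) \<partial>T) \<partial>count_space UNIV)"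
    by (rule nn_integral_count_space_nn_integral) (auto simp: split_beta')
  also have "\<dots> = (\<integral>\<^sup>+z. (case z of (v, v') \<Rightarrow> ?f v v' * indicator {(v, v'). v \<parallel> v'} (v, v')) \<partial>count_space UNIV)"
    by (intro nn_integral_cong) (auto simp: nn_integral_multc split: prod.split)
  also have "\<dots> = (\<integral>\<^sup>+v. \<integral>\<^sup>+v'. ?f v v' * indicator {(v, v'). v \<parallel> v'} (v, v') \<partial>count_space UNIV \<partial>count_space UNIV)"
    by (subst nn_integral_fst_count_space[symmetric]) simp
  also have "\<dots> = (\<Sum>k. (\<integral>\<^sup>+j. g j \<partial>count_space UNIV) ^ k *
       ((\<integral>\<^sup>+i. \<integral>\<^sup>+j. g2 i j * indicator {(i, j). i \<noteq> j} (i, j) \<partial>count_space UNIV \<partial>count_space UNIV) *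
        (\<Sum>a. (\<integral>\<^sup>+j. g j \<partial>count_space UNIV) ^ a * (\<Sum>b. (\<integral>\<^sup>+j. g j \<partial>count_space UNIV) ^ b * D s t k a b))))"
  proof (rule nn_integral_parallel_weights)
    fix u p q :: "nat list" and i j :: nat assume ij: "i \<noteq> j"
    have "?f (u @ i # p) (u @ j # q) = emeasure T {\<omega> \<in> space T. u @ i # p \<in> N s \<omega> \<and> u @ j # q \<in> N t \<omega>}"
    proof -
      have "{\<omega> \<in> space T. u @ i # p \<in> N s \<omega> \<and> u @ j # q \<in> N t \<omega>} = {\<omega> \<in> space T. u @ i # p \<in> N s \<omega>} \<inter> {\<omega> \<in> space T. u @ j # q \<in> N t \<omega>}" by auto
      then have "{\<omega> \<in> space T. u @ i # p \<in> N s \<omega> \<and> u @ j # q \<in> N t \<omega>} \<in> sets T"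
        using measurable_alive_at by auto
      from nn_integral_indicator[OF this] show ?thesis
        by (subst (asm) eq_commute) (auto intro!: nn_integral_cong simp: indicator_def)
    qed
    then show "?f (u @ i # p) (u @ j # q) = prod_list (map g u) * g2 i j * prod_list (map g p) * prod_list (map g q) * D s t (length u) (length p) (length q)"
      using emeasure_alive_pair[OF ij] by simp
  qed
  finally show ?thesis by (simp only: sum_g sum_g2 sum_D)
qed

text \<open>
  A cell alive at time \<open>t\<close> has exactly one ancestor, or itself, alive at an earlier time \<open>s\<close>; hence
  comparable pairs contribute at most the mean population size at time \<open>t\<close>.
\<close>

lemma pop_moment_bounds:
  fixes t \<tau> :: real
  assumes \<tau>: "0 \<le> \<tau>"
  defines "M \<equiv> (\<Sum>k. ennreal k1 ^ k * (ennreal k2 * (\<integral>\<^sup>+\<omega>. h (X k \<omega>) (t - S k \<omega>) * h (X k \<omega>) (t + \<tau> - S k \<omega>) \<partial>P)))"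
  shows "M \<le> pop_moment \<xi> \<kappa> T Y t \<tau>"
    and "pop_moment \<xi> \<kappa> T Y t \<tau> \<le> M + (1 + ennreal k1 * (\<integral>\<^sup>+\<omega>. h (X 0 \<omega>) (t + \<tau> - S 0 \<omega>) \<partial>P))"
proof -
  let ?t = "t + \<tau>"
  let ?C = "\<lambda>\<omega> J. \<integral>\<^sup>+v. \<integral>\<^sup>+v'. I t v \<omega> * I ?t v' \<omega> * indicator J (v, v') \<partial>count_space UNIV \<partial>count_space UNIV"
  let ?par = "{(v, v'). v \<parallel> v'} :: (nat list \<times> nat list) set" and ?pre = "{(v, v'). prefix v v'} :: (nat list \<times> nat list) set"
  have meas: "(\<lambda>\<omega>. ?C \<omega> J) \<in> borel_measurable T" for J
  proof -
    show ?thesis by (intro borel_measurable_nn_integral_count_space infinite_UNIV_listI) measurable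
  qed
  have split: "pop \<xi> \<kappa> Y t \<omega> * pop \<xi> \<kappa> Y ?t \<omega> = ?C \<omega> ?par + ?C \<omega> ?pre" if \<omega>: "\<omega> \<in> space T" for \<omega>
  proof -
    have "pop \<xi> \<kappa> Y t \<omega> * pop \<xi> \<kappa> Y ?t \<omega> = (\<integral>\<^sup>+v. \<integral>\<^sup>+v'. I t v \<omega> * I ?t v' \<omega> \<partial>count_space UNIV \<partial>count_space UNIV)"
      unfolding pop_eq by (subst nn_integral_multc[symmetric]) (simp_all add: nn_integral_cmult)
    also have "\<dots> = (\<integral>\<^sup>+v. (\<integral>\<^sup>+v'. I t v \<omega> * I ?t v' \<omega> * indicator ?par (v, v') + I t v \<omega> * I ?t v' \<omega> * indicator ?pre (v, v') \<partial>count_space UNIV) \<partial>count_space UNIV)"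
    proof (intro nn_integral_cong)
      fix v v' :: "nat list"
      \<comment> \<open>The third possibility, \<open>v'\<close> a strict prefix of
        \<open>v\<close>, is excluded: \<open>v\<close> lives at the earlier of the two
        times.\<close>
      show "I t v \<omega> * I ?t v' \<omega> = I t v \<omega> * I ?t v' \<omega> * indicator ?par (v, v') + I t v \<omega> * I ?t v' \<omega> * indicator ?pre (v, v')"
        by (rule prefix_cases[of v v'])
           (use alive_strict_prefix[OF _ \<omega>, of t ?t v' v] \<tau> in \<open>auto simp: parallel_def indicator_def\<close>)
    qed
    also have "\<dots> = ?C \<omega> ?par + ?C \<omega> ?pre" by (simp add: nn_integral_add)
    finally show ?thesis .
  qed
  have "pop_moment \<xi> \<kappa> T Y t \<tau> = (\<integral>\<^sup>+\<omega>. ?C \<omega> ?par + ?C \<omega> ?pre \<partial>T)"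
    unfolding pop_moment_def by (intro nn_integral_cong split)
  also have "\<dots> = (\<integral>\<^sup>+\<omega>. ?C \<omega> ?par \<partial>T) + (\<integral>\<^sup>+\<omega>. ?C \<omega> ?pre \<partial>T)"
    by (rule nn_integral_add) (rule meas)+
  also have "(\<integral>\<^sup>+\<omega>. ?C \<omega> ?par \<partial>T) = M" unfolding M_def by (rule parallel_pairs)
  finally have eq: "pop_moment \<xi> \<kappa> T Y t \<tau> = M + (\<integral>\<^sup>+\<omega>. ?C \<omega> ?pre \<partial>T)" .
  then show "M \<le> pop_moment \<xi> \<kappa> T Y t \<tau>" by simp
  have "(\<integral>\<^sup>+\<omega>. ?C \<omega> ?pre \<partial>T) \<le> (\<integral>\<^sup>+\<omega>. pop \<xi> \<kappa> Y ?t \<omega> \<partial>T)"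
  proof (rule nn_integral_mono)
    fix \<omega> assume \<omega>: "\<omega> \<in> space T"
    have one: "(\<integral>\<^sup>+v. I t v \<omega> * indicator ?pre (v, v') \<partial>count_space UNIV) \<le> 1" for v'
    proof -
      let ?A = "{v. v \<in> N t \<omega> \<and> prefix v v'}"
      \<comment> \<open>Two prefixes of one list are comparable, and distinct comparable cells are
        never alive together.\<close>
      have "v = w" if "v \<in> ?A" "w \<in> ?A" for v w
        using that prefix_same_cases[of v v' w] alive_strict_prefix[OF order_refl \<omega>, of v w t] alive_strict_prefix[OF order_refl \<omega>, of w v t]
        by (auto simp: strict_prefix_def)
      then obtain w where "?A \<subseteq> {w}" by blast
      have "(\<integral>\<^sup>+v. I t v \<omega> * indicator ?pre (v, v') \<partial>count_space UNIV) = (\<integral>\<^sup>+v. indicator ?A v \<partial>count_space UNIV)"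
        by (intro nn_integral_cong) (simp add: indicator_def)
      also have "\<dots> \<le> (\<integral>\<^sup>+v. indicator {w} v \<partial>count_space UNIV)"
        using \<open>?A \<subseteq> {w}\<close> by (intro nn_integral_mono) (auto simp: indicator_def)
      finally show ?thesis by simp
    qed
    have "?C \<omega> ?pre = (\<integral>\<^sup>+v'. \<integral>\<^sup>+v. I t v \<omega> * I ?t v' \<omega> * indicator ?pre (v, v') \<partial>count_space UNIV \<partial>count_space UNIV)"
      using nn_integral_fst_count_space[of "\<lambda>(v, v'). I t v \<omega> * I ?t v' \<omega> * indicator ?pre (v, v')"]
        nn_integral_snd_count_space[of "\<lambda>(v, v'). I t v \<omega> * I ?t v' \<omega> * indicator ?pre (v, v')"] by simp
    also have "\<dots> = (\<integral>\<^sup>+v'. I ?t v' \<omega> * (\<integral>\<^sup>+v. I t v \<omega> * indicator ?pre (v, v') \<partial>count_space UNIV) \<partial>count_space UNIV)"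
      by (subst nn_integral_cmult[symmetric]) (simp_all add: mult_ac)
    also have "\<dots> \<le> (\<integral>\<^sup>+v'. I ?t v' \<omega> * 1 \<partial>count_space UNIV)"
      by (intro nn_integral_mono mult_left_mono one) simp
    finally show "?C \<omega> ?pre \<le> pop \<xi> \<kappa> Y ?t \<omega>" by (simp add: pop_eq)
  qed
  also have "\<dots> \<le> 1 + ennreal k1 * (\<integral>\<^sup>+\<omega>. h (X 0 \<omega>) (?t - S 0 \<omega>) \<partial>P)" by (rule pop_mean_le)
  finally show "pop_moment \<xi> \<kappa> T Y t \<tau> \<le> M + (1 + ennreal k1 * (\<integral>\<^sup>+\<omega>. h (X 0 \<omega>) (?t - S 0 \<omega>) \<partial>P))"
    unfolding eq by (rule add_left_mono)
qed

end

section \<open>Asymptotics of the moments\<close>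

lemma integrable_exp_Ici:
  assumes "0 < (a::real)"
  shows "integrable lborel (\<lambda>t. indicator {0..} t * exp (- a * t) :: real)"
proof (rule integrableI_nonneg)
  interpret prob_space "density lborel (exponential_density a)"
    by (rule prob_space_exponential_density[OF assms])
  have "(\<integral>\<^sup>+ t. ennreal (exponential_density a t) \<partial>lborel) = 1"
    using emeasure_space_1 by (simp add: emeasure_density)
  moreover have "(\<integral>\<^sup>+ t. ennreal (exponential_density a t) \<partial>lborel) = (\<integral>\<^sup>+ t. ennreal a * ennreal (indicator {0..} t * exp (- a * t)) \<partial>lborel)"
    using assms by (intro nn_integral_cong) (auto simp: exponential_density_def indicator_def ennreal_mult'[symmetric] mult.commute)
  ultimately have "ennreal a * (\<integral>\<^sup>+ t. ennreal (indicator {0..} t * exp (- a * t)) \<partial>lborel) = 1"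
    by (simp add: nn_integral_cmult)
  then show "(\<integral>\<^sup>+ t. ennreal (indicator {0..} t * exp (- a * t)) \<partial>lborel) < \<infinity>"
    using assms by (auto simp: ennreal_mult_eq_top_iff top.not_eq_extremum[symmetric])
qed auto

section \<open>Exponential growth of the mean progeny\<close>

locale analytic_branching = branching E \<xi> \<kappa> P X X' Q T Y
  for E :: "'x measure" and \<xi> \<kappa> and P :: "'p measure" and X X' Q and T :: "'t measure" and Y +
  fixes \<Phi> :: "'x \<Rightarrow> complex \<Rightarrow> complex" and \<nu> \<delta> \<epsilon> :: real
  assumes nu: "\<nu> = real_of_ereal (malthus \<xi> \<kappa> P X)"
    and analytic: "analyticity E \<xi> (kappa1 \<kappa> P X) \<nu> Q \<Phi> \<delta> \<epsilon>"
begin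

lemma \<delta>: "0 < \<delta>" "\<delta> < \<nu>" "0 < \<epsilon>" and \<nu>_pos: "0 < \<nu>"
  using analytic by (auto simp: analyticity_def)

abbreviation "f c \<equiv> f0 \<xi> k1 \<nu> Q c"

definition q :: "'x \<Rightarrow> real \<Rightarrow> nat \<Rightarrow> real" where
  "q c t n = measure (Q c) {w \<in> space (Q c). life_sum \<xi> w (Suc n) - life_sum \<xi> w 0 \<le> t}"

text \<open>\<open>f0\<close> freed of its exponential factor; it is nondecreasing in
  \<open>t\<close>, as pointwise inversion requires.\<close>

definition G :: "'x \<Rightarrow> real \<Rightarrow> real" where
  "G c t = (k1 - 1) * (\<Sum>n. k1 ^ n * q c t n)"

lemma f_eq: "f c t = exp (- \<nu> * t) * G c t"
  by (simp add: f0_def G_def q_def)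

lemma life_sum_diff: "life_sum \<xi> w (Suc n) - life_sum \<xi> w 0 = (\<Sum>i<Suc n. \<xi> (w (Suc i)))"
  unfolding life_sum_def by (simp add: sum.atMost_Suc_shift lessThan_Suc_atMost del: sum.atMost_Suc)

lemma measurable_life_sum [measurable]: "(\<lambda>w. life_sum \<xi> w n) \<in> borel_measurable (path_space E)"
  unfolding life_sum_def by measurable

lemma path_space_apply: "w \<in> space (path_space E) \<Longrightarrow> w n \<in> space E"
  by (auto simp: space_PiM)

lemma life_sum_nonneg: "w \<in> space (path_space E) \<Longrightarrow> 0 \<le> life_sum \<xi> w n"
  unfolding life_sum_def by (intro sum_nonneg \<xi>_nonneg path_space_apply)

text \<open>The infimum provides convergence at some exponent below \<open>\<gamma>\<close>; life
  sums being nonnegative, the terms decrease in the exponent, which carries convergence to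
  \<open>\<gamma>\<close>.\<close>

lemma laplace_sum_finite:
  assumes c: "c \<in> space E" and \<gamma>: "\<nu> < \<gamma>"
  shows "summable (\<lambda>n. k1 ^ n * (\<integral>w. exp (- \<gamma> * life_sum \<xi> w (Suc n)) \<partial>Q c))"
    and "integrable (Q c) (\<lambda>w. exp (- \<gamma> * life_sum \<xi> w (Suc n)))"
proof -
  interpret Q: prob_space "Q c" by (rule Q_space(1)[OF c])
  note [measurable_cong] = Q_space(2)[OF c]
  have int: "integrable (Q c) (\<lambda>w. exp (- \<gamma> * life_sum \<xi> w n))" for n
    using \<gamma> \<nu>_pos life_sum_nonneg
    by (intro Q.integrable_const_bound[of _ 1] AE_I2) (auto simp: Q_space(3)[OF c])
  show "integrable (Q c) (\<lambda>w. exp (- \<gamma> * life_sum \<xi> w (Suc n)))" by (rule int)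
  have m: "malthus \<xi> \<kappa> P X = malthus_given \<xi> k1 Q c" "malthus \<xi> \<kappa> P X < \<infinity>"
    using markov c by (auto simp: markov_independence_def)
  \<comment> \<open>\<open>real_of_ereal\<close> sends infinite values to 0, so finiteness is
    checked on both sides before \<open>\<nu>\<close> is identified with the infimum.\<close>
  have "0 \<le> malthus \<xi> \<kappa> P X" unfolding malthus_def by (intro INF_greatest) auto
  then have "malthus \<xi> \<kappa> P X = ereal \<nu>" using m(2) nu by (cases "malthus \<xi> \<kappa> P X") simp_all
  then have "malthus_given \<xi> k1 Q c = ereal \<nu>" using m(1) by simp
  then have "malthus_given \<xi> k1 Q c < ereal \<gamma>" using \<gamma> by simp
  then obtain \<gamma>' where \<gamma>': "\<gamma>' < \<gamma>" "0 < \<gamma>'"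
     "(\<Sum>n. ennreal (k1 ^ n) * (\<integral>\<^sup>+ w. ennreal (exp (- \<gamma>' * life_sum \<xi> w (Suc n))) \<partial>Q c)) < \<infinity>"
    unfolding malthus_given_def by (auto simp: INF_less_iff)
  have "(\<Sum>n. ennreal (k1 ^ n * (\<integral>w. exp (- \<gamma> * life_sum \<xi> w (Suc n)) \<partial>Q c)))
    = (\<Sum>n. ennreal (k1 ^ n) * (\<integral>\<^sup>+ w. ennreal (exp (- \<gamma> * life_sum \<xi> w (Suc n))) \<partial>Q c))"
    using k1_ge_2 by (subst nn_integral_eq_integral[OF int]) (auto simp: ennreal_mult)
  also have "\<dots> \<le> (\<Sum>n. ennreal (k1 ^ n) * (\<integral>\<^sup>+ w. ennreal (exp (- \<gamma>' * life_sum \<xi> w (Suc n))) \<partial>Q c))"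
    using \<gamma>' life_sum_nonneg
    by (intro suminf_le mult_left_mono nn_integral_mono ennreal_leI) (auto simp: Q_space(3)[OF c] mult_right_mono)
  finally show "summable (\<lambda>n. k1 ^ n * (\<integral>w. exp (- \<gamma> * life_sum \<xi> w (Suc n)) \<partial>Q c))"
    using \<gamma>'(3) k1_ge_2 by (intro summable_suminf_not_top) (auto simp: top.not_eq_extremum)
qed

text \<open>Exponential Markov inequality. Under \<open>Q c\<close> the state of generation 0 is
  \<open>c\<close> almost surely, so its lifetime enters as the constant
  \<open>\<xi> c\<close>.\<close>

lemma q_bound:
  assumes c: "c \<in> space E" and \<gamma>: "\<nu> < \<gamma>"
  shows "q c t n \<le> exp (\<gamma> * (t + \<xi> c)) * (\<integral>w. exp (- \<gamma> * life_sum \<xi> w (Suc n)) \<partial>Q c)"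
proof -
  interpret Q: prob_space "Q c" by (rule Q_space(1)[OF c])
  note [measurable_cong] = Q_space(2)[OF c]
  have w0: "AE w in Q c. w 0 = c"
    using markov c by (auto simp: markov_independence_def stationary_markov_def)
  have "q c t n = (\<integral>w. indicator {w \<in> space (Q c). life_sum \<xi> w (Suc n) - life_sum \<xi> w 0 \<le> t} w \<partial>Q c)"
    unfolding q_def by simp
  also have "\<dots> \<le> (\<integral>w. exp (\<gamma> * (t + \<xi> c)) * exp (- \<gamma> * life_sum \<xi> w (Suc n)) \<partial>Q c)"
  proof (rule integral_mono_AE)
    show "AE w in Q c. indicator {w \<in> space (Q c). life_sum \<xi> w (Suc n) - life_sum \<xi> w 0 \<le> t} w
        \<le> exp (\<gamma> * (t + \<xi> c)) * exp (- \<gamma> * life_sum \<xi> w (Suc n))"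
      using w0
    proof eventually_elim
      case (elim w)
      have "0 \<le> \<gamma> * (t + \<xi> c) + - \<gamma> * life_sum \<xi> w (Suc n)" if "life_sum \<xi> w (Suc n) - life_sum \<xi> w 0 \<le> t"
      proof -
        have "0 \<le> t + \<xi> c - life_sum \<xi> w (Suc n)" using that elim by (simp add: life_sum_def)
        then have "0 \<le> \<gamma> * (t + \<xi> c - life_sum \<xi> w (Suc n))" using \<gamma> \<nu>_pos by simp
        then show ?thesis by (simp add: algebra_simps)
      qed
      then show ?case by (simp add: indicator_def exp_add[symmetric])
    qed
    show "integrable (Q c) (\<lambda>w. exp (\<gamma> * (t + \<xi> c)) * exp (- \<gamma> * life_sum \<xi> w (Suc n)))"
      using laplace_sum_finite(2)[OF c \<gamma>] by simp
    show "integrable (Q c) (indicat_real {w \<in> space (Q c). life_sum \<xi> w (Suc n) - life_sum \<xi> w 0 \<le> t})"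
      by (rule Q.integrable_const_bound[of _ 1]) (simp, measurable)
  qed
  finally show ?thesis by simp
qed

lemma q_nonneg: "0 \<le> q c t n" by (simp add: q_def)

lemma q_summable:
  assumes c: "c \<in> space E"
  shows "summable (\<lambda>n. k1 ^ n * q c t n)"
proof (rule summable_comparison_test')
  let ?\<gamma> = "\<nu> + 1"
  show "summable (\<lambda>n. exp (?\<gamma> * (t + \<xi> c)) * (k1 ^ n * (\<integral>w. exp (- ?\<gamma> * life_sum \<xi> w (Suc n)) \<partial>Q c)))"
    by (intro summable_mult laplace_sum_finite(1)[OF c]) simp
  fix n
  have "k1 ^ n * q c t n \<le> k1 ^ n * (exp (?\<gamma> * (t + \<xi> c)) * (\<integral>w. exp (- ?\<gamma> * life_sum \<xi> w (Suc n)) \<partial>Q c))"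
    using k1_ge_2 by (intro mult_left_mono q_bound[OF c]) auto
  then show "norm (k1 ^ n * q c t n) \<le> exp (?\<gamma> * (t + \<xi> c)) * (k1 ^ n * (\<integral>w. exp (- ?\<gamma> * life_sum \<xi> w (Suc n)) \<partial>Q c))"
    using k1_ge_2 q_nonneg[of c t n] by (simp add: mult_ac)
qed

lemma G_nonneg: "c \<in> space E \<Longrightarrow> 0 \<le> G c t"
  unfolding G_def using k1_ge_2 q_nonneg by (intro mult_nonneg_nonneg suminf_nonneg q_summable) auto

lemma G_mono:
  assumes c: "c \<in> space E" shows "mono (G c)"
proof (rule monoI)
  fix s t :: real assume st: "s \<le> t"
  interpret Q: prob_space "Q c" by (rule Q_space(1)[OF c])
  note [measurable_cong] = Q_space(2)[OF c]
  have "q c s n \<le> q c t n" for n unfolding q_def using st by (intro Q.finite_measure_mono) auto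
  then show "G c s \<le> G c t" unfolding G_def using k1_ge_2
    by (intro mult_left_mono suminf_le q_summable[OF c]) auto
qed

lemma G_neg:
  assumes c: "c \<in> space E" and t: "t < 0" shows "G c t = 0"
proof -
  have "q c t n = 0" for n
  proof -
    have empty: "{w \<in> space (Q c). life_sum \<xi> w (Suc n) - life_sum \<xi> w 0 \<le> t} = {}"
    proof (rule ccontr)
      assume "{w \<in> space (Q c). life_sum \<xi> w (Suc n) - life_sum \<xi> w 0 \<le> t} \<noteq> {}"
      then obtain w where w: "w \<in> space (path_space E)" "(\<Sum>i<Suc n. \<xi> (w (Suc i))) \<le> t"
        by (auto simp: Q_space(3)[OF c] life_sum_diff)
      have "0 \<le> (\<Sum>i<Suc n. \<xi> (w (Suc i)))" using w(1) by (intro sum_nonneg \<xi>_nonneg) (auto simp: space_PiM)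
      then show False using w t by linarith
    qed
    show ?thesis unfolding q_def empty by simp
  qed
  then show ?thesis by (simp add: G_def)
qed

lemma f_integrable:
  assumes c: "c \<in> space E" and \<gamma>: "0 < \<gamma>"
  shows "integrable lborel (\<lambda>t. exp (- \<gamma> * t) * f c t)"
proof -
  \<comment> \<open>An intermediate exponent: \<open>G\<close> grows at most like
    \<open>exp (b * t)\<close>, and the factors \<open>exp (- \<gamma> * t)\<close> and
    \<open>exp (- \<nu> * t)\<close> then leave the decay
    \<open>exp (- (\<gamma> / 2) * t)\<close>.\<close>
  define b where "b = \<nu> + \<gamma> / 2"
  have b: "\<nu> < b" using \<gamma> by (simp add: b_def)
  define A where "A = (k1 - 1) * (exp (b * \<xi> c) * (\<Sum>n. k1 ^ n * (\<integral>w. exp (- b * life_sum \<xi> w (Suc n)) \<partial>Q c)))"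
  have [measurable]: "G c \<in> borel_measurable borel" by (rule borel_measurable_mono[OF G_mono[OF c]])
  have G_le: "G c t \<le> A * exp (b * t)" for t
  proof -
    have "(\<Sum>n. k1 ^ n * q c t n) \<le> (\<Sum>n. exp (b * (t + \<xi> c)) * (k1 ^ n * (\<integral>w. exp (- b * life_sum \<xi> w (Suc n)) \<partial>Q c)))"
    proof (intro suminf_le q_summable[OF c] summable_mult laplace_sum_finite(1)[OF c b])
      fix n
      have "k1 ^ n * q c t n \<le> k1 ^ n * (exp (b * (t + \<xi> c)) * (\<integral>w. exp (- b * life_sum \<xi> w (Suc n)) \<partial>Q c))"
        using k1_ge_2 by (intro mult_left_mono q_bound[OF c b]) auto
      then show "k1 ^ n * q c t n \<le> exp (b * (t + \<xi> c)) * (k1 ^ n * (\<integral>w. exp (- b * life_sum \<xi> w (Suc n)) \<partial>Q c))"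
        by (simp add: mult_ac)
    qed
    also have "\<dots> = exp (b * (t + \<xi> c)) * (\<Sum>n. k1 ^ n * (\<integral>w. exp (- b * life_sum \<xi> w (Suc n)) \<partial>Q c))"
      by (intro suminf_mult laplace_sum_finite(1)[OF c b])
    finally have "G c t \<le> (k1 - 1) * (exp (b * (t + \<xi> c)) * (\<Sum>n. k1 ^ n * (\<integral>w. exp (- b * life_sum \<xi> w (Suc n)) \<partial>Q c)))"
      unfolding G_def using k1_ge_2 by (intro mult_left_mono) auto
    also have "\<dots> = A * exp (b * t)" by (simp add: A_def distrib_left exp_add)
    finally show ?thesis .
  qed
  show ?thesis
  proof (rule Bochner_Integration.integrable_bound)
    show "integrable lborel (\<lambda>t. A * (indicator {0..} t * exp (- (\<gamma> / 2) * t)))"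
      using \<gamma> by (intro integrable_mult_right integrable_exp_Ici) simp
    show "AE t in lborel. norm (exp (- \<gamma> * t) * f c t) \<le> norm (A * (indicator {0..} t * exp (- (\<gamma> / 2) * t)))"
    proof (rule AE_I2)
      fix t :: real
      show "norm (exp (- \<gamma> * t) * f c t) \<le> norm (A * (indicator {0..} t * exp (- (\<gamma> / 2) * t)))"
      proof (cases "t < 0")
        case False
        have "exp (- \<gamma> * t) * f c t \<le> exp (- \<gamma> * t) * (exp (- \<nu> * t) * (A * exp (b * t)))"
          unfolding f_eq by (intro mult_left_mono G_le) auto
        also have "\<dots> = A * (exp (- \<gamma> * t) * exp (- \<nu> * t) * exp (b * t))" by simp
        also have "exp (- \<gamma> * t) * exp (- \<nu> * t) * exp (b * t) = exp (- (\<gamma> / 2) * t)"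
          unfolding exp_add[symmetric] by (simp add: b_def algebra_simps)
        finally have "exp (- \<gamma> * t) * f c t \<le> A * exp (- (\<gamma> / 2) * t)" .
        moreover have "0 \<le> exp (- \<gamma> * t) * f c t" using G_nonneg[OF c] by (simp add: f_eq)
        ultimately show ?thesis using False by (simp add: indicator_def)
      qed (simp add: f_eq G_neg[OF c])
    qed
  qed (simp add: f_eq[abs_def])
qed

lemma f_asymptotics:
  assumes c: "c \<in> space E"
  shows "\<bar>f c s - C0 \<Phi> c\<bar> \<le> exp (- \<delta> * s) * enn2real (Psi0 \<Phi> \<delta> c)" and "0 < C0 \<Phi> c" and "Psi0 \<Phi> \<delta> c < \<infinity>"
proof -
  have an: "(\<forall>\<gamma>>0. \<Phi> c (complex_of_real \<gamma>) = complex_of_real (laplace_f0 \<xi> k1 \<nu> Q c \<gamma>))"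
        "\<Phi> c analytic_on ({z. \<bar>Re z\<bar> < \<delta> + \<epsilon>} - {0})"
        "is_pole (\<Phi> c) 0" "zorder (\<Phi> c) 0 = -1"
        "(\<integral>\<^sup>+ y. ennreal (cmod (\<Phi> c (Complex \<delta> y))) \<partial>lborel) < \<infinity>"
        "uniform_limit {-\<delta>..\<delta>} (\<lambda>y u. \<Phi> c (Complex u y)) (\<lambda>_. 0) at_top"
        "uniform_limit {-\<delta>..\<delta>} (\<lambda>y u. \<Phi> c (Complex u y)) (\<lambda>_. 0) at_bot"
        "Psi0 \<Phi> \<delta> c < \<infinity>"
    using analytic c unfolding analyticity_def by blast+
  have lap: "\<Phi> c (of_real \<gamma>) = of_real (\<integral>t. exp (- \<gamma> * t) * f c t \<partial>lborel)" if "0 < \<gamma>" for \<gamma>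
  proof -
    have "laplace_f0 \<xi> k1 \<nu> Q c \<gamma> = (\<integral>t. exp (- \<gamma> * t) * f c t \<partial>lborel)"
      unfolding laplace_f0_def set_lebesgue_integral_def
      by (intro Bochner_Integration.integral_cong) (auto simp: f_eq indicator_def G_neg[OF c])
    then show ?thesis using an(1) that by simp
  qed
  note main = laplace_asymptotics[OF G_mono[OF c] G_nonneg[OF c] G_neg[OF c] \<nu>_pos
      f_integrable[OF c, unfolded f_eq] lap[unfolded f_eq] analytic_imp_holomorphic[OF an(2)] \<delta>(1,3) an(3-5)
      an(8)[unfolded Psi0_def] an(6,7)]
  show "\<bar>f c s - C0 \<Phi> c\<bar> \<le> exp (- \<delta> * s) * enn2real (Psi0 \<Phi> \<delta> c)"
    using main(1) by (simp add: C0_def Psi0_def f_eq)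
  show "0 < C0 \<Phi> c" using main(2) by (simp add: C0_def)
  show "Psi0 \<Phi> \<delta> c < \<infinity>" by (rule an(8))
qed

text \<open>Generation \<open>a\<close> contributes \<open>p a - p (Suc a)\<close>, the probability
  that its birth but not its death has occurred by time \<open>s\<close>. Summation by parts against
  \<open>k1 ^ a\<close> gives \<open>p 0\<close> plus \<open>k1 - 1\<close> times the sum of
  \<open>k1 ^ a * p (Suc a)\<close>, which is \<open>p 0 + G c s\<close>.\<close>

lemma h_eq:
  assumes c: "c \<in> space E"
  shows "h c s = ennreal ((if 0 \<le> s then 1 else 0) + exp (\<nu> * s) * f c s)"
proof -
  interpret K: prob_space "K c" by (rule K_space(1)[OF c])
  interpret Q: prob_space "Q c" by (rule Q_space(1)[OF c])
  note [measurable_cong] = K_space(2) Q_space(2)[OF c]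
  define p where "p a = measure (K c) {z \<in> space (K c). (\<Sum>i<a. \<xi> (z i)) \<le> s}" for a
  have sub: "{z \<in> space (K c). (\<Sum>i<Suc a. \<xi> (z i)) \<le> s} \<subseteq> {z \<in> space (K c). (\<Sum>i<a. \<xi> (z i)) \<le> s}" for a
  proof clarsimp
    fix z assume "z \<in> space (K c)" "(\<Sum>i<a. \<xi> (z i)) + \<xi> (z a) \<le> s"
    moreover have "0 \<le> \<xi> (z a)" using \<open>z \<in> space (K c)\<close> by (intro \<xi>_nonneg) (auto simp: K_space(3) space_PiM)
    ultimately show "(\<Sum>i<a. \<xi> (z i)) \<le> s" by linarith
  qed
  have H: "H a c s = ennreal (p a - p (Suc a))" for a
  proof -
    have "H a c s = (\<integral>\<^sup>+z. indicator ({z \<in> space (K c). (\<Sum>i<a. \<xi> (z i)) \<le> s} - {z \<in> space (K c). (\<Sum>i<Suc a. \<xi> (z i)) \<le> s}) z \<partial>K c)"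
      unfolding H_def alive_def by (intro nn_integral_cong) (auto simp: indicator_def)
    also have "\<dots> = ennreal (measure (K c) ({z \<in> space (K c). (\<Sum>i<a. \<xi> (z i)) \<le> s} - {z \<in> space (K c). (\<Sum>i<Suc a. \<xi> (z i)) \<le> s}))"
      by (subst nn_integral_indicator) (simp_all add: K.emeasure_eq_measure)
    also have "\<dots> = ennreal (p a - p (Suc a))"
      unfolding p_def by (subst K.finite_measure_Diff) (use sub in auto)
    finally show ?thesis .
  qed
  have p0: "p 0 = (if 0 \<le> s then 1 else 0)" by (simp add: p_def K.prob_space)
  \<comment> \<open>\<open>K\<close> lacks generation 0, so its first \<open>a + 1\<close> lifetimes
    are those of generations 1 to \<open>a + 1\<close>, whose sum is the difference of life sums in
    \<open>q\<close>.\<close>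
  have pS: "p (Suc a) = q c s a" for a
  proof -
    have F: "future 0 \<in> Q c \<rightarrow>\<^sub>M path_space E" by measurable
    have B: "{z \<in> space (path_space E). (\<Sum>i<Suc a. \<xi> (z i)) \<le> s} \<in> sets (path_space E)" by measurable
    have "p (Suc a) = measure (Q c) (future 0 -` {z \<in> space (path_space E). (\<Sum>i<Suc a. \<xi> (z i)) \<le> s} \<inter> space (Q c))"
      unfolding p_def K_space(3) unfolding K_def by (rule measure_distr[OF F B])
    also have "future 0 -` {z \<in> space (path_space E). (\<Sum>i<Suc a. \<xi> (z i)) \<le> s} \<inter> space (Q c)
      = {w \<in> space (Q c). life_sum \<xi> w (Suc a) - life_sum \<xi> w 0 \<le> s}"
      using measurable_space[OF F] by (auto simp: life_sum_diff)
    finally show ?thesis by (simp add: q_def)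
  qed
  have mono: "p (Suc a) \<le> p a" for a
    unfolding p_def by (intro K.finite_measure_mono sub) measurable
  let ?q = "\<Sum>n. k1 ^ n * q c s n"
  have s1: "(\<lambda>a. k1 ^ a * p (Suc a)) sums ?q"
    unfolding pS by (rule summable_sums[OF q_summable[OF c]])
  have "(\<lambda>a. k1 ^ Suc a * p (Suc a)) sums (k1 * ?q)"
    using sums_mult[OF s1, of k1] by (simp add: mult.assoc)
  then have "(\<lambda>a. k1 ^ a * p a) sums (k1 * ?q + p 0)"
    using sums_Suc[of "\<lambda>a. k1 ^ a * p a"] by simp
  then have "(\<lambda>a. k1 ^ a * p a - k1 ^ a * p (Suc a)) sums (k1 * ?q + p 0 - ?q)" by (rule sums_diff[OF _ s1])
  then have s2: "(\<lambda>a. k1 ^ a * (p a - p (Suc a))) sums (p 0 + G c s)"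
    by (simp add: G_def algebra_simps)
  have "h c s = (\<Sum>a. ennreal (k1 ^ a * (p a - p (Suc a))))"
    unfolding h_def H using k1_ge_2 mono by (simp add: ennreal_power ennreal_mult)
  also have "\<dots> = ennreal (p 0 + G c s)"
    using s2 k1_ge_2 mono by (intro suminf_ennreal_eq) auto
  also have "G c s = exp (\<nu> * s) * f c s" by (simp add: f_eq exp_minus)
  finally show ?thesis by (simp add: p0)
qed

end

text \<open>The expression is \<open>(C + a) * (C + b) - C^2\<close>.\<close>

lemma product_perturbation:
  fixes a b r C :: real
  assumes a: "\<bar>a\<bar> \<le> r" and b: "\<bar>b\<bar> \<le> r" and C: "0 \<le> C"
  shows "\<bar>C * a + C * b + a * b\<bar> \<le> 2 * C * r + r\<^sup>2"
proof -
  have "\<bar>C * a\<bar> \<le> C * r" "\<bar>C * b\<bar> \<le> C * r"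
    using a b C by (auto simp: abs_mult intro: mult_left_mono)
  moreover have "\<bar>a * b\<bar> \<le> r\<^sup>2"
    unfolding abs_mult power2_eq_square using a by (intro mult_mono a b) auto
  ultimately show ?thesis by (simp add: abs_le_iff)
qed

lemma le_twice_add: "0 \<le> a \<Longrightarrow> 0 \<le> b \<Longrightarrow> 0 \<le> c \<Longrightarrow> b \<le> 2 * (a + b) + 2 * c" for a b c :: real
  by auto

section \<open>Measurable versions of the limit and of the remainder\<close>

context analytic_branching begin

lemma measurable_f [measurable]: "(\<lambda>c. f c t) \<in> borel_measurable E"
proof -
  have "(\<lambda>c. q c t n) \<in> borel_measurable E" for n
  proof -
    define B where "B = {w \<in> space (path_space E). life_sum \<xi> w (Suc n) - life_sum \<xi> w 0 \<le> t}"
    have B: "B \<in> sets (path_space E)" unfolding B_def by measurable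
    have "(\<lambda>c. measure (Q c) B) \<in> borel_measurable E"
      using measurable_compose[OF measurable_prob_algebraD[OF Q_measurable] measurable_measure_subprob_algebra[OF B]] by simp
    then show ?thesis
      by (rule measurable_cong[THEN iffD1, rotated]) (simp add: q_def B_def Q_space(3))
  qed
  then show ?thesis unfolding f_eq G_def by measurable
qed

text \<open>Measurability of a residue in the state is not visible from its definition; here it
  becomes a limit of measurable functions.\<close>

lemma f_tendsto: "c \<in> space E \<Longrightarrow> (\<lambda>n. f c (real n)) \<longlonglongrightarrow> C0 \<Phi> c"
proof -
  assume c: "c \<in> space E"
  have "filterlim (\<lambda>n. - \<delta> * real n) at_bot sequentially"
    using \<delta> by (intro filterlim_tendsto_neg_mult_at_bot[OF tendsto_const] filterlim_real_sequentially) auto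
  then have "(\<lambda>n. exp (- \<delta> * real n)) \<longlonglongrightarrow> 0" by (rule filterlim_compose[OF exp_at_bot])
  then have "(\<lambda>n. exp (- \<delta> * real n) * enn2real (Psi0 \<Phi> \<delta> c)) \<longlonglongrightarrow> 0"
    by (rule tendsto_mult_left_zero)
  then have "(\<lambda>n. f c (real n) - C0 \<Phi> c) \<longlonglongrightarrow> 0"
  proof (rule Lim_null_comparison[rotated], intro always_eventually allI)
    fix n show "norm (f c (real n) - C0 \<Phi> c) \<le> exp (- \<delta> * real n) * enn2real (Psi0 \<Phi> \<delta> c)"
      using f_asymptotics(1)[OF c, of "real n"] by simp
  qed
  then show ?thesis by (simp add: LIM_zero_iff)
qed

lemma measurable_C0 [measurable]: "C0 \<Phi> \<in> borel_measurable E"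
  by (rule borel_measurable_LIMSEQ_real[OF f_tendsto]) auto

text \<open>
  \<open>Psi0 \<Phi> \<delta>\<close> need not be measurable.  It is replaced by the optimal constant in the expansion of
  \<open>f c\<close>, which is.
\<close>

definition R :: "'x \<Rightarrow> real" where
  "R c = enn2real (SUP q::rat. ennreal (exp (\<delta> * of_rat q) * \<bar>f c (of_rat q) - C0 \<Phi> c\<bar>))"

lemma measurable_R [measurable]: "R \<in> borel_measurable E"
  unfolding R_def by measurable

lemma R_nonneg: "0 \<le> R c" by (simp add: R_def)

text \<open>The supremum runs over rationals for the sake of measurability. The passage to real
  \<open>s\<close> rests on the monotonicity of \<open>G\<close>: rationals approaching
  \<open>s\<close> from the right give the upper bound, rationals from the left the lower
  one.\<close>

lemma
  assumes c: "c \<in> space E"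
  shows R_le_Psi0: "ennreal (R c) \<le> Psi0 \<Phi> \<delta> c"
    and f_bound: "\<bar>f c s - C0 \<Phi> c\<bar> \<le> R c * exp (- \<delta> * s)"
proof -
  let ?r = "\<lambda>q. exp (\<delta> * q) * \<bar>f c q - C0 \<Phi> c\<bar>"
  have Psi: "ennreal (enn2real (Psi0 \<Phi> \<delta> c)) = Psi0 \<Phi> \<delta> c"
    using f_asymptotics(3)[OF c] by simp
  have "ennreal (?r q) \<le> Psi0 \<Phi> \<delta> c" for q
  proof -
    have "?r q \<le> exp (\<delta> * q) * (exp (- \<delta> * q) * enn2real (Psi0 \<Phi> \<delta> c))"
      by (intro mult_left_mono f_asymptotics(1)[OF c]) simp
    also have "\<dots> = enn2real (Psi0 \<Phi> \<delta> c)" by (simp add: exp_minus)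
    finally show ?thesis using ennreal_leI Psi by fastforce
  qed
  then have sup: "(SUP q::rat. ennreal (?r (of_rat q))) \<le> Psi0 \<Phi> \<delta> c" by (intro SUP_least)
  then have fin: "(SUP q::rat. ennreal (?r (of_rat q))) < \<infinity>" using f_asymptotics(3)[OF c] by (rule le_less_trans)
  then have R: "ennreal (R c) = (SUP q::rat. ennreal (?r (of_rat q)))" by (simp add: R_def)
  then show "ennreal (R c) \<le> Psi0 \<Phi> \<delta> c" using sup by simp
  have rat: "\<bar>f c (of_rat q) - C0 \<Phi> c\<bar> \<le> R c * exp (- \<delta> * of_rat q)" for q
  proof -
    have "ennreal (?r (of_rat q)) \<le> ennreal (R c)" unfolding R by (rule SUP_upper) simp
    then have "?r (of_rat q) \<le> R c" using R_nonneg by simp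
    then show ?thesis by (simp add: exp_minus field_simps)
  qed
  \<comment> \<open>The sign \<open>a\<close> selects the side: right of \<open>s\<close> for 1,
    left of it for -1.\<close>
  have approx: "\<exists>\<rho> :: nat \<Rightarrow> rat. (\<lambda>n. of_rat (\<rho> n) :: real) \<longlonglongrightarrow> s \<and> (\<forall>n. a * (of_rat (\<rho> n) - s) \<ge> 0)" if a: "a = 1 \<or> a = -1" for a :: real
  proof -
    have "\<exists>\<rho>::rat. 0 < a * (of_rat \<rho> - s) \<and> a * (of_rat \<rho> - s) < 1 / real (Suc n)" for n
    proof (cases "a = 1")
      case True
      then show ?thesis using of_rat_dense[of s "s + 1 / real (Suc n)"] by (auto simp: algebra_simps)
    next
      case False
      then show ?thesis using of_rat_dense[of "s - 1 / real (Suc n)" s] a by (auto simp: algebra_simps)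
    qed
    then obtain \<rho> :: "nat \<Rightarrow> rat" where \<rho>: "\<And>n. 0 < a * (of_rat (\<rho> n) - s)" "\<And>n. a * (of_rat (\<rho> n) - s) < 1 / real (Suc n)" by metis
    have "(\<lambda>n. of_rat (\<rho> n) - s) \<longlonglongrightarrow> 0"
    proof (rule Lim_null_comparison[OF _ LIMSEQ_inverse_real_of_nat], intro always_eventually allI)
      fix n show "norm (of_rat (\<rho> n) - s) \<le> inverse (real (Suc n))"
        using \<rho>(1,2)[of n] a by (auto simp: inverse_eq_divide)
    qed
    then have "(\<lambda>n. of_rat (\<rho> n) :: real) \<longlonglongrightarrow> s" by (simp add: LIM_zero_iff)
    then show ?thesis using \<rho>(1) less_imp_le by blast
  qed
  have G_eq: "G c u = exp (\<nu> * u) * f c u" for u by (simp add: f_eq exp_minus)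
  show "\<bar>f c s - C0 \<Phi> c\<bar> \<le> R c * exp (- \<delta> * s)"
  proof (rule abs_leI)
    obtain \<rho> :: "nat \<Rightarrow> rat" where \<rho>: "(\<lambda>n. of_rat (\<rho> n) :: real) \<longlonglongrightarrow> s" "\<And>n. s \<le> of_rat (\<rho> n)"
      using approx[of 1] by auto
    have "(\<lambda>n. exp (\<nu> * (of_rat (\<rho> n) - s)) * (C0 \<Phi> c + R c * exp (- \<delta> * of_rat (\<rho> n)))) \<longlonglongrightarrow> exp (\<nu> * (s - s)) * (C0 \<Phi> c + R c * exp (- \<delta> * s))"
      by (intro tendsto_intros \<rho>(1))
    moreover have "f c s \<le> exp (\<nu> * (of_rat (\<rho> n) - s)) * (C0 \<Phi> c + R c * exp (- \<delta> * of_rat (\<rho> n)))" for n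
    proof -
      have "f c s = exp (- \<nu> * s) * G c s" by (rule f_eq)
      also have "\<dots> \<le> exp (- \<nu> * s) * G c (of_rat (\<rho> n))"
        using monoD[OF G_mono[OF c] \<rho>(2)] by simp
      also have "\<dots> = exp (\<nu> * (of_rat (\<rho> n) - s)) * f c (of_rat (\<rho> n))"
        unfolding G_eq by (simp add: mult.assoc[symmetric] exp_add[symmetric] algebra_simps)
      also have "\<dots> \<le> exp (\<nu> * (of_rat (\<rho> n) - s)) * (C0 \<Phi> c + R c * exp (- \<delta> * of_rat (\<rho> n)))"
        using rat[of "\<rho> n"] by (intro mult_left_mono) auto
      finally show ?thesis .
    qed
    ultimately have "f c s \<le> exp (\<nu> * (s - s)) * (C0 \<Phi> c + R c * exp (- \<delta> * s))"
      by (intro LIMSEQ_le_const) auto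
    then show "f c s - C0 \<Phi> c \<le> R c * exp (- \<delta> * s)" by simp
  next
    obtain \<rho> :: "nat \<Rightarrow> rat" where \<rho>: "(\<lambda>n. of_rat (\<rho> n) :: real) \<longlonglongrightarrow> s" "\<And>n. of_rat (\<rho> n) \<le> s"
      using approx[of "-1"] by auto
    have "(\<lambda>n. exp (\<nu> * (of_rat (\<rho> n) - s)) * (C0 \<Phi> c - R c * exp (- \<delta> * of_rat (\<rho> n)))) \<longlonglongrightarrow> exp (\<nu> * (s - s)) * (C0 \<Phi> c - R c * exp (- \<delta> * s))"
      by (intro tendsto_intros \<rho>(1))
    moreover have "exp (\<nu> * (of_rat (\<rho> n) - s)) * (C0 \<Phi> c - R c * exp (- \<delta> * of_rat (\<rho> n))) \<le> f c s" for n
    proof -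
      have "exp (\<nu> * (of_rat (\<rho> n) - s)) * (C0 \<Phi> c - R c * exp (- \<delta> * of_rat (\<rho> n))) \<le> exp (\<nu> * (of_rat (\<rho> n) - s)) * f c (of_rat (\<rho> n))"
        using rat[of "\<rho> n"] by (intro mult_left_mono) auto
      also have "\<dots> = exp (- \<nu> * s) * G c (of_rat (\<rho> n))"
        unfolding G_eq by (simp add: mult.assoc[symmetric] exp_add[symmetric] algebra_simps)
      also have "\<dots> \<le> exp (- \<nu> * s) * G c s"
        using monoD[OF G_mono[OF c] \<rho>(2)] by simp
      also have "\<dots> = f c s" by (rule f_eq[symmetric])
      finally show ?thesis .
    qed
    ultimately have "exp (\<nu> * (s - s)) * (C0 \<Phi> c - R c * exp (- \<delta> * s)) \<le> f c s"
      by (intro LIMSEQ_le_const2) auto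
    then show "- (f c s - C0 \<Phi> c) \<le> R c * exp (- \<delta> * s)" by simp
  qed
qed

section \<open>Expansion of the product of two mean progenies, with explicit error\<close>

lemma f_nonneg: "c \<in> space E \<Longrightarrow> 0 \<le> f c s"
  using G_nonneg by (simp add: f_eq)

lemma f_neg: "c \<in> space E \<Longrightarrow> s < 0 \<Longrightarrow> f c s = 0"
  using G_neg by (simp add: f_eq)

lemma f_le:
  assumes c: "c \<in> space E" and s: "0 \<le> s"
  shows "f c s \<le> C0 \<Phi> c + R c"
proof -
  have "R c * exp (- \<delta> * s) \<le> R c * 1"
    using \<delta> s R_nonneg by (intro mult_left_mono) auto
  then show ?thesis using f_bound[OF c, of s] by (simp add: abs_le_iff)
qed

text \<open>Error caused by a branching cell in state \<open>c\<close> that dies at time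
  \<open>\<sigma>\<close>. Its two groups mirror the integrands of the second and third summability
  hypotheses, with \<open>R\<close> for \<open>Psi0\<close> and 1 for the generation
  \<open>k\<close>.\<close>

definition W :: "'x \<Rightarrow> real \<Rightarrow> real" where
  "W c \<sigma> = 2 * (C0 \<Phi> c * R c * exp (- (2 * \<nu> - \<delta>) * \<sigma>) + (R c)\<^sup>2 * exp (- 2 * (\<nu> - \<delta>) * \<sigma>))
     + 2 * ((C0 \<Phi> c + R c + 1) * exp (- (\<nu> + \<delta>) * \<sigma>))"

text \<open>The two sources of error: the remainder of \<open>f\<close> decays at rate
  \<open>\<delta>\<close>, and the terms of the product that carry an indicator are smaller than the
  leading one by \<open>exp (- (\<nu> - \<delta>) * t)\<close>.\<close>

definition \<eta> :: real where "\<eta> = min \<delta> (\<nu> - \<delta>)"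

lemma \<eta>_pos: "0 < \<eta>" using \<delta> by (simp add: \<eta>_def)

lemma W_nonneg: "c \<in> space E \<Longrightarrow> 0 \<le> W c \<sigma>"
  unfolding W_def using f_asymptotics(2)[of c] R_nonneg[of c] by (intro add_nonneg_nonneg mult_nonneg_nonneg) auto

text \<open>The local \<open>\<phi>\<close> is the real form of \<open>h\<close>. The expansion is
  put into two inequalities free of subtraction, ready to be integrated as extended reals.\<close>

lemma product_expansion:
  fixes \<sigma> t \<tau> :: real
  assumes c: "c \<in> space E" and t: "0 \<le> t" and \<tau>: "0 \<le> \<tau>"
  defines "\<phi> \<equiv> \<lambda>s. (if 0 \<le> s then 1 else 0) + exp (\<nu> * s) * f c s"
  shows "\<phi> (t - \<sigma>) * \<phi> (t + \<tau> - \<sigma>) \<le> exp (\<nu> * (2 * t + \<tau>)) * ((C0 \<Phi> c)\<^sup>2 * exp (- 2 * \<nu> * \<sigma>) + exp (- \<eta> * t) * W c \<sigma>)"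
    and "exp (\<nu> * (2 * t + \<tau>)) * ((C0 \<Phi> c)\<^sup>2 * exp (- 2 * \<nu> * \<sigma>)) \<le> \<phi> (t - \<sigma>) * \<phi> (t + \<tau> - \<sigma>) + exp (\<nu> * (2 * t + \<tau>)) * exp (- \<eta> * t) * W c \<sigma>"
proof -
  define C Rc u u' e where "C = C0 \<Phi> c" and "Rc = R c" and "u = t - \<sigma>" and "u' = t + \<tau> - \<sigma>" and "e = exp (\<nu> * (2 * t + \<tau>))"
  have C: "0 < C" and Rc: "0 \<le> Rc" using f_asymptotics(2)[OF c] R_nonneg by (auto simp: C_def Rc_def)
  have uu: "u \<le> u'" using \<tau> by (simp add: u_def u'_def)
  define r where "r = Rc * exp (- \<delta> * u)"
  have r0: "0 \<le> r" using Rc by (simp add: r_def)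
  have b1: "\<bar>f c u - C\<bar> \<le> r" using f_bound[OF c, of u] by (simp add: C_def r_def Rc_def)
  \<comment> \<open>The later argument has the smaller remainder, so a single \<open>r\<close>
    serves both factors.\<close>
  have b2: "\<bar>f c u' - C\<bar> \<le> r"
  proof -
    have "Rc * exp (- \<delta> * u') \<le> r" unfolding r_def using Rc uu \<delta> by (intro mult_left_mono) auto
    then show ?thesis using f_bound[OF c, of u'] by (simp add: C_def Rc_def)
  qed
  have prod_bound: "\<bar>f c u * f c u' - C\<^sup>2\<bar> \<le> 2 * C * r + r\<^sup>2"
  proof -
    have "f c u * f c u' - C\<^sup>2 = C * (f c u - C) + C * (f c u' - C) + (f c u - C) * (f c u' - C)"
      by (simp add: algebra_simps power2_eq_square)
    then show ?thesis using product_perturbation[OF b1 b2, of C] C by simp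
  qed
  have e_fac: "exp (\<nu> * u) * exp (\<nu> * u') = e * exp (- 2 * \<nu> * \<sigma>)"
    unfolding e_def exp_add[symmetric] by (simp add: u_def u'_def algebra_simps)
  have \<eta>le: "exp (- \<delta> * t) \<le> exp (- \<eta> * t)" "exp (- (\<nu> - \<delta>) * t) \<le> exp (- \<eta> * t)"
    using mult_right_mono[OF min.cobounded1[of \<delta> "\<nu> - \<delta>"] t] mult_right_mono[OF min.cobounded2[of \<delta> "\<nu> - \<delta>"] t]
    by (simp_all add: \<eta>_def algebra_simps)
  define W1 W2 where "W1 = 2 * (C * Rc * exp (- (2 * \<nu> - \<delta>) * \<sigma>) + Rc\<^sup>2 * exp (- 2 * (\<nu> - \<delta>) * \<sigma>))"
    and "W2 = 2 * ((C + Rc + 1) * exp (- (\<nu> + \<delta>) * \<sigma>))"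
  have W: "W c \<sigma> = W1 + W2" by (simp add: W_def W1_def W2_def C_def Rc_def)
  have W12: "0 \<le> W1" "0 \<le> W2" using C Rc by (auto simp: W1_def W2_def)
  have err1: "exp (- 2 * \<nu> * \<sigma>) * (2 * C * r + r\<^sup>2) \<le> exp (- \<eta> * t) * W1"
  proof -
    have r_eq: "r = Rc * exp (\<delta> * \<sigma>) * exp (- \<delta> * t)"
      by (simp add: r_def u_def exp_add[symmetric] algebra_simps)
    have 1: "exp (- 2 * \<nu> * \<sigma>) * (2 * C * r) = exp (- \<delta> * t) * (2 * (C * Rc * exp (- (2 * \<nu> - \<delta>) * \<sigma>)))"
    proof -
      have "exp (- 2 * \<nu> * \<sigma>) * exp (\<delta> * \<sigma>) = exp (- (2 * \<nu> - \<delta>) * \<sigma>)"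
        unfolding exp_add[symmetric] by (simp add: algebra_simps)
      moreover have "exp (- 2 * \<nu> * \<sigma>) * (2 * C * r) = (exp (- 2 * \<nu> * \<sigma>) * exp (\<delta> * \<sigma>)) * (exp (- \<delta> * t) * (2 * (C * Rc)))"
        unfolding r_eq by (simp only: mult_ac)
      ultimately show ?thesis by (simp only: mult_ac)
    qed
    have 2: "exp (- 2 * \<nu> * \<sigma>) * r\<^sup>2 = (exp (- \<delta> * t))\<^sup>2 * (Rc\<^sup>2 * exp (- 2 * (\<nu> - \<delta>) * \<sigma>))"
    proof -
      have "exp (- 2 * \<nu> * \<sigma>) * (exp (\<delta> * \<sigma>))\<^sup>2 = exp (- 2 * (\<nu> - \<delta>) * \<sigma>)"
        unfolding exp_double[symmetric] exp_add[symmetric] by (simp add: algebra_simps)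
      moreover have "exp (- 2 * \<nu> * \<sigma>) * r\<^sup>2 = (exp (- 2 * \<nu> * \<sigma>) * (exp (\<delta> * \<sigma>))\<^sup>2) * ((exp (- \<delta> * t))\<^sup>2 * Rc\<^sup>2)"
        unfolding r_eq power_mult_distrib by (simp only: mult_ac)
      ultimately show ?thesis by (simp only: mult_ac)
    qed
    \<comment> \<open>The quadratic error decays at twice the rate; for \<open>t \<ge> 0\<close> it
      is weakened to the rate of the linear one.\<close>
    have d1: "exp (- \<delta> * t) \<le> 1" using \<delta> t by simp
    then have "(exp (- \<delta> * t))\<^sup>2 \<le> exp (- \<delta> * t)"
      using mult_left_mono[OF d1, of "exp (- \<delta> * t)"] by (simp add: power2_eq_square)
    then have "exp (- 2 * \<nu> * \<sigma>) * r\<^sup>2 \<le> exp (- \<delta> * t) * (2 * (Rc\<^sup>2 * exp (- 2 * (\<nu> - \<delta>) * \<sigma>)))"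
      unfolding 2
    proof (rule mult_mono)
      have twice: "y \<le> 2 * y" if "0 \<le> y" for y :: real using that by auto
      show "Rc\<^sup>2 * exp (- 2 * (\<nu> - \<delta>) * \<sigma>) \<le> 2 * (Rc\<^sup>2 * exp (- 2 * (\<nu> - \<delta>) * \<sigma>))"
        by (rule twice) simp
    qed auto
    then have "exp (- 2 * \<nu> * \<sigma>) * (2 * C * r) + exp (- 2 * \<nu> * \<sigma>) * r\<^sup>2
        \<le> exp (- \<delta> * t) * (2 * (C * Rc * exp (- (2 * \<nu> - \<delta>) * \<sigma>))) + exp (- \<delta> * t) * (2 * (Rc\<^sup>2 * exp (- 2 * (\<nu> - \<delta>) * \<sigma>)))"
      unfolding 1 by (rule add_left_mono)
    then have "exp (- 2 * \<nu> * \<sigma>) * (2 * C * r + r\<^sup>2) \<le> exp (- \<delta> * t) * W1"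
      by (simp only: W1_def distrib_left)
    also have "\<dots> \<le> exp (- \<eta> * t) * W1" by (intro mult_right_mono \<eta>le W12)
    finally show ?thesis .
  qed
  have main: "\<bar>(exp (\<nu> * u) * f c u) * (exp (\<nu> * u') * f c u') - e * (C\<^sup>2 * exp (- 2 * \<nu> * \<sigma>))\<bar> \<le> e * (exp (- \<eta> * t) * W1)"
  proof -
    have "(exp (\<nu> * u) * f c u) * (exp (\<nu> * u') * f c u') = (exp (\<nu> * u) * exp (\<nu> * u')) * (f c u * f c u')" by (simp only: mult_ac)
    then have "(exp (\<nu> * u) * f c u) * (exp (\<nu> * u') * f c u') - e * (C\<^sup>2 * exp (- 2 * \<nu> * \<sigma>))
      = e * exp (- 2 * \<nu> * \<sigma>) * (f c u * f c u' - C\<^sup>2)"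
      unfolding e_fac by (simp add: algebra_simps)
    then have "\<bar>(exp (\<nu> * u) * f c u) * (exp (\<nu> * u') * f c u') - e * (C\<^sup>2 * exp (- 2 * \<nu> * \<sigma>))\<bar>
      = e * (exp (- 2 * \<nu> * \<sigma>) * \<bar>f c u * f c u' - C\<^sup>2\<bar>)"
      by (simp add: abs_mult e_def mult.assoc)
    also have "\<dots> \<le> e * (exp (- 2 * \<nu> * \<sigma>) * (2 * C * r + r\<^sup>2))"
      using prod_bound by (intro mult_left_mono) (auto simp: e_def)
    also have "\<dots> \<le> e * (exp (- \<eta> * t) * W1)" by (intro mult_left_mono err1) (simp add: e_def)
    finally show ?thesis .
  qed
  have fn: "0 \<le> f c v" for v by (rule f_nonneg[OF c])
  have lower: "(exp (\<nu> * u) * f c u) * (exp (\<nu> * u') * f c u') \<le> \<phi> u * \<phi> u'"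
    unfolding \<phi>_def using fn by (intro mult_mono) auto
  \<comment> \<open>Only terms carrying an indicator are at stake. For \<open>u < 0\<close> the
    first factor vanishes; for \<open>u \<ge> 0\<close> each of them is at most
    \<open>exp (\<nu> * u')\<close> times a quantity depending on the state alone.\<close>
  have upper: "\<phi> u * \<phi> u' \<le> (exp (\<nu> * u) * f c u) * (exp (\<nu> * u') * f c u') + e * (exp (- \<eta> * t) * W2)"
  proof (cases "0 \<le> u")
    case False
    then have "\<phi> u = 0" using f_neg[OF c] by (simp add: \<phi>_def)
    then show ?thesis using fn W12 by (simp add: e_def)
  next
    case True
    then have u: "0 \<le> u" "0 \<le> u'" using uu by auto
    define m where "m = exp (\<nu> * u')"
    have m: "exp (\<nu> * u) \<le> m" "1 \<le> m" using \<nu>_pos uu u by (auto simp: m_def)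
    have "\<phi> u * \<phi> u' = (exp (\<nu> * u) * f c u) * (exp (\<nu> * u') * f c u') + (1 + exp (\<nu> * u) * f c u + m * f c u')"
      using u by (simp add: \<phi>_def m_def algebra_simps)
    also have "1 + exp (\<nu> * u) * f c u + m * f c u' \<le> m + m * (C + Rc) + m * (C + Rc)"
    proof (intro add_mono m(2))
      show "exp (\<nu> * u) * f c u \<le> m * (C + Rc)"
        using f_le[OF c u(1)] fn m(1) by (intro mult_mono) (auto simp: C_def Rc_def m_def)
      show "m * f c u' \<le> m * (C + Rc)"
        using f_le[OF c u(2)] by (intro mult_left_mono) (auto simp: C_def Rc_def m_def)
    qed
    also have "\<dots> \<le> m * (2 * (C + Rc + 1))" using m(2) by (simp add: algebra_simps)
    also have "m \<le> e * exp (- (\<nu> - \<delta>) * t) * exp (- (\<nu> + \<delta>) * \<sigma>)"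
    proof -
      \<comment> \<open>Adding the nonnegative \<open>\<delta> * u\<close> to the exponent gives up
        part of the decay in \<open>t\<close> for additional decay in \<open>\<sigma>\<close>; this
        produces the weight \<open>exp (- (\<nu> + \<delta>) * \<sigma>)\<close> of the third
        hypothesis.\<close>
      have "\<nu> * u' \<le> \<nu> * u' + \<delta> * u" using u \<delta> by simp
      also have "\<dots> = \<nu> * (2 * t + \<tau>) + - (\<nu> - \<delta>) * t + - (\<nu> + \<delta>) * \<sigma>"
        by (simp add: u_def u'_def algebra_simps)
      finally show ?thesis unfolding m_def e_def exp_add[symmetric] by simp
    qed
    finally have "\<phi> u * \<phi> u' \<le> (exp (\<nu> * u) * f c u) * (exp (\<nu> * u') * f c u')
        + e * exp (- (\<nu> - \<delta>) * t) * exp (- (\<nu> + \<delta>) * \<sigma>) * (2 * (C + Rc + 1))"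
      using C Rc by (simp add: mult_right_mono)
    also have "e * exp (- (\<nu> - \<delta>) * t) * exp (- (\<nu> + \<delta>) * \<sigma>) * (2 * (C + Rc + 1)) = e * (exp (- (\<nu> - \<delta>) * t) * W2)"
      by (simp add: W2_def)
    also have "\<dots> \<le> e * (exp (- \<eta> * t) * W2)"
      by (intro mult_left_mono mult_right_mono \<eta>le W12) (simp add: e_def)
    finally show ?thesis by simp
  qed
  have "\<phi> u * \<phi> u' \<le> e * (C\<^sup>2 * exp (- 2 * \<nu> * \<sigma>)) + e * (exp (- \<eta> * t) * W1) + e * (exp (- \<eta> * t) * W2)"
    using main upper by linarith
  also have "\<dots> = e * (C\<^sup>2 * exp (- 2 * \<nu> * \<sigma>) + exp (- \<eta> * t) * W c \<sigma>)" by (simp add: W distrib_left)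
  finally show "\<phi> (t - \<sigma>) * \<phi> (t + \<tau> - \<sigma>) \<le> exp (\<nu> * (2 * t + \<tau>)) * ((C0 \<Phi> c)\<^sup>2 * exp (- 2 * \<nu> * \<sigma>) + exp (- \<eta> * t) * W c \<sigma>)"
    by (simp only: u_def u'_def e_def C_def)
  have "e * (C\<^sup>2 * exp (- 2 * \<nu> * \<sigma>)) \<le> \<phi> u * \<phi> u' + e * (exp (- \<eta> * t) * W1)"
    using main lower by linarith
  also have "\<dots> \<le> \<phi> u * \<phi> u' + e * (exp (- \<eta> * t) * W c \<sigma>)"
    using W12 by (intro add_left_mono mult_left_mono) (auto simp: W e_def)
  finally show "exp (\<nu> * (2 * t + \<tau>)) * ((C0 \<Phi> c)\<^sup>2 * exp (- 2 * \<nu> * \<sigma>)) \<le> \<phi> (t - \<sigma>) * \<phi> (t + \<tau> - \<sigma>) + exp (\<nu> * (2 * t + \<tau>)) * exp (- \<eta> * t) * W c \<sigma>"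
    by (simp only: u_def u'_def e_def C_def mult.assoc)
qed

text \<open>The inequality \<open>a \<le> 1 + a^2\<close> replaces first powers of \<open>C0\<close>
  and \<open>R\<close> by the squares that the summability hypotheses control. The 3 collects the
  indicator and two units from this inequality.\<close>

lemma first_moment_bound:
  assumes c: "c \<in> space E" and s: "0 \<le> s"
  shows "(if 0 \<le> s - \<sigma> then 1 else 0) + exp (\<nu> * (s - \<sigma>)) * f c (s - \<sigma>)
    \<le> exp (\<nu> * s) * (3 + (C0 \<Phi> c)\<^sup>2 * exp (- 2 * \<nu> * \<sigma>) + W c \<sigma>)"
proof -
  have sq: "a \<le> 1 + a\<^sup>2" for a :: real
    using zero_le_power2[of "a - 1/2"] by (simp add: power2_eq_square algebra_simps)
  have C: "0 < C0 \<Phi> c" and R: "0 \<le> R c" using f_asymptotics(2)[OF c] R_nonneg by auto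
  show ?thesis
  proof (cases "0 \<le> s - \<sigma>")
    case False
    have "0 \<le> exp (\<nu> * s) * (3 + (C0 \<Phi> c)\<^sup>2 * exp (- 2 * \<nu> * \<sigma>) + W c \<sigma>)"
      using W_nonneg[OF c, of \<sigma>] by (intro mult_nonneg_nonneg add_nonneg_nonneg) auto
    then show ?thesis using False f_neg[OF c] by simp
  next
    case True
    let ?a = "C0 \<Phi> c * exp (- \<nu> * \<sigma>)" and ?b = "R c * exp (- (\<nu> - \<delta>) * \<sigma>)"
    have "exp (\<nu> * (s - \<sigma>)) * f c (s - \<sigma>) \<le> exp (\<nu> * (s - \<sigma>)) * (C0 \<Phi> c + R c * exp (- \<delta> * (s - \<sigma>)))"
      using f_bound[OF c, of "s - \<sigma>"] by (intro mult_left_mono) auto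
    also have "\<dots> = exp (\<nu> * s) * (?a + exp (- \<delta> * s) * ?b)"
    proof -
      have 1: "exp (\<nu> * (s - \<sigma>)) = exp (\<nu> * s) * exp (- \<nu> * \<sigma>)" unfolding exp_add[symmetric] by (simp add: algebra_simps)
      have 2: "exp (\<nu> * (s - \<sigma>)) * exp (- \<delta> * (s - \<sigma>)) = exp (\<nu> * s) * (exp (- \<delta> * s) * exp (- (\<nu> - \<delta>) * \<sigma>))"
        unfolding exp_add[symmetric] by (simp add: algebra_simps)
      have "exp (\<nu> * (s - \<sigma>)) * (C0 \<Phi> c + R c * exp (- \<delta> * (s - \<sigma>)))
        = exp (\<nu> * (s - \<sigma>)) * C0 \<Phi> c + (exp (\<nu> * (s - \<sigma>)) * exp (- \<delta> * (s - \<sigma>))) * R c" by (simp add: distrib_left mult_ac)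
      then show ?thesis unfolding 2 unfolding 1 by (simp add: distrib_left mult_ac)
    qed
    also have "\<dots> \<le> exp (\<nu> * s) * ((1 + ?a\<^sup>2) + (1 + ?b\<^sup>2))"
    proof (intro mult_left_mono add_mono sq)
      have "exp (- \<delta> * s) * ?b \<le> 1 * ?b" using \<delta> s R by (intro mult_right_mono) auto
      then show "exp (- \<delta> * s) * ?b \<le> 1 + ?b\<^sup>2" using sq[of ?b] by linarith
    qed simp
    also have "?a\<^sup>2 = (C0 \<Phi> c)\<^sup>2 * exp (- 2 * \<nu> * \<sigma>)"
      unfolding power_mult_distrib exp_double[symmetric] by (simp add: mult.assoc)
    also have "?b\<^sup>2 = (R c)\<^sup>2 * exp (- 2 * (\<nu> - \<delta>) * \<sigma>)"
      unfolding power_mult_distrib exp_double[symmetric] by (simp add: mult.assoc)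
    also have "\<dots> \<le> W c \<sigma>"
    proof -
      have "0 \<le> C0 \<Phi> c * R c * exp (- (2 * \<nu> - \<delta>) * \<sigma>)" "0 \<le> (R c)\<^sup>2 * exp (- 2 * (\<nu> - \<delta>) * \<sigma>)"
         "0 \<le> (C0 \<Phi> c + R c + 1) * exp (- (\<nu> + \<delta>) * \<sigma>)" using C R by auto
      then show ?thesis unfolding W_def by (rule le_twice_add)
    qed
    finally have "exp (\<nu> * (s - \<sigma>)) * f c (s - \<sigma>) \<le> exp (\<nu> * s) * ((1 + (C0 \<Phi> c)\<^sup>2 * exp (- 2 * \<nu> * \<sigma>)) + (1 + W c \<sigma>))"
      by simp
    moreover have "1 \<le> exp (\<nu> * s)" using \<nu>_pos s by simp
    ultimately have "1 + exp (\<nu> * (s - \<sigma>)) * f c (s - \<sigma>) \<le> exp (\<nu> * s) + exp (\<nu> * s) * ((1 + (C0 \<Phi> c)\<^sup>2 * exp (- 2 * \<nu> * \<sigma>)) + (1 + W c \<sigma>))"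
      by (intro add_mono)
    also have "\<dots> = exp (\<nu> * s) * (3 + (C0 \<Phi> c)\<^sup>2 * exp (- 2 * \<nu> * \<sigma>) + W c \<sigma>)"
      by (simp add: algebra_simps)
    finally show ?thesis using True by simp
  qed
qed

end

lemma ennreal_twice_plus:
  assumes "0 \<le> a" "0 \<le> b"
  shows "ennreal (2 * a + 2 * b) = 2 * ennreal a + 2 * ennreal b"
proof -
  have "ennreal (2 * a + 2 * b) = ennreal (2 * a) + ennreal (2 * b)"
    using assms by (intro ennreal_plus) auto
  then show ?thesis using assms by (simp only: ennreal_mult[of 2] ennreal_numeral zero_le_numeral)
qed

section \<open>Integration over the state and summation over the generation of branching\<close>

context analytic_branching begin

lemma measurable_W [measurable]: "(\<lambda>\<omega>. W (X k \<omega>) (S k \<omega>)) \<in> borel_measurable P"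
  unfolding W_def by measurable

text \<open>The pointwise expansion is integrated and summed in \<open>ennreal\<close>, and real
  numbers return once finiteness is known. Only \<open>exp (\<nu> * (2 * t + \<tau>))\<close> and
  \<open>exp (- \<eta> * t)\<close> depend on the times, so one \<open>b\<close> serves all of
  them.\<close>

lemma second_moment_asymptotics:
  assumes sum1: "(\<Sum>k. ennreal (k1 ^ k) *
        (\<integral>\<^sup>+ \<omega>. ennreal ((C0 \<Phi> (X k \<omega>))\<^sup>2 * exp (- 2 * \<nu> * S k \<omega>)) \<partial>P)) < \<infinity>"
    and sum2: "(\<Sum>k. ennreal (k1 ^ k) *
        (\<integral>\<^sup>+ \<omega>. ennreal (C0 \<Phi> (X k \<omega>)) * Psi0 \<Phi> \<delta> (X k \<omega>) * ennreal (exp (- (2 * \<nu> - \<delta>) * S k \<omega>))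
              + (Psi0 \<Phi> \<delta> (X k \<omega>))\<^sup>2 * ennreal (exp (- 2 * (\<nu> - \<delta>) * S k \<omega>)) \<partial>P)) < \<infinity>"
    and sum3: "(\<Sum>k. ennreal (k1 ^ k) *
        (\<integral>\<^sup>+ \<omega>. (ennreal (C0 \<Phi> (X k \<omega>)) + Psi0 \<Phi> \<delta> (X k \<omega>) + of_nat k)
              * ennreal (exp (- (\<nu> + \<delta>) * S k \<omega>)) \<partial>P)) < \<infinity>"
  defines "m \<equiv> enn2real (\<Sum>k. ennreal (k1 ^ k) *
        (\<integral>\<^sup>+ \<omega>. ennreal ((C0 \<Phi> (X k \<omega>))\<^sup>2 * exp (- 2 * \<nu> * S k \<omega>)) \<partial>P))"
  shows "0 < m" and "\<exists>b\<ge>0. \<forall>t\<ge>0. \<forall>\<tau>\<ge>0. pop_moment \<xi> \<kappa> T Y t \<tau> < \<infinity> \<and>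
      \<bar>enn2real (pop_moment \<xi> \<kappa> T Y t \<tau>) - exp (\<nu> * (2 * t + \<tau>)) * k2 * m\<bar> \<le> exp (\<nu> * (2 * t + \<tau>)) * exp (- \<eta> * t) * b"
proof -
  have Xs: "X k \<omega> \<in> space E" if "\<omega> \<in> space P" for k \<omega> by (rule X_space[OF that])
  have C: "0 < C0 \<Phi> (X k \<omega>)" if "\<omega> \<in> space P" for k \<omega> by (rule f_asymptotics(2)[OF Xs[OF that]])
  have Psi: "ennreal (R (X k \<omega>)) \<le> Psi0 \<Phi> \<delta> (X k \<omega>)" if "\<omega> \<in> space P" for k \<omega> by (rule R_le_Psi0[OF Xs[OF that]])
  have Snn: "0 \<le> S k \<omega>" if "\<omega> \<in> space P" for k \<omega>
    unfolding life_sum_def by (intro sum_nonneg \<xi>_nonneg Xs[OF that])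
  let ?a = "\<lambda>k \<omega>. (C0 \<Phi> (X k \<omega>))\<^sup>2 * exp (- 2 * \<nu> * S k \<omega>)"
  let ?W = "\<lambda>k \<omega>. W (X k \<omega>) (S k \<omega>)"
  define A where "A k = (\<integral>\<^sup>+ \<omega>. ennreal (?a k \<omega>) \<partial>P)" for k
  define B where "B k = (\<integral>\<^sup>+ \<omega>. ennreal (?W k \<omega>) \<partial>P)" for k
  define At where "At = (\<Sum>k. ennreal (k1 ^ k) * A k)"
  define Bt where "Bt = (\<Sum>k. ennreal (k1 ^ k) * B k)"
  have At: "At = ennreal m" using sum1 by (simp add: At_def A_def m_def)
  have Bt_fin: "Bt < \<infinity>"
  proof -
    let ?w1 = "\<lambda>k \<omega>. C0 \<Phi> (X k \<omega>) * R (X k \<omega>) * exp (- (2 * \<nu> - \<delta>) * S k \<omega>) + (R (X k \<omega>))\<^sup>2 * exp (- 2 * (\<nu> - \<delta>) * S k \<omega>)"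
    let ?w2 = "\<lambda>k \<omega>. (C0 \<Phi> (X k \<omega>) + R (X k \<omega>) + 1) * exp (- (\<nu> + \<delta>) * S k \<omega>)"
    let ?w3 = "\<lambda>k \<omega>. (C0 \<Phi> (X k \<omega>) + R (X k \<omega>) + real k) * exp (- (\<nu> + \<delta>) * S k \<omega>)"
    let ?I2 = "\<lambda>k. \<integral>\<^sup>+ \<omega>. ennreal (C0 \<Phi> (X k \<omega>)) * Psi0 \<Phi> \<delta> (X k \<omega>) * ennreal (exp (- (2 * \<nu> - \<delta>) * S k \<omega>))
              + (Psi0 \<Phi> \<delta> (X k \<omega>))\<^sup>2 * ennreal (exp (- 2 * (\<nu> - \<delta>) * S k \<omega>)) \<partial>P"
    let ?I3 = "\<lambda>k. \<integral>\<^sup>+ \<omega>. (ennreal (C0 \<Phi> (X k \<omega>)) + Psi0 \<Phi> \<delta> (X k \<omega>) + of_nat k) * ennreal (exp (- (\<nu> + \<delta>) * S k \<omega>)) \<partial>P"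
    \<comment> \<open>\<open>W\<close> has 1 where the third hypothesis has \<open>k\<close>. The
      difference matters only at \<open>k = 0\<close>, where the missing term is at most 1 because
      life sums are nonnegative.\<close>
    let ?z = "\<lambda>k::nat. if k = 0 then 1 else 0 :: ennreal"
    have B_le: "B k \<le> 2 * ?I2 k + 2 * (?I3 k + ?z k)" for k
    proof -
      have "B k = (\<integral>\<^sup>+ \<omega>. 2 * ennreal (?w1 k \<omega>) + 2 * ennreal (?w2 k \<omega>) \<partial>P)"
        unfolding B_def
      proof (rule nn_integral_cong)
        fix \<omega> assume \<omega>: "\<omega> \<in> space P"
        have "0 \<le> ?w1 k \<omega>" "0 \<le> ?w2 k \<omega>"
          using C[OF \<omega>, of k] R_nonneg[of "X k \<omega>"] by (auto intro!: add_nonneg_nonneg mult_nonneg_nonneg)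
        then show "ennreal (?W k \<omega>) = 2 * ennreal (?w1 k \<omega>) + 2 * ennreal (?w2 k \<omega>)"
          unfolding W_def by (rule ennreal_twice_plus)
      qed
      also have "\<dots> = 2 * (\<integral>\<^sup>+ \<omega>. ennreal (?w1 k \<omega>) \<partial>P) + 2 * (\<integral>\<^sup>+ \<omega>. ennreal (?w2 k \<omega>) \<partial>P)"
        by (subst nn_integral_add) (simp_all add: nn_integral_cmult)
      finally have B_eq: "B k = \<dots>" .
      have i1: "(\<integral>\<^sup>+ \<omega>. ennreal (?w1 k \<omega>) \<partial>P) \<le> ?I2 k"
      proof (rule nn_integral_mono)
        fix \<omega> assume \<omega>: "\<omega> \<in> space P"
        have "ennreal (?w1 k \<omega>) = ennreal (C0 \<Phi> (X k \<omega>)) * ennreal (R (X k \<omega>)) * ennreal (exp (- (2 * \<nu> - \<delta>) * S k \<omega>))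
            + (ennreal (R (X k \<omega>)))\<^sup>2 * ennreal (exp (- 2 * (\<nu> - \<delta>) * S k \<omega>))"
          using C[OF \<omega>, of k] R_nonneg[of "X k \<omega>"]
          by (subst ennreal_plus) (auto simp: ennreal_mult ennreal_power intro!: mult_nonneg_nonneg)
        also have "\<dots> \<le> ennreal (C0 \<Phi> (X k \<omega>)) * Psi0 \<Phi> \<delta> (X k \<omega>) * ennreal (exp (- (2 * \<nu> - \<delta>) * S k \<omega>))
              + (Psi0 \<Phi> \<delta> (X k \<omega>))\<^sup>2 * ennreal (exp (- 2 * (\<nu> - \<delta>) * S k \<omega>))"
          using Psi[OF \<omega>, of k] by (intro add_mono mult_right_mono mult_left_mono power_mono) auto
        finally show "ennreal (?w1 k \<omega>) \<le> \<dots>" .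
      qed
      have "(\<integral>\<^sup>+ \<omega>. ennreal (?w2 k \<omega>) \<partial>P) \<le> (\<integral>\<^sup>+ \<omega>. ennreal (?w3 k \<omega>) + ?z k \<partial>P)"
      proof (rule nn_integral_mono)
        fix \<omega> assume \<omega>: "\<omega> \<in> space P"
        have e1: "exp (- (\<nu> + \<delta>) * S k \<omega>) \<le> 1"
        proof -
          have "0 \<le> (\<nu> + \<delta>) * S k \<omega>" using Snn[OF \<omega>, of k] \<delta> by (intro mult_nonneg_nonneg) auto
          then show ?thesis by (simp only: exp_le_one_iff minus_mult_left[symmetric] neg_le_0_iff_le)
        qed
        have w3: "0 \<le> ?w3 k \<omega>" using C[OF \<omega>, of k] R_nonneg[of "X k \<omega>"] by auto
        show "ennreal (?w2 k \<omega>) \<le> ennreal (?w3 k \<omega>) + ?z k"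
        proof (cases "k = 0")
          case True
          have "?w2 k \<omega> = ?w3 k \<omega> + exp (- (\<nu> + \<delta>) * S k \<omega>)" using True by (simp add: algebra_simps)
          then have "?w2 k \<omega> \<le> ?w3 k \<omega> + 1" using e1 by linarith
          then have "ennreal (?w2 k \<omega>) \<le> ennreal (?w3 k \<omega> + 1)" by (rule ennreal_leI)
          then show ?thesis using True w3 by (simp add: ennreal_plus del: ennreal_plus_if)
        next
          case False
          then have "?w2 k \<omega> \<le> ?w3 k \<omega>" by (intro mult_right_mono) auto
          then show ?thesis using False ennreal_leI by simp
        qed
      qed
      also have "\<dots> = (\<integral>\<^sup>+ \<omega>. ennreal (?w3 k \<omega>) \<partial>P) + ?z k"
        by (subst nn_integral_add) (simp_all add: P.emeasure_space_1)
      finally have i2: "(\<integral>\<^sup>+ \<omega>. ennreal (?w2 k \<omega>) \<partial>P) \<le> (\<integral>\<^sup>+ \<omega>. ennreal (?w3 k \<omega>) \<partial>P) + ?z k" .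
      have i3: "(\<integral>\<^sup>+ \<omega>. ennreal (?w3 k \<omega>) \<partial>P) \<le> ?I3 k"
      proof (rule nn_integral_mono)
        fix \<omega> assume \<omega>: "\<omega> \<in> space P"
        have "ennreal (?w3 k \<omega>) = (ennreal (C0 \<Phi> (X k \<omega>)) + ennreal (R (X k \<omega>)) + of_nat k) * ennreal (exp (- (\<nu> + \<delta>) * S k \<omega>))"
          using C[OF \<omega>, of k] R_nonneg[of "X k \<omega>"]
          by (simp add: ennreal_mult ennreal_plus ennreal_of_nat_eq_real_of_nat del: ennreal_plus_if)
        also have "\<dots> \<le> (ennreal (C0 \<Phi> (X k \<omega>)) + Psi0 \<Phi> \<delta> (X k \<omega>) + of_nat k) * ennreal (exp (- (\<nu> + \<delta>) * S k \<omega>))"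
          using Psi[OF \<omega>, of k] by (intro add_mono mult_right_mono) auto
        finally show "ennreal (?w3 k \<omega>) \<le> \<dots>" .
      qed
      show ?thesis unfolding B_eq
        by (intro add_mono mult_left_mono i1 order_trans[OF i2] i3) auto
    qed
    have "Bt \<le> (\<Sum>k. 2 * (ennreal (k1 ^ k) * ?I2 k) + (2 * (ennreal (k1 ^ k) * ?I3 k) + 2 * ?z k))"
      unfolding Bt_def
    proof (rule suminf_le)
      fix k
      have "ennreal (k1 ^ k) * B k \<le> ennreal (k1 ^ k) * (2 * ?I2 k + 2 * (?I3 k + ?z k))"
        by (intro mult_left_mono B_le) simp
      also have "\<dots> = 2 * (ennreal (k1 ^ k) * ?I2 k) + (2 * (ennreal (k1 ^ k) * ?I3 k) + 2 * ?z k)"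
        by (simp add: distrib_left mult_ac)
      finally show "ennreal (k1 ^ k) * B k \<le> \<dots>" .
    qed auto
    also have "\<dots> = 2 * (\<Sum>k. ennreal (k1 ^ k) * ?I2 k) + (2 * (\<Sum>k. ennreal (k1 ^ k) * ?I3 k) + 2 * (\<Sum>k. ?z k))"
      by (simp only: suminf_add[OF summableI summableI, symmetric] ennreal_suminf_cmult)
    finally have le: "Bt \<le> \<dots>" .
    have z: "(\<Sum>k. ?z k) = 1" using sums_unique[OF sums_single[of 0 "\<lambda>_. 1 :: ennreal"]] by simp
    have "2 * (\<Sum>k. ennreal (k1 ^ k) * ?I2 k) + (2 * (\<Sum>k. ennreal (k1 ^ k) * ?I3 k) + 2 * 1) < \<infinity>"
      using sum2 sum3 by (simp add: ennreal_mult_less_top)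
    with le[unfolded z] show ?thesis by (rule le_less_trans)
  qed
  define b where "b = enn2real Bt"
  have Bt: "Bt = ennreal b" using Bt_fin by (simp add: b_def)
  have b0: "0 \<le> b" by (simp add: b_def)
  \<comment> \<open>The weight of generation 0 is 1, so its terms lie below the full sums; the mean
    population is thereby controlled by \<open>m\<close> and \<open>b\<close>.\<close>
  have A0: "A 0 \<le> At" "B 0 \<le> Bt"
    using sum_le_suminf[of "\<lambda>k. ennreal (k1 ^ k) * A k" "{0}"] sum_le_suminf[of "\<lambda>k. ennreal (k1 ^ k) * B k" "{0}"]
    by (simp_all add: At_def Bt_def)
  \<comment> \<open>Generation 0 alone makes \<open>m\<close> positive, since \<open>C0\<close> is
    positive at every state.\<close>
  have "A 0 \<noteq> 0"
  proof
    assume "A 0 = 0"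
    then have "AE \<omega> in P. ennreal (?a 0 \<omega>) = 0" unfolding A_def by (subst (asm) nn_integral_0_iff_AE) auto
    then have "AE \<omega> in P. False"
      using AE_space
    proof eventually_elim
      case (elim \<omega>)
      have "0 < ?a 0 \<omega>" using C[OF elim(2), of 0] by simp
      then show ?case using elim(1) by (simp add: ennreal_eq_0_iff)
    qed
    then show False by (simp add: P.AE_False)
  qed
  then have "0 < At" using A0(1) by (metis le_zero_eq zero_less_iff_neq_zero)
  then show m0: "0 < m" by (simp add: At)
  \<comment> \<open>\<open>k2 * b\<close> stems from branching pairs, the remainder from comparable
    pairs through \<open>pop_mean_le\<close> and \<open>first_moment_bound\<close>.\<close>
  define b' where "b' = k2 * b + 1 + k1 * (3 + m + b)"
  have k: "0 < k1" "0 < k2" using k1_ge_2 k2_ge_2 by auto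
  have b'0: "0 \<le> b'" using k b0 m0 by (simp add: b'_def)
  have "pop_moment \<xi> \<kappa> T Y t \<tau> < \<infinity> \<and>
      \<bar>enn2real (pop_moment \<xi> \<kappa> T Y t \<tau>) - exp (\<nu> * (2 * t + \<tau>)) * k2 * m\<bar> \<le> exp (\<nu> * (2 * t + \<tau>)) * exp (- \<eta> * t) * b'"
    if t: "0 \<le> t" and \<tau>: "0 \<le> \<tau>" for t \<tau>
  proof -
    define e1 e2 where "e1 = exp (\<nu> * (2 * t + \<tau>))" and "e2 = exp (- \<eta> * t)"
    have e: "0 < e1" "0 < e2" by (auto simp: e1_def e2_def)
    define hh where "hh k \<omega> = h (X k \<omega>) (t - S k \<omega>) * h (X k \<omega>) (t + \<tau> - S k \<omega>)" for k \<omega>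
    have hhm[measurable]: "hh k \<in> borel_measurable P" for k unfolding hh_def by measurable
    define M where "M = (\<Sum>k. ennreal k1 ^ k * (ennreal k2 * (\<integral>\<^sup>+\<omega>. hh k \<omega> \<partial>P)))"
    let ?\<phi> = "\<lambda>c s. (if 0 \<le> s then 1 else 0) + exp (\<nu> * s) * f c s"
    have hh_eq: "hh k \<omega> = ennreal (?\<phi> (X k \<omega>) (t - S k \<omega>) * ?\<phi> (X k \<omega>) (t + \<tau> - S k \<omega>))" if "\<omega> \<in> space P" for k \<omega>
    proof -
      have "0 \<le> ?\<phi> (X k \<omega>) s" for s using f_nonneg[OF Xs[OF that]] by simp
      then show ?thesis unfolding hh_def h_eq[OF Xs[OF that]] by (intro ennreal_mult[symmetric])
    qed
    have a0: "0 \<le> ?a k \<omega>" for k \<omega> by simp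
    have W0: "0 \<le> ?W k \<omega>" if "\<omega> \<in> space P" for k \<omega> by (rule W_nonneg[OF Xs[OF that]])
    have up: "(\<integral>\<^sup>+\<omega>. hh k \<omega> \<partial>P) \<le> ennreal e1 * (A k + ennreal e2 * B k)" for k
    proof -
      have "(\<integral>\<^sup>+\<omega>. hh k \<omega> \<partial>P) \<le> (\<integral>\<^sup>+\<omega>. ennreal e1 * (ennreal (?a k \<omega>) + ennreal e2 * ennreal (?W k \<omega>)) \<partial>P)"
      proof (rule nn_integral_mono)
        fix \<omega> assume \<omega>: "\<omega> \<in> space P"
        have "hh k \<omega> \<le> ennreal (e1 * (?a k \<omega> + e2 * ?W k \<omega>))"
          unfolding hh_eq[OF \<omega>] e1_def e2_def by (rule ennreal_leI, rule product_expansion(1)[OF Xs[OF \<omega>] t \<tau>])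
        also have "\<dots> = ennreal e1 * (ennreal (?a k \<omega>) + ennreal e2 * ennreal (?W k \<omega>))"
          using e W0[OF \<omega>, of k] by (simp add: ennreal_mult ennreal_plus del: ennreal_plus_if)
        finally show "hh k \<omega> \<le> \<dots>" .
      qed
      also have "\<dots> = ennreal e1 * (A k + ennreal e2 * B k)"
        unfolding A_def B_def by (simp add: nn_integral_cmult nn_integral_add)
      finally show ?thesis .
    qed
    \<comment> \<open>The error is added on the right rather than subtracted on the left, to avoid
      truncated subtraction in \<open>ennreal\<close>.\<close>
    have low: "ennreal e1 * A k \<le> (\<integral>\<^sup>+\<omega>. hh k \<omega> \<partial>P) + ennreal (e1 * e2) * B k" for k
    proof -
      have "ennreal e1 * A k = (\<integral>\<^sup>+\<omega>. ennreal e1 * ennreal (?a k \<omega>) \<partial>P)"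
        unfolding A_def by (simp add: nn_integral_cmult)
      also have "\<dots> \<le> (\<integral>\<^sup>+\<omega>. hh k \<omega> + ennreal (e1 * e2) * ennreal (?W k \<omega>) \<partial>P)"
      proof (rule nn_integral_mono)
        fix \<omega> assume \<omega>: "\<omega> \<in> space P"
        have pos: "0 \<le> ?\<phi> (X k \<omega>) (t - S k \<omega>) * ?\<phi> (X k \<omega>) (t + \<tau> - S k \<omega>)"
          using f_nonneg[OF Xs[OF \<omega>]] by (intro mult_nonneg_nonneg) simp_all
        have "ennreal e1 * ennreal (?a k \<omega>) = ennreal (e1 * ?a k \<omega>)" using e a0[of k \<omega>] by (intro ennreal_mult[symmetric]) auto
        also have "\<dots> \<le> ennreal (?\<phi> (X k \<omega>) (t - S k \<omega>) * ?\<phi> (X k \<omega>) (t + \<tau> - S k \<omega>) + e1 * e2 * ?W k \<omega>)"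
          unfolding e1_def e2_def by (rule ennreal_leI, rule product_expansion(2)[OF Xs[OF \<omega>] t \<tau>])
        also have "\<dots> = hh k \<omega> + ennreal (e1 * e2) * ennreal (?W k \<omega>)"
          unfolding hh_eq[OF \<omega>] using e W0[OF \<omega>, of k] pos
          by (subst ennreal_plus) (auto simp: ennreal_mult)
        finally show "ennreal e1 * ennreal (?a k \<omega>) \<le> \<dots>" .
      qed
      also have "\<dots> = (\<integral>\<^sup>+\<omega>. hh k \<omega> \<partial>P) + ennreal (e1 * e2) * B k"
        unfolding B_def by (subst nn_integral_add) (simp_all add: nn_integral_cmult)
      finally show ?thesis .
    qed
    have M_up: "M \<le> ennreal (k2 * e1 * (m + e2 * b))"
    proof -
      have "M \<le> (\<Sum>k. ennreal (k2 * e1) * (ennreal (k1 ^ k) * A k) + ennreal (k2 * e1 * e2) * (ennreal (k1 ^ k) * B k))"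
        unfolding M_def
      proof (rule suminf_le)
        fix j
        have "ennreal k1 ^ j * (ennreal k2 * (\<integral>\<^sup>+\<omega>. hh j \<omega> \<partial>P)) \<le> ennreal k1 ^ j * (ennreal k2 * (ennreal e1 * (A j + ennreal e2 * B j)))"
          by (intro mult_left_mono up) auto
        also have "\<dots> = ennreal (k2 * e1) * (ennreal (k1 ^ j) * A j) + ennreal (k2 * e1 * e2) * (ennreal (k1 ^ j) * B j)"
          using k e by (simp add: ennreal_mult ennreal_power distrib_left mult_ac)
        finally show "ennreal k1 ^ j * (ennreal k2 * (\<integral>\<^sup>+\<omega>. hh j \<omega> \<partial>P)) \<le> \<dots>" .
      qed auto
      also have "\<dots> = ennreal (k2 * e1) * At + ennreal (k2 * e1 * e2) * Bt"
        unfolding At_def Bt_def by (simp only: suminf_add[OF summableI summableI, symmetric] ennreal_suminf_cmult)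
      also have "\<dots> = ennreal (k2 * e1 * (m + e2 * b))"
        unfolding At Bt using k e m0 b0 by (simp add: ennreal_plus[symmetric] ennreal_mult[symmetric] distrib_left mult_ac del: ennreal_plus)
      finally show ?thesis .
    qed
    have M_low: "ennreal (k2 * e1 * m) \<le> M + ennreal (k2 * e1 * e2 * b)"
    proof -
      have "ennreal (k2 * e1 * m) = ennreal (k2 * e1) * At"
        unfolding At using k e m0 by (simp add: ennreal_mult)
      also have "\<dots> = (\<Sum>k. ennreal (k2 * e1) * (ennreal (k1 ^ k) * A k))" by (simp add: At_def)
      also have "\<dots> \<le> (\<Sum>k. ennreal k1 ^ k * (ennreal k2 * (\<integral>\<^sup>+\<omega>. hh k \<omega> \<partial>P)) + ennreal (k2 * e1 * e2) * (ennreal (k1 ^ k) * B k))"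
      proof (rule suminf_le)
        fix j
        have "ennreal (k2 * e1) * (ennreal (k1 ^ j) * A j) = ennreal k1 ^ j * (ennreal k2 * (ennreal e1 * A j))"
          using k e by (simp add: ennreal_mult ennreal_power mult_ac)
        also have "\<dots> \<le> ennreal k1 ^ j * (ennreal k2 * ((\<integral>\<^sup>+\<omega>. hh j \<omega> \<partial>P) + ennreal (e1 * e2) * B j))"
          by (intro mult_left_mono low) auto
        also have "\<dots> = ennreal k1 ^ j * (ennreal k2 * (\<integral>\<^sup>+\<omega>. hh j \<omega> \<partial>P)) + ennreal (k2 * e1 * e2) * (ennreal (k1 ^ j) * B j)"
          using k e by (simp add: ennreal_mult ennreal_power distrib_left mult_ac)
        finally show "ennreal (k2 * e1) * (ennreal (k1 ^ j) * A j) \<le> \<dots>" .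
      qed auto
      also have "\<dots> = M + ennreal (k2 * e1 * e2) * Bt"
        unfolding M_def Bt_def by (simp only: suminf_add[OF summableI summableI, symmetric] ennreal_suminf_cmult)
      also have "ennreal (k2 * e1 * e2) * Bt = ennreal (k2 * e1 * e2 * b)"
        unfolding Bt using k e b0 by (simp add: ennreal_mult)
      finally show ?thesis .
    qed
    \<comment> \<open>The growth of the mean population at time \<open>t + \<tau>\<close>. It stays
      below \<open>e1 * e2\<close> because \<open>\<eta> \<le> \<nu>\<close>, so comparable pairs
      fit into the error term.\<close>
    define e3 where "e3 = exp (\<nu> * (t + \<tau>))"
    have e3: "0 < e3" "1 \<le> e3" "e3 \<le> e1 * e2"
    proof -
      show "0 < e3" "1 \<le> e3" using \<nu>_pos t \<tau> by (auto simp: e3_def)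
      have "\<eta> * t \<le> \<nu> * t" using t \<delta> by (intro mult_right_mono) (auto simp: \<eta>_def)
      then show "e3 \<le> e1 * e2" unfolding e1_def e2_def e3_def exp_add[symmetric] by (simp add: algebra_simps)
    qed
    have first: "(\<integral>\<^sup>+\<omega>. h (X 0 \<omega>) (t + \<tau> - S 0 \<omega>) \<partial>P) \<le> ennreal (e3 * (3 + m + b))"
    proof -
      have "(\<integral>\<^sup>+\<omega>. h (X 0 \<omega>) (t + \<tau> - S 0 \<omega>) \<partial>P) \<le> (\<integral>\<^sup>+\<omega>. ennreal e3 * (3 + ennreal (?a 0 \<omega>) + ennreal (?W 0 \<omega>)) \<partial>P)"
      proof (rule nn_integral_mono)
        fix \<omega> assume \<omega>: "\<omega> \<in> space P"
        have "h (X 0 \<omega>) (t + \<tau> - S 0 \<omega>) \<le> ennreal (e3 * (3 + ?a 0 \<omega> + ?W 0 \<omega>))"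
          unfolding h_eq[OF Xs[OF \<omega>]] e3_def by (rule ennreal_leI, rule first_moment_bound[OF Xs[OF \<omega>]]) (use t \<tau> in simp)
        also have "\<dots> = ennreal e3 * (3 + ennreal (?a 0 \<omega>) + ennreal (?W 0 \<omega>))"
          using e3 W0[OF \<omega>, of 0] by (simp add: ennreal_mult ennreal_plus del: ennreal_plus_if)
        finally show "h (X 0 \<omega>) (t + \<tau> - S 0 \<omega>) \<le> \<dots>" .
      qed
      also have "\<dots> = ennreal e3 * (3 + A 0 + B 0)"
        unfolding A_def B_def by (simp add: nn_integral_cmult nn_integral_add P.emeasure_space_1)
      also have "\<dots> \<le> ennreal e3 * (3 + At + Bt)" by (intro mult_left_mono add_mono A0) auto
      also have "\<dots> = ennreal (e3 * (3 + m + b))"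
        unfolding At Bt using e3 m0 b0 by (simp add: ennreal_mult ennreal_plus del: ennreal_plus_if)
      finally show ?thesis .
    qed
    let ?p = "pop_moment \<xi> \<kappa> T Y t \<tau>"
    have bounds: "M \<le> ?p" "?p \<le> M + (1 + ennreal k1 * (\<integral>\<^sup>+\<omega>. h (X 0 \<omega>) (t + \<tau> - S 0 \<omega>) \<partial>P))"
      using pop_moment_bounds[OF \<tau>, of t] by (simp_all add: M_def hh_def)
    have "?p \<le> ennreal (k2 * e1 * (m + e2 * b)) + (1 + ennreal k1 * ennreal (e3 * (3 + m + b)))"
      using bounds(2) M_up first by (meson add_mono mult_left_mono order_refl order_trans zero_le)
    also have "\<dots> = ennreal (k2 * e1 * (m + e2 * b) + (1 + k1 * (e3 * (3 + m + b))))"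
      using k e e3 m0 b0 by (simp add: ennreal_mult[symmetric] ennreal_plus ennreal_1[symmetric] del: ennreal_plus_if ennreal_1)
    finally have p_up: "?p \<le> ennreal (k2 * e1 * (m + e2 * b) + (1 + k1 * (e3 * (3 + m + b))))" .
    then have fin: "?p < \<infinity>" using ennreal_less_top le_less_trans by (metis infinity_ennreal_def)
    define p where "p = enn2real ?p"
    have p: "?p = ennreal p" "0 \<le> p" using fin by (auto simp: p_def)
    have nn: "0 \<le> k2 * e1 * (m + e2 * b) + (1 + k1 * (e3 * (3 + m + b)))" "0 \<le> k2 * e1 * e2 * b"
      using k e e3 m0 b0 by auto
    have p1: "p \<le> k2 * e1 * (m + e2 * b) + (1 + k1 * (e3 * (3 + m + b)))"
      using p_up nn(1) unfolding p(1) by simp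
    have "ennreal (k2 * e1 * m) \<le> ennreal p + ennreal (k2 * e1 * e2 * b)"
      using M_low bounds(1) unfolding p(1) by (meson add_right_mono order_trans)
    then have "ennreal (k2 * e1 * m) \<le> ennreal (p + k2 * e1 * e2 * b)"
      by (simp only: ennreal_plus[OF p(2) nn(2)])
    then have p2: "k2 * e1 * m \<le> p + k2 * e1 * e2 * b"
      by (subst (asm) ennreal_le_iff) (use p(2) nn(2) in simp_all)
    have x1: "1 + k1 * (e3 * (3 + m + b)) \<le> e1 * e2 * (1 + k1 * (3 + m + b))"
    proof -
      have "1 + k1 * (e3 * (3 + m + b)) \<le> e3 + k1 * (e3 * (3 + m + b))" using e3 by simp
      also have "\<dots> = e3 * (1 + k1 * (3 + m + b))" by (simp add: algebra_simps)
      also have "\<dots> \<le> e1 * e2 * (1 + k1 * (3 + m + b))" using e3 k m0 b0 by (intro mult_right_mono) auto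
      finally show ?thesis .
    qed
    have x2: "0 \<le> e1 * e2 * (1 + k1 * (3 + m + b))" using e k m0 b0 by simp
    have eq1: "e1 * e2 * b' = k2 * e1 * e2 * b + e1 * e2 * (1 + k1 * (3 + m + b))"
      by (simp add: b'_def algebra_simps)
    have eq2: "k2 * e1 * (m + e2 * b) = k2 * e1 * m + k2 * e1 * e2 * b" by (simp add: algebra_simps)
    have "\<bar>p - k2 * e1 * m\<bar> \<le> e1 * e2 * b'"
      using p1 p2 x1 x2 unfolding eq1 eq2 by linarith
    then show ?thesis using fin unfolding p_def e1_def e2_def by (simp add: mult_ac)
  qed
  then show "\<exists>b\<ge>0. \<forall>t\<ge>0. \<forall>\<tau>\<ge>0. pop_moment \<xi> \<kappa> T Y t \<tau> < \<infinity> \<and>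
      \<bar>enn2real (pop_moment \<xi> \<kappa> T Y t \<tau>) - exp (\<nu> * (2 * t + \<tau>)) * k2 * m\<bar> \<le> exp (\<nu> * (2 * t + \<tau>)) * exp (- \<eta> * t) * b"
    using b'0 by blast
qed

end

theorem proposition3p9:
  fixes E :: "'x measure"
    and \<xi> :: "'x \<Rightarrow> real"
    and \<kappa> :: "'x \<Rightarrow> nat"
    and P :: "'p measure"
    and X :: "nat \<Rightarrow> 'p \<Rightarrow> 'x"
    and X' :: "nat \<Rightarrow> nat \<Rightarrow> 'p \<Rightarrow> 'x"
    and Q :: "'x \<Rightarrow> (nat \<Rightarrow> 'x) measure"
    and T :: "'t measure"
    and Y :: "nat list \<Rightarrow> 't \<Rightarrow> 'x"
    and \<Phi> :: "'x \<Rightarrow> complex \<Rightarrow> complex"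
    and \<nu> \<kappa>\<^sub>1 \<kappa>\<^sub>2 \<delta> \<epsilon> :: real
    and S :: "nat \<Rightarrow> 'p \<Rightarrow> real"
  assumes model: "branching_model E \<xi> \<kappa> P X T Y"
    and nu: "\<nu> = real_of_ereal (malthus \<xi> \<kappa> P X)"
    and k1: "\<kappa>\<^sub>1 = kappa1 \<kappa> P X"
    and k2: "\<kappa>\<^sub>2 = kappa2 \<kappa> P X"
    and S: "\<And>n \<omega>. S n \<omega> = life_sum \<xi> (\<lambda>j. X j \<omega>) n"
    and markov: "markov_independence E \<xi> \<kappa> P X X' Q T Y"
    and analytic: "analyticity E \<xi> \<kappa>\<^sub>1 \<nu> Q \<Phi> \<delta> \<epsilon>"
    and sum1: "(\<Sum>k. ennreal (\<kappa>\<^sub>1 ^ k) *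
        (\<integral>\<^sup>+ \<omega>. ennreal ((C0 \<Phi> (X k \<omega>))\<^sup>2 * exp (- 2 * \<nu> * S k \<omega>)) \<partial>P)) < \<infinity>"
    and sum2: "(\<Sum>k. ennreal (\<kappa>\<^sub>1 ^ k) *
        (\<integral>\<^sup>+ \<omega>. ennreal (C0 \<Phi> (X k \<omega>)) * Psi0 \<Phi> \<delta> (X k \<omega>) * ennreal (exp (- (2 * \<nu> - \<delta>) * S k \<omega>))
              + (Psi0 \<Phi> \<delta> (X k \<omega>))\<^sup>2 * ennreal (exp (- 2 * (\<nu> - \<delta>) * S k \<omega>)) \<partial>P)) < \<infinity>"
    and sum3: "(\<Sum>k. ennreal (\<kappa>\<^sub>1 ^ k) *
        (\<integral>\<^sup>+ \<omega>. (ennreal (C0 \<Phi> (X k \<omega>)) + Psi0 \<Phi> \<delta> (X k \<omega>) + of_nat k)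
              * ennreal (exp (- (\<nu> + \<delta>) * S k \<omega>)) \<partial>P)) < \<infinity>"
  shows "(\<forall>t>0. \<forall>\<tau>\<ge>0. pop_moment \<xi> \<kappa> T Y t \<tau> < \<infinity>) \<and>
    (\<exists>a>0. \<exists>\<epsilon>\<^sub>1>0. \<exists>c :: real \<Rightarrow> real \<Rightarrow> real. \<forall>\<^sub>F t in at_top. \<forall>\<tau>\<ge>0.
       \<bar>c t \<tau>\<bar> \<le> a \<and>
       enn2real (pop_moment \<xi> \<kappa> T Y t \<tau>) =
         exp (\<nu> * (2 * t + \<tau>)) * \<kappa>\<^sub>2
         * enn2real (\<Sum>k. ennreal (\<kappa>\<^sub>1 ^ k) *
             (\<integral>\<^sup>+ \<omega>. ennreal ((C0 \<Phi> (X k \<omega>))\<^sup>2 * exp (- 2 * \<nu> * S k \<omega>)) \<partial>P))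
         * (1 + c t \<tau> * exp (- \<epsilon>\<^sub>1 * t)))"
proof -
  interpret analytic_branching E \<xi> \<kappa> P X X' Q T Y \<Phi> \<nu> \<delta> \<epsilon>
    using model markov nu analytic unfolding k1 by unfold_locales
  define m where "m = enn2real (\<Sum>k. ennreal (\<kappa>\<^sub>1 ^ k) *
             (\<integral>\<^sup>+ \<omega>. ennreal ((C0 \<Phi> (X k \<omega>))\<^sup>2 * exp (- 2 * \<nu> * S k \<omega>)) \<partial>P))"
  note asym = second_moment_asymptotics[OF sum1[unfolded S k1] sum2[unfolded S k1] sum3[unfolded S k1],
      folded S k1 k2, folded m_def]
  from asym(2) obtain b where b: "0 \<le> b" "\<And>t \<tau>. 0 \<le> t \<Longrightarrow> 0 \<le> \<tau> \<Longrightarrow> pop_moment \<xi> \<kappa> T Y t \<tau> < \<infinity>"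
    "\<And>t \<tau>. 0 \<le> t \<Longrightarrow> 0 \<le> \<tau> \<Longrightarrow> \<bar>enn2real (pop_moment \<xi> \<kappa> T Y t \<tau>) - exp (\<nu> * (2 * t + \<tau>)) * \<kappa>\<^sub>2 * m\<bar>
        \<le> exp (\<nu> * (2 * t + \<tau>)) * exp (- \<eta> * t) * b"
    by blast
  define d where "d = \<kappa>\<^sub>2 * m"
  have d: "0 < d" using asym(1) k2_ge_2 by (simp add: d_def k2)
  \<comment> \<open>The required expansion solved for its coefficient; only the bound on it carries
    information.\<close>
  define c where "c t \<tau> = (enn2real (pop_moment \<xi> \<kappa> T Y t \<tau>) / (exp (\<nu> * (2 * t + \<tau>)) * d) - 1) / exp (- \<eta> * t)" for t \<tau>
  \<comment> \<open>The summand 1 keeps the constant positive even when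
    \<open>b = 0\<close>.\<close>
  have bound: "\<bar>c t \<tau>\<bar> \<le> b / d + 1"
    and expansion: "enn2real (pop_moment \<xi> \<kappa> T Y t \<tau>) = exp (\<nu> * (2 * t + \<tau>)) * \<kappa>\<^sub>2 * m * (1 + c t \<tau> * exp (- \<eta> * t))"
    if t: "0 \<le> t" "0 \<le> \<tau>" for t \<tau>
  proof -
    define p e1 e2 where "p = enn2real (pop_moment \<xi> \<kappa> T Y t \<tau>)" and "e1 = exp (\<nu> * (2 * t + \<tau>))" and "e2 = exp (- \<eta> * t)"
    have e: "0 < e1" "0 < e2" by (auto simp: e1_def e2_def)
    have c: "c t \<tau> = (p - e1 * d) / (e1 * d * e2)"
      unfolding c_def p_def[symmetric] e1_def[symmetric] e2_def[symmetric] using e d by (simp add: field_simps)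
    have "\<bar>p - e1 * d\<bar> \<le> e1 * e2 * b"
      using b(3)[OF t] by (simp add: p_def e1_def e2_def d_def mult.assoc)
    then have "\<bar>p - e1 * d\<bar> / (e1 * d * e2) \<le> e1 * e2 * b / (e1 * d * e2)"
      using e d by (intro divide_right_mono) auto
    also have "\<dots> = b / d" using e d by simp
    finally show "\<bar>c t \<tau>\<bar> \<le> b / d + 1" unfolding c using e d by (simp add: abs_mult)
    have "p = e1 * d * (1 + c t \<tau> * e2)" unfolding c using e d by (simp add: field_simps)
    then show "enn2real (pop_moment \<xi> \<kappa> T Y t \<tau>) = exp (\<nu> * (2 * t + \<tau>)) * \<kappa>\<^sub>2 * m * (1 + c t \<tau> * exp (- \<eta> * t))"
      by (simp add: p_def e1_def e2_def d_def mult.assoc)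
  qed
  have "0 < b / d + 1" using b(1) d by (simp add: add_nonneg_pos)
  then have "\<exists>a>0. \<exists>\<epsilon>\<^sub>1>0. \<exists>c :: real \<Rightarrow> real \<Rightarrow> real. \<forall>\<^sub>F t in at_top. \<forall>\<tau>\<ge>0.
       \<bar>c t \<tau>\<bar> \<le> a \<and>
       enn2real (pop_moment \<xi> \<kappa> T Y t \<tau>) = exp (\<nu> * (2 * t + \<tau>)) * \<kappa>\<^sub>2 * m * (1 + c t \<tau> * exp (- \<epsilon>\<^sub>1 * t))"
    using \<eta>_pos bound expansion
    by (intro exI[of _ "b / d + 1"] exI[of _ \<eta>] exI[of _ c] conjI eventually_mono[OF eventually_ge_at_top[of 0]]) auto
  then show ?thesis using b(2) unfolding m_def by auto
qed

end
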